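(* Let $n\ge 3$. For every $\lambda\in(0,n-1)$ there exists a vector field $u\in L^{n-\lambda}(\mathbb{R}^n;\mathbb{R}^n)$ with $\operatorname{div}u=0$ such that there is a bounded weak solution $v$ of the elliptic equation $$-\Delta v+(u\cdot\nabla)v=0$$ in the unit ball of $\mathbb{R}^n$ centered at the origin which is not continuous at the origin.
   Context: $\operatorname{div}u=0$ is understood in the sense of distributions. A weak solution is a scalar function $v\in H^1$ of the unit ball solving the equation in the sense of distributions. Since $v$ is defined up to null sets, "not continuous at the origin" means that no function agreeing almost everywhere with $v$ is continuous at the origin. *)

theory Defs
  imports "HOL-Analysis.Analysis"
begin

text \<open>
  Functions on an open set \<open>\<Omega>\<close> are total functions of which only the values on \<open>\<Omega>\<close> matter.
  Test functions are defined on the whole space, i.e. extended by zero.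
\<close>

definition partial_deriv :: "'a::euclidean_space \<Rightarrow> ('a \<Rightarrow> real) \<Rightarrow> 'a \<Rightarrow> real" where
  "partial_deriv b f x = frechet_derivative f (at x) b"

definition grad :: "('a::euclidean_space \<Rightarrow> real) \<Rightarrow> 'a \<Rightarrow> 'a" where
  "grad f x = (\<Sum>b\<in>Basis. partial_deriv b f x *\<^sub>R b)"

definition laplacian :: "('a::euclidean_space \<Rightarrow> real) \<Rightarrow> 'a \<Rightarrow> real" where
  "laplacian f x = (\<Sum>b\<in>Basis. partial_deriv b (partial_deriv b f) x)"

primrec Ck :: "nat \<Rightarrow> ('a::euclidean_space \<Rightarrow> real) \<Rightarrow> bool" where
  "Ck 0 f \<longleftrightarrow> continuous_on UNIV f"
| "Ck (Suc k) f \<longleftrightarrow> f differentiable_on UNIV \<and> (\<forall>b\<in>Basis. Ck k (partial_deriv b f))"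

definition test_function_on :: "'a::euclidean_space set \<Rightarrow> ('a \<Rightarrow> real) \<Rightarrow> bool" where
  "test_function_on \<Omega> \<phi> \<longleftrightarrow>
     (\<forall>k. Ck k \<phi>) \<and> compact (closure {x. \<phi> x \<noteq> 0}) \<and> closure {x. \<phi> x \<noteq> 0} \<subseteq> \<Omega>"

definition Lp_on :: "real \<Rightarrow> 'a::euclidean_space set \<Rightarrow> ('a \<Rightarrow> 'b::euclidean_space) \<Rightarrow> bool" where
  "Lp_on p \<Omega> f \<longleftrightarrow>
     f \<in> borel_measurable (lebesgue_on \<Omega>) \<and>
     integrable (lebesgue_on \<Omega>) (\<lambda>x. norm (f x) powr p)"

definition locally_integrable_on ::
    "'a::euclidean_space set \<Rightarrow> ('a \<Rightarrow> 'b::euclidean_space) \<Rightarrow> bool" where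
  "locally_integrable_on \<Omega> f \<longleftrightarrow>
     (\<forall>K. compact K \<and> K \<subseteq> \<Omega> \<longrightarrow> integrable (lebesgue_on K) f)"

definition div_free_on :: "'a::euclidean_space set \<Rightarrow> ('a \<Rightarrow> 'a) \<Rightarrow> bool" where
  "div_free_on \<Omega> u \<longleftrightarrow> locally_integrable_on \<Omega> u \<and>
     (\<forall>\<phi>. test_function_on \<Omega> \<phi> \<longrightarrow> (LINT x|lebesgue_on \<Omega>. u x \<bullet> grad \<phi> x) = 0)"

definition weak_gradient_on ::
    "'a::euclidean_space set \<Rightarrow> ('a \<Rightarrow> real) \<Rightarrow> ('a \<Rightarrow> 'a) \<Rightarrow> bool" where
  "weak_gradient_on \<Omega> v g \<longleftrightarrow>
     locally_integrable_on \<Omega> v \<and> locally_integrable_on \<Omega> g \<and>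
     (\<forall>\<phi>. test_function_on \<Omega> \<phi> \<longrightarrow> (\<forall>b\<in>Basis.
        (LINT x|lebesgue_on \<Omega>. v x * partial_deriv b \<phi> x) =
        - (LINT x|lebesgue_on \<Omega>. (g x \<bullet> b) * \<phi> x)))"

definition H1_on :: "'a::euclidean_space set \<Rightarrow> ('a \<Rightarrow> real) \<Rightarrow> bool" where
  "H1_on \<Omega> v \<longleftrightarrow> Lp_on 2 \<Omega> v \<and> (\<exists>g. weak_gradient_on \<Omega> v g \<and> Lp_on 2 \<Omega> g)"

text \<open>
  Weak solutions of \<open>- \<Delta> v + (u \<bullet> \<nabla>) v = 0\<close>. For \<open>u\<close> in \<open>L\<^sup>p\<close> with \<open>p < 2\<close> the product of
  \<open>u\<close> with the weak gradient \<open>g\<close> of \<open>v\<close> need not be locally integrable, whence the explicit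
  requirement: without it the product defines no distribution, and the Bochner integral below
  could be \<open>0\<close> by default. The choice of \<open>g\<close> is immaterial, since it is unique up to null sets.
\<close>

definition weak_solution_on ::
    "'a::euclidean_space set \<Rightarrow> ('a \<Rightarrow> 'a) \<Rightarrow> ('a \<Rightarrow> real) \<Rightarrow> bool" where
  "weak_solution_on \<Omega> u v \<longleftrightarrow> H1_on \<Omega> v \<and>
     (\<exists>g. weak_gradient_on \<Omega> v g \<and> locally_integrable_on \<Omega> (\<lambda>x. u x \<bullet> g x) \<and>
        (\<forall>\<phi>. test_function_on \<Omega> \<phi> \<longrightarrow>
           - (LINT x|lebesgue_on \<Omega>. v x * laplacian \<phi> x)
           + (LINT x|lebesgue_on \<Omega>. (u x \<bullet> g x) * \<phi> x) = 0))"

definition ess_bounded_on :: "'a::euclidean_space set \<Rightarrow> ('a \<Rightarrow> real) \<Rightarrow> bool" where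
  "ess_bounded_on \<Omega> v \<longleftrightarrow> (\<exists>C. AE x in lebesgue_on \<Omega>. \<bar>v x\<bar> \<le> C)"

end

theory Submission
  imports Defs
begin

text \<open>
  Write \<open>r = |x|\<close>, \<open>z = x \<bullet> e\<close> for a coordinate direction \<open>e\<close>, \<open>\<beta> = 1/m\<close> for a large natural
  number \<open>m\<close>, and \<open>h(r) = (1 + r\<^sup>\<beta>)/r\<close>. The solution is \<open>v = z h(r)\<close>, a perturbation of the
  discontinuous function \<open>z/r\<close>. The map \<open>x \<mapsto> h(r) x\<close> blows the origin up to the unit sphere, and it
  turns the level sets of \<open>v\<close> into parts of parallel hyperplanes: the levels below 1 emanate from
  the origin, those above 1 cross the axis. A divergence-free drift with \<open>u \<bullet> \<nabla>v = \<Delta>v\<close> is obtained by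
  integrating \<open>\<Delta>v\<close> radially along these hyperplanes, starting from zero on the unit ball. This gives
  \<open>u = (n - 1) A e + (x \<bullet> \<nabla>A) e - (e \<bullet> \<nabla>A) x\<close>, where
  \<open>A = z h\<^sup>n \<integral>\<^sub>0\<^sup>1 t\<^sup>n\<^sup>-\<^sup>2 P(h\<^sup>2 (z\<^sup>2 + t\<^sup>2 (r\<^sup>2 - z\<^sup>2))) dt\<close> with an explicit \<open>C\<^sup>1\<close> profile \<open>P\<close>
  supported in \<open>[1, \<infinity>)\<close>, times a radial cutoff. Since \<open>|u| \<le> C r\<^sup>-\<^sup>1\<^sup>-\<^sup>2\<^sup>\<beta>\<close>, every exponent \<open>p < n\<close>
  is admissible once \<open>m\<close> is large.
\<close>

subsection \<open>Integration by parts and difference quotients\<close>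

text \<open>The obstacle is the axis through \<open>e\<close>. The gradient of \<open>z/r\<close>
  vanishes there while its Laplacian \<open>-(n - 1) z/r^3\<close> does not, so no finite drift can
  balance the two. The extra term cures this: on the positive half axis
  \<open>v = 1 + r^\<beta>\<close>, whose slope \<open>\<beta> r^(\<beta> - 1)\<close> is positive,
  and for small \<beta> the price is only a small additional power of \<open>1/r\<close> in
  \<open>u\<close>. With \<beta> = 1/m, the quantity \<open>y = r^\<beta>\<close> satisfies
  \<open>y^(m (n - 2)) = r^(n - 2)\<close>; the equation for the profile is then solved by a natural
  power of \<open>y\<close> times a smooth factor, and \<open>P\<close> leaves zero to an order high
  enough to be C1. The second difficulty is the origin, where all fields blow up. The weak
  identities survive as long as the blow-up order is below \<open>n\<close>: it is
  \<open>1 + 2 \<beta>\<close> for \<open>u\<close> and its potentials' derivatives, 1 for the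
  gradient of \<open>v\<close> and 2 for its second derivatives. The last is where
  \<open>n \<ge> 3\<close> enters.\<close>

lemma partial_deriv_eq:
  assumes "(f has_derivative f') (at x)"
  shows "partial_deriv b f x = f' b"
  by (simp add: partial_deriv_def frechet_derivative_at[OF assms, symmetric])

lemma partial_deriv_has_derivative_at:
  assumes "f differentiable (at (x + s *\<^sub>R b))"
  shows "((\<lambda>t. f (x + t *\<^sub>R b)) has_real_derivative partial_deriv b f (x + s *\<^sub>R b)) (at s)"
proof -
  let ?f' = "frechet_derivative f (at (x + s *\<^sub>R b))"
  have D: "(f has_derivative ?f') (at (x + s *\<^sub>R b))"
    using assms by (simp add: frechet_derivative_works)
  have lin: "linear ?f'"
    using assms by (rule linear_frechet_derivative)
  have "((\<lambda>t. x + t *\<^sub>R b) has_derivative (\<lambda>t. t *\<^sub>R b)) (at s)"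
    by (auto intro!: derivative_eq_intros)
  from has_derivative_compose[OF this D] show ?thesis
    unfolding has_field_derivative_def partial_deriv_def
    by (rule has_derivative_eq_rhs) (simp add: linear_cmul[OF lin] fun_eq_iff)
qed

definition diff_quot :: "real \<Rightarrow> 'a::euclidean_space \<Rightarrow> ('a \<Rightarrow> real) \<Rightarrow> 'a \<Rightarrow> real" where
  "diff_quot h b f x = (f (x + h *\<^sub>R b) - f x) / h"

text \<open>One continuous derivative is asked, matching the regularity of the potentials of the
  drift, whose profile \<open>P\<close> is only C1. The radius is a parameter so that it can supply
  dominating indicators in limit arguments.\<close>

definition C1_cpt :: "real \<Rightarrow> ('a::euclidean_space \<Rightarrow> real) \<Rightarrow> bool" where
  "C1_cpt R f \<longleftrightarrow> (\<forall>x. f differentiable (at x)) \<and>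
     (\<forall>b\<in>Basis. continuous_on UNIV (partial_deriv b f)) \<and> (\<forall>x. norm x > R \<longrightarrow> f x = 0)"

lemma partial_deriv_zero_outside:
  assumes "\<And>x. norm x > R \<Longrightarrow> f x = 0" "norm x > R"
  shows "partial_deriv b f x = 0"
proof -
  have "open {x::'a. norm x > R}" by (intro open_Collect_less continuous_intros)
  then have "(f has_derivative (\<lambda>_. 0)) (at x)"
    by (rule has_derivative_transform_within_open[OF has_derivative_const[of 0]]) (simp_all add: assms)
  from partial_deriv_eq[OF this] show ?thesis .
qed

lemma C1_cpt_partial_zero:
  assumes "C1_cpt R f" "norm x > R"
  shows "partial_deriv b f x = 0"
  by (rule partial_deriv_zero_outside[OF _ assms(2)]) (use assms(1) in \<open>simp add: C1_cpt_def\<close>)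

lemma continuous_cpt_bounded:
  fixes g :: "'a::euclidean_space \<Rightarrow> real"
  assumes "continuous_on UNIV g" "\<And>x. norm x > R \<Longrightarrow> g x = 0"
  obtains C where "0 \<le> C" "\<And>x. \<bar>g x\<bar> \<le> C"
proof -
  have "bounded (g ` cball 0 R)"
    by (intro compact_imp_bounded compact_continuous_image continuous_on_subset[OF assms(1)]) auto
  then obtain C where "\<forall>y\<in>g ` cball 0 R. norm y \<le> C"
    unfolding bounded_iff by blast
  then have C: "\<And>x. x \<in> cball 0 R \<Longrightarrow> \<bar>g x\<bar> \<le> C" by simp
  have "\<bar>g x\<bar> \<le> max C 0" for x
    using C[of x] assms(2)[of x] by (cases "norm x > R") (simp_all add: max_def, linarith)
  then show thesis by (rule that[rotated]) simp
qed

lemma C1_cpt_cont: "C1_cpt R f \<Longrightarrow> continuous_on UNIV f"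
  by (simp add: C1_cpt_def continuous_at_imp_continuous_on differentiable_imp_continuous_within)

lemma integrable_cpt_bound:
  fixes g :: "'a::euclidean_space \<Rightarrow> real"
  assumes "g \<in> borel_measurable borel" "\<And>x. \<bar>g x\<bar> \<le> C" "\<And>x. norm x > R \<Longrightarrow> g x = 0"
  shows "integrable lborel g"
proof (rule Bochner_Integration.integrable_bound)
  show "integrable lborel (\<lambda>x::'a. indicator (cball 0 R) x *\<^sub>R C)"
    by (intro integrable_indicator) (auto simp: emeasure_lborel_cball_finite simp flip: infinity_ennreal_def)
  show "AE x in lborel. norm (g x) \<le> norm (indicator (cball 0 R) x *\<^sub>R C)"
  proof (intro always_eventually allI)
    fix x show "norm (g x) \<le> norm (indicator (cball 0 R) x *\<^sub>R C)"
      using assms(2)[of x] assms(3)[of x] by (cases "norm x > R") auto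
  qed
qed (use assms in simp)

lemma integrable_cpt_cont:
  fixes g :: "'a::euclidean_space \<Rightarrow> real"
  assumes "continuous_on UNIV g" "\<And>x. norm x > R \<Longrightarrow> g x = 0"
  shows "integrable lborel g"
proof -
  obtain C where "\<And>x. \<bar>g x\<bar> \<le> C"
    using continuous_cpt_bounded[OF assms] by blast
  with assms show ?thesis
    by (intro integrable_cpt_bound[of g C R] borel_measurable_continuous_onI)
qed

lemma integral_lborel_shift:
  fixes f :: "'a::euclidean_space \<Rightarrow> real"
  assumes "f \<in> borel_measurable borel"
  shows "(LINT x|lborel. f (x + c)) = (LINT x|lborel. f x)"
proof -
  have "(LINT x|lborel. f x) = (LINT x|distr lborel borel ((+) c). f x)"
    by (simp add: lborel_distr_plus)
  also have "\<dots> = (LINT x|lborel. f (c + x))"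
    using assms by (intro integral_distr) auto
  finally show ?thesis by (simp add: add.commute)
qed

lemma diff_quot_bound:
  assumes "\<And>x. f differentiable (at x)" "\<And>x. \<bar>partial_deriv b f x\<bar> \<le> C"
  shows "\<bar>diff_quot h b f x\<bar> \<le> C"
proof (cases "h = 0")
  case True
  \<comment> \<open>For \<open>h = 0\<close> the quotient is 0, division by zero being zero, and
    \<open>C\<close> is nonnegative as a bound of an absolute value.\<close>
  then show ?thesis using assms(2)[of x] by (simp add: diff_quot_def)
next
  case False
  have "norm (f (x + h *\<^sub>R b) - f (x + 0 *\<^sub>R b)) \<le> C * norm (h - 0)"
    by (rule field_differentiable_bound[of UNIV "\<lambda>t. f (x + t *\<^sub>R b)" "\<lambda>t. partial_deriv b f (x + t *\<^sub>R b)"])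
      (use assms in \<open>auto intro!: partial_deriv_has_derivative_at\<close>)
  then show ?thesis using False by (simp add: diff_quot_def divide_le_eq abs_mult)
qed

lemma diff_quot_tendsto:
  assumes "f differentiable (at x)" "h \<longlonglongrightarrow> 0" "\<And>k. h k \<noteq> 0"
  shows "(\<lambda>k. diff_quot (h k) b f x) \<longlonglongrightarrow> partial_deriv b f x"
proof -
  have "((\<lambda>t. (f (x + t *\<^sub>R b) - f x) / t) \<longlongrightarrow> partial_deriv b f x) (at 0)"
    using partial_deriv_has_derivative_at[of f x 0 b] assms(1) by (simp add: has_field_derivative_iff)
  moreover have "filterlim h (at 0) sequentially"
    using assms(2,3) by (simp add: filterlim_at)
  ultimately show ?thesis
    unfolding diff_quot_def by (rule filterlim_compose)
qed

lemma diff_quot_zero_outside: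
  assumes "\<And>x. norm x > R \<Longrightarrow> f x = 0" "\<bar>h\<bar> \<le> 1" "b \<in> Basis" "norm x > R + 1"
  shows "diff_quot h b f x = 0"
proof -
  have "norm x - norm (h *\<^sub>R b) \<le> norm (x + h *\<^sub>R b)"
    by (metis norm_diff_ineq)
  then have "norm (x + h *\<^sub>R b) > R" using assms(2-4) by simp
  moreover have "norm x > R" using assms(4) by simp
  ultimately show ?thesis using assms(1) by (simp add: diff_quot_def)
qed

lemma diff_quot_cont:
  assumes "continuous_on UNIV f"
  shows "continuous_on UNIV (diff_quot h b f)"
  unfolding diff_quot_def divide_inverse
  by (intro continuous_intros continuous_on_compose2[OF assms]) auto

text \<open>Dominated convergence: by the mean value inequality the quotients obey the bound of the
  partial derivative, and for steps of size at most 1 they all vanish outside the ball of radius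
  \<open>R + 1\<close>, on which the continuous weight \<open>g\<close> is bounded.\<close>

lemma diff_quot_integral_tendsto:
  assumes f: "C1_cpt R f" and b: "b \<in> Basis" and g: "continuous_on UNIV g"
    and h: "h \<longlonglongrightarrow> 0" "\<And>k. h k \<noteq> 0" "\<And>k. \<bar>h k\<bar> \<le> 1"
  shows "(\<lambda>k. LINT x|lborel. g x * diff_quot (h k) b f x) \<longlonglongrightarrow> (LINT x|lborel. g x * partial_deriv b f x)"
proof -
  have cf: "continuous_on UNIV f" using f by (rule C1_cpt_cont)
  have cp: "continuous_on UNIV (partial_deriv b f)" using f b by (simp add: C1_cpt_def)
  obtain C where C: "0 \<le> C" "\<And>x. \<bar>partial_deriv b f x\<bar> \<le> C"
    using continuous_cpt_bounded[OF cp C1_cpt_partial_zero[OF f]] by blast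
  have "compact (cball (0::'a) (R+1))" by simp
  then have "bounded (g ` cball 0 (R+1))"
    by (intro compact_imp_bounded compact_continuous_image continuous_on_subset[OF g]) auto
  then obtain D where "\<forall>y\<in>g ` cball 0 (R+1). norm y \<le> D"
    unfolding bounded_iff by blast
  then have D: "\<And>x. x \<in> cball 0 (R+1) \<Longrightarrow> \<bar>g x\<bar> \<le> D" by simp
  have meas: "(\<lambda>x. g x * diff_quot (h k) b f x) \<in> borel_measurable borel" for k
    by (intro borel_measurable_continuous_onI continuous_intros g diff_quot_cont cf)
  show ?thesis
  proof (rule integral_dominated_convergence[where w="\<lambda>x. indicator (cball 0 (R+1)) x *\<^sub>R (D * C)"])
    show "(\<lambda>x. g x * partial_deriv b f x) \<in> borel_measurable lborel"
      using borel_measurable_continuous_onI[OF continuous_on_mult[OF g cp]] by simp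
    show "(\<lambda>x. g x * diff_quot (h k) b f x) \<in> borel_measurable lborel" for k
      using meas[of k] by simp
    show "integrable lborel (\<lambda>x::'a. indicator (cball 0 (R+1)) x *\<^sub>R (D * C))"
      by (intro integrable_indicator) (auto simp: emeasure_lborel_cball_finite simp flip: infinity_ennreal_def)
    show "AE x in lborel. (\<lambda>k. g x * diff_quot (h k) b f x) \<longlonglongrightarrow> g x * partial_deriv b f x"
      using f by (intro always_eventually allI tendsto_mult tendsto_const diff_quot_tendsto h) (simp add: C1_cpt_def)
    show "AE x in lborel. norm (g x * diff_quot (h k) b f x) \<le> indicator (cball 0 (R+1)) x *\<^sub>R (D * C)" for k
    proof (intro always_eventually allI)
      fix x :: 'a
      have 1: "\<bar>diff_quot (h k) b f x\<bar> \<le> C"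
        using f C by (intro diff_quot_bound) (auto simp: C1_cpt_def)
      show "norm (g x * diff_quot (h k) b f x) \<le> indicator (cball 0 (R+1)) x *\<^sub>R (D * C)"
      proof (cases "norm x > R + 1")
        case True
        then have "diff_quot (h k) b f x = 0"
          using f h(3) b by (intro diff_quot_zero_outside[of R]) (auto simp: C1_cpt_def)
        then show ?thesis using True by simp
      next
        case False
        then have x: "x \<in> cball 0 (R+1)" by simp
        have "\<bar>g x\<bar> * \<bar>diff_quot (h k) b f x\<bar> \<le> D * C"
          using D[OF x] 1 by (intro mult_mono) auto
        with x show ?thesis by (simp add: abs_mult)
      qed
    qed
  qed
qed

abbreviation (input) "hseq \<equiv> (\<lambda>k::nat. 1 / real (Suc k))"

lemma hseq: "hseq \<longlonglongrightarrow> 0" "hseq k \<noteq> 0" "\<bar>hseq k\<bar> \<le> 1"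
  using LIMSEQ_Suc[OF lim_1_over_n[where 'a = real]] by (auto simp: divide_simps)

text \<open>Translation invariance of Lebesgue measure gives every difference quotient integral
  zero, and the quotients converge under the integral. This takes the place of integrating along
  lines with Fubini.\<close>

lemma integral_partial_deriv:
  fixes f :: "'a::euclidean_space \<Rightarrow> real"
  assumes f: "C1_cpt R f" and b: "b \<in> Basis"
  shows "(LINT x|lborel. partial_deriv b f x) = 0"
proof -
  have cf: "continuous_on UNIV f" using f by (rule C1_cpt_cont)
  have z: "\<And>x. norm x > R \<Longrightarrow> f x = 0" using f by (simp add: C1_cpt_def)
  have int: "integrable lborel f" using cf z by (rule integrable_cpt_cont)
  have "(LINT x|lborel. 1 * diff_quot h b f x) = 0" for h :: real
  proof -
    have m: "f \<in> borel_measurable borel" using cf by (rule borel_measurable_continuous_onI)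
    have "integrable lborel (\<lambda>x. f (x + h *\<^sub>R b))"
    proof (rule integrable_cpt_cont[of _ "R + norm (h *\<^sub>R b)"])
      show "continuous_on UNIV (\<lambda>x. f (x + h *\<^sub>R b))"
        by (intro continuous_on_compose2[OF cf] continuous_intros) auto
      fix x :: 'a assume x: "norm x > R + norm (h *\<^sub>R b)"
      have "norm x - norm (h *\<^sub>R b) \<le> norm (x + h *\<^sub>R b)" by (metis norm_diff_ineq)
      with x show "f (x + h *\<^sub>R b) = 0" by (intro z) simp
    qed
    with int have "(LINT x|lborel. f (x + h *\<^sub>R b) - f x) = 0"
      by (simp add: integral_lborel_shift[OF m])
    then show ?thesis by (simp add: diff_quot_def)
  qed
  then have "(\<lambda>k::nat. 0) \<longlonglongrightarrow> (LINT x|lborel. 1 * partial_deriv b f x)"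
    using diff_quot_integral_tendsto[OF f b continuous_on_const[of UNIV 1] hseq] by (simp only:)
  then show ?thesis by (simp add: LIMSEQ_const_iff)
qed

lemma partial_deriv_mult:
  assumes "f differentiable (at x)" "g differentiable (at x)"
  shows "partial_deriv b (\<lambda>x. f x * g x) x = f x * partial_deriv b g x + partial_deriv b f x * g x"
  using has_derivative_mult[of f "frechet_derivative f (at x)" x UNIV g "frechet_derivative g (at x)"] assms
  by (subst partial_deriv_eq) (auto simp: frechet_derivative_works partial_deriv_def)

lemma C1_cpt_mult:
  assumes f: "C1_cpt R f" and g: "\<And>x. g differentiable (at x)" "\<And>b. b \<in> Basis \<Longrightarrow> continuous_on UNIV (partial_deriv b g)"
  shows "C1_cpt R (\<lambda>x. f x * g x)"
  unfolding C1_cpt_def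
proof (intro conjI allI ballI impI)
  fix b :: 'a assume b: "b \<in> Basis"
  have "continuous_on UNIV (\<lambda>x. f x * partial_deriv b g x + partial_deriv b f x * g x)"
    using f g b C1_cpt_cont[OF f]
    by (intro continuous_intros) (auto simp: C1_cpt_def continuous_at_imp_continuous_on differentiable_imp_continuous_within)
  then show "continuous_on UNIV (partial_deriv b (\<lambda>x. f x * g x))"
    using f g by (subst continuous_on_cong[OF refl partial_deriv_mult]) (auto simp: C1_cpt_def)
qed (use f g in \<open>auto simp: C1_cpt_def\<close>)

lemma partial_deriv_diff_quot:
  assumes "\<And>x. f differentiable (at x)"
  shows "diff_quot h c f differentiable (at x)"
    and "partial_deriv b (diff_quot h c f) x = diff_quot h c (partial_deriv b f) x"
proof -
  have f: "(f has_derivative frechet_derivative f (at x)) (at x)" for x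
    using assms by (simp add: frechet_derivative_works)
  have 1: "((\<lambda>x. f (x + h *\<^sub>R c)) has_derivative frechet_derivative f (at (x + h *\<^sub>R c))) (at x)"
    by (rule has_derivative_compose[where f = "\<lambda>x. x + h *\<^sub>R c" and g = f and f' = "\<lambda>d. d"])
      (auto intro!: derivative_eq_intros f)
  have 2: "(diff_quot h c f has_derivative
      (\<lambda>d. (frechet_derivative f (at (x + h *\<^sub>R c)) d - frechet_derivative f (at x) d) / h)) (at x)"
    unfolding diff_quot_def divide_inverse
    by (intro has_derivative_mult_left has_derivative_diff 1 f)
  then show "diff_quot h c f differentiable (at x)" by (auto simp: differentiable_def)
  show "partial_deriv b (diff_quot h c f) x = diff_quot h c (partial_deriv b f) x"
    using partial_deriv_eq[OF 2] by (simp add: partial_deriv_def diff_quot_def)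
qed

lemma integral_by_parts:
  assumes f: "C1_cpt R f" and b: "b \<in> Basis"
    and g: "\<And>x. g differentiable (at x)" "\<And>b. b \<in> Basis \<Longrightarrow> continuous_on UNIV (partial_deriv b g)"
  shows "(LINT x|lborel. partial_deriv b f x * g x) = - (LINT x|lborel. f x * partial_deriv b g x)"
proof -
  have fz: "\<And>x. norm x > R \<Longrightarrow> f x = 0" and df: "\<And>x. f differentiable (at x)"
    and cpf: "continuous_on UNIV (partial_deriv b f)" using f b by (auto simp: C1_cpt_def)
  have cg: "continuous_on UNIV g"
    using g(1) by (simp add: continuous_at_imp_continuous_on differentiable_imp_continuous_within)
  have i1: "integrable lborel (\<lambda>x. f x * partial_deriv b g x)"
    by (rule integrable_cpt_cont[of _ R]) (auto intro!: continuous_intros g b C1_cpt_cont[OF f] simp: fz)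
  have i2: "integrable lborel (\<lambda>x. partial_deriv b f x * g x)"
    by (rule integrable_cpt_cont[of _ R])
      (auto intro!: continuous_intros cpf cg simp: C1_cpt_partial_zero[OF f])
  have "0 = (LINT x|lborel. f x * partial_deriv b g x + partial_deriv b f x * g x)"
    using integral_partial_deriv[OF C1_cpt_mult[OF f g] b] partial_deriv_mult[OF df g(1), of b] by simp
  also have "\<dots> = (LINT x|lborel. f x * partial_deriv b g x) + (LINT x|lborel. partial_deriv b f x * g x)"
    using i1 i2 by simp
  finally show ?thesis by simp
qed

text \<open>The derivative in direction \<open>j\<close> is replaced by difference quotients, so that no second
  derivatives, and hence no symmetry of mixed derivatives, are needed.\<close>

lemma integral_partial_deriv_swap:
  assumes B: "C1_cpt R B" and p: "C1_cpt S p" and i: "i \<in> Basis" and j: "j \<in> Basis"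
  shows "(LINT x|lborel. partial_deriv i B x * partial_deriv j p x)
       = (LINT x|lborel. partial_deriv i p x * partial_deriv j B x)"
proof -
  have cpB: "continuous_on UNIV (partial_deriv i B)" and cpp: "continuous_on UNIV (partial_deriv i p)"
    using B p i by (auto simp: C1_cpt_def)
  have dp: "\<And>x. p differentiable (at x)" and dB: "\<And>x. B differentiable (at x)"
    using B p by (auto simp: C1_cpt_def)
  have cB: "continuous_on UNIV B" using B by (rule C1_cpt_cont)
  have Bz: "\<And>x. norm x > R \<Longrightarrow> B x = 0" and pz: "\<And>x. norm x > S \<Longrightarrow> partial_deriv i p x = 0"
    using B C1_cpt_partial_zero[OF p] by (auto simp: C1_cpt_def)
  have mp: "partial_deriv i p \<in> borel_measurable borel" and mB: "B \<in> borel_measurable borel"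
    using cpp cB by (auto intro: borel_measurable_continuous_onI)
  \<comment> \<open>The identity at the discrete level. Two minus signs cancel: one from moving the
    derivative in direction \<open>i\<close>, the other from the shift, which turns the step
    \<open>h\<close> into \<open>-h\<close>.\<close>
  have eq: "(LINT x|lborel. partial_deriv i B x * diff_quot h j p x)
      = (LINT x|lborel. partial_deriv i p x * diff_quot (-h) j B x)" if h: "h \<noteq> 0" for h
  proof -
    let ?q = "partial_deriv i p"
    have "(LINT x|lborel. partial_deriv i B x * diff_quot h j p x)
      = - (LINT x|lborel. B x * partial_deriv i (diff_quot h j p) x)"
    proof (rule integral_by_parts[OF B i])
      show "diff_quot h j p differentiable (at x)" for x by (rule partial_deriv_diff_quot[OF dp])
      fix b :: 'a assume "b \<in> Basis"
      then have "continuous_on UNIV (diff_quot h j (partial_deriv b p))"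
        using p by (intro diff_quot_cont) (simp add: C1_cpt_def)
      then show "continuous_on UNIV (partial_deriv b (diff_quot h j p))"
        by (subst continuous_on_cong[OF refl partial_deriv_diff_quot(2)[OF dp]]) auto
    qed
    also have "\<dots> = - (LINT x|lborel. B x * diff_quot h j ?q x)"
      by (simp add: partial_deriv_diff_quot(2)[OF dp])
    also have "\<dots> = - (((LINT x|lborel. B x * ?q (x + h *\<^sub>R j)) - (LINT x|lborel. B x * ?q x)) / h)"
    proof -
      have "integrable lborel (\<lambda>x. B x * ?q (x + h *\<^sub>R j))" "integrable lborel (\<lambda>x. B x * ?q x)"
        by (rule integrable_cpt_cont[of _ R]; 
            auto intro!: continuous_intros cB cpp continuous_on_compose2[OF cpp] simp: Bz)+
      then show ?thesis by (simp add: diff_quot_def right_diff_distrib flip: Bochner_Integration.integral_diff)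
    qed
    also have "(LINT x|lborel. B x * ?q (x + h *\<^sub>R j)) = (LINT x|lborel. B (x + (- h) *\<^sub>R j) * ?q x)"
      using integral_lborel_shift[of "\<lambda>x. B x * ?q (x + h *\<^sub>R j)" "(-h) *\<^sub>R j"] mp mB
      by (simp add: borel_measurable_times)
    also have "- (((LINT x|lborel. B (x + (- h) *\<^sub>R j) * ?q x) - (LINT x|lborel. B x * ?q x)) / h)
       = (LINT x|lborel. ?q x * diff_quot (-h) j B x)"
    proof -
      have "integrable lborel (\<lambda>x. B (x + (- h) *\<^sub>R j) * ?q x)" "integrable lborel (\<lambda>x. B x * ?q x)"
        by (rule integrable_cpt_cont[of _ S]; 
            auto intro!: continuous_intros cB cpp continuous_on_compose2[OF cB] simp: pz)+
      then have "(LINT x|lborel. B (x + (- h) *\<^sub>R j) * ?q x) - (LINT x|lborel. B x * ?q x)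
         = (LINT x|lborel. ?q x * (B (x + (- h) *\<^sub>R j) - B x))"
        by (subst Bochner_Integration.integral_diff[symmetric]) (auto simp: algebra_simps)
      moreover have "(LINT x|lborel. ?q x * diff_quot (-h) j B x)
          = (LINT x|lborel. ?q x * (B (x + (- h) *\<^sub>R j) - B x)) / (-h)"
        unfolding diff_quot_def times_divide_eq_right by (rule integral_divide_zero)
      ultimately show ?thesis by simp
    qed
    finally show ?thesis .
  qed
  have "(\<lambda>k. LINT x|lborel. partial_deriv i B x * diff_quot (hseq k) j p x)
     \<longlonglongrightarrow> (LINT x|lborel. partial_deriv i B x * partial_deriv j p x)"
    by (rule diff_quot_integral_tendsto[OF p j cpB hseq])
  moreover have "(\<lambda>k. LINT x|lborel. partial_deriv i p x * diff_quot (- hseq k) j B x)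
     \<longlonglongrightarrow> (LINT x|lborel. partial_deriv i p x * partial_deriv j B x)"
    by (rule diff_quot_integral_tendsto[OF B j cpp]) (use hseq tendsto_minus[OF hseq(1)] in auto)
  ultimately show ?thesis
    unfolding eq[OF hseq(2)] by (rule LIMSEQ_unique)
qed

subsection \<open>Functions with a point singularity\<close>

text \<open>The exponent is a double successor so as to be at least 2: then the corner of
  \<open>max 0 y\<close> is smoothed, since the difference quotient at 0 is bounded by
  \<open>|h| ^ Suc k\<close>. All truncations below, namely \<open>cut\<close>, \<open>chi\<close>
  and the profile, take their regularity from here.\<close>

lemma DERIV_max_power:
  "((\<lambda>y::real. max 0 y ^ Suc (Suc k)) has_real_derivative real (k + 2) * max 0 y ^ Suc k) (at y)"
proof -
  consider "y > 0" | "y < 0" | "y = 0" by linarith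
  then show ?thesis
  proof cases
    case 1
    have "((\<lambda>y::real. y ^ Suc (Suc k)) has_real_derivative real (k + 2) * y ^ Suc k) (at y)"
      by (rule DERIV_cong[OF DERIV_pow]) (simp del: power_Suc)
    then show ?thesis
      using 1 by (rule_tac DERIV_cong[OF has_field_derivative_transform_within_open[where S = "{0<..}" and f = "\<lambda>y. y ^ Suc (Suc k)"]])
        (auto simp del: power_Suc)
  next
    case 2
    have "((\<lambda>y::real. 0) has_real_derivative 0) (at y)" by simp
    then have "((\<lambda>y::real. max 0 y ^ Suc (Suc k)) has_real_derivative 0) (at y)"
      using 2 by (rule_tac has_field_derivative_transform_within_open[where S = "{..<0}" and f = "\<lambda>y. 0"]) auto
    then show ?thesis using 2 by simp
  next
    case 3
    have "((\<lambda>h::real. max 0 h ^ Suc (Suc k) / h) \<longlongrightarrow> 0) (at 0)"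
    proof (rule Lim_null_comparison)
      have "norm (max 0 h ^ Suc (Suc k) / h) \<le> \<bar>h\<bar> ^ Suc k" for h :: real
      proof (cases "h > 0")
        case True
        then have "max 0 h ^ Suc (Suc k) / h = h ^ Suc k" by simp
        then show ?thesis using True by (simp add: abs_mult del: power_Suc)
      next
        case False
        then have "max 0 h = 0" by simp
        then have "max 0 h ^ Suc (Suc k) / h = 0" by (simp only: power_0_Suc div_0)
        then show ?thesis unfolding \<open>max 0 h ^ Suc (Suc k) / h = 0\<close> by (simp only: norm_zero zero_le_power abs_ge_zero)
      qed
      then show "\<forall>\<^sub>F h in at (0::real). norm (max 0 h ^ Suc (Suc k) / h) \<le> \<bar>h\<bar> ^ Suc k"
        by (rule always_eventually[OF allI])
      show "((\<lambda>h::real. \<bar>h\<bar> ^ Suc k) \<longlongrightarrow> 0) (at 0)"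
        by (rule tendsto_eq_rhs[OF tendsto_power[OF tendsto_rabs[OF tendsto_ident_at]]]) simp
    qed
    then show ?thesis using 3 by (simp add: has_field_derivative_iff)
  qed
qed

text \<open>Dyadic shells: on the shell \<open>S k\<close> the integrand is at most
  \<open>c * 2 powr (\<alpha> * k)\<close> and the volume is at most
  \<open>V * 2 powr (- n * k)\<close>, so the integral is dominated by a geometric series of ratio
  \<open>2 powr (\<alpha> - n) < 1\<close>.\<close>

lemma integrable_norm_powr:
  fixes R \<alpha> :: real
  assumes "\<alpha> < real DIM('a)"
  shows "integrable lborel (\<lambda>x::'a::euclidean_space. indicator (cball 0 R) x * norm x powr (- \<alpha>))"
proof (cases "R \<le> 0")
  case True
  then have "(\<lambda>x::'a. indicator (cball 0 R) x * norm x powr (- \<alpha>)) = (\<lambda>x. 0)"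
  proof (intro ext)
    fix x :: 'a
    show "indicator (cball 0 R) x * norm x powr (- \<alpha>) = 0"
    proof (cases "norm x \<le> R")
      case True
      with \<open>R \<le> 0\<close> have "norm x \<le> 0" by linarith
      then show ?thesis by simp
    qed simp
  qed
  then show ?thesis by simp
next
  case False
  then have R: "R > 0" by simp
  let ?n = "DIM('a)"
  define S where "S k = {x::'a. R / 2 ^ Suc k < norm x \<and> norm x \<le> R / 2 ^ k}" for k
  define f where "f x = indicator (cball 0 R) x * norm x powr (- \<alpha>)" for x :: 'a
  \<comment> \<open>The norm varies by a factor of at most 2 on a shell. For \<alpha> \<ge> 0 the
    supremum sits at the inner radius \<open>R / 2 ^ Suc k\<close>, which costs
    \<open>2 powr \<alpha>\<close> compared with the outer one.\<close>
  define c where "c = R powr (- \<alpha>) * 2 powr \<bar>\<alpha>\<bar>"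
  define V where "V = unit_ball_vol (real ?n) * R ^ ?n"
  have V: "V \<ge> 0" using R by (simp add: V_def)
  have Sm[measurable]: "S k \<in> sets borel" for k
    unfolding S_def by measurable
  have nn: "norm x powr (- \<alpha>) \<le> c * 2 powr (\<alpha> * real k)" if "x \<in> S k" for x k
  proof -
    have "R / 2 ^ Suc k > 0" using R by simp
    with that have x: "norm x > 0" "R / 2 ^ Suc k < norm x" "norm x \<le> R / 2 ^ k"
      unfolding S_def mem_Collect_eq by linarith+
    have e: "R / 2 ^ k = R * 2 powr (- real k)" "R / 2 ^ Suc k = R * 2 powr (- real (Suc k))"
      by (simp_all only: powr_minus divide_inverse powr_realpow zero_less_numeral)
    show ?thesis
    proof (cases "\<alpha> \<ge> 0")
      case True
      have "norm x powr (- \<alpha>) \<le> (R * 2 powr (- real (Suc k))) powr (- \<alpha>)"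
        using x R True e by (intro powr_mono2') auto
      also have "\<dots> = R powr (- \<alpha>) * 2 powr (\<alpha> * real (Suc k))"
        using R by (simp add: powr_mult powr_powr algebra_simps)
      also have "\<dots> = c * 2 powr (\<alpha> * real k)"
        using True by (simp add: c_def algebra_simps powr_add)
      finally show ?thesis .
    next
      case False
      have "norm x powr (- \<alpha>) \<le> (R * 2 powr (- real k)) powr (- \<alpha>)"
        using x R False e by (intro powr_mono2) auto
      also have "\<dots> = R powr (- \<alpha>) * 2 powr (\<alpha> * real k)"
        using R by (simp add: powr_mult powr_powr algebra_simps)
      also have "\<dots> \<le> c * 2 powr (\<alpha> * real k)"
        unfolding c_def by (intro mult_right_mono) (auto simp: mult_le_cancel_left1 ge_one_powr_ge_zero)
      finally show ?thesis .
    qed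
  qed
  have cover: "\<exists>k. x \<in> S k" if "x \<noteq> 0" "norm x \<le> R" for x
  proof -
    have "(\<lambda>k. R / 2 ^ Suc k) \<longlonglongrightarrow> 0"
      using LIMSEQ_Suc[OF LIMSEQ_divide_realpow_zero[of 2 R]] by simp
    then have "\<forall>\<^sub>F k in sequentially. R / 2 ^ Suc k < norm x"
      using that(1) by (intro order_tendstoD) auto
    then have ex: "\<exists>k. R / 2 ^ Suc k < norm x" by (auto simp: eventually_sequentially)
    define k where "k = (LEAST k. R / 2 ^ Suc k < norm x)"
    have 1: "R / 2 ^ Suc k < norm x" unfolding k_def using ex by (rule LeastI_ex)
    have "norm x \<le> R / 2 ^ k"
    proof (cases k)
      case 0 then show ?thesis using that by simp
    next
      case (Suc j)
      then have "\<not> R / 2 ^ Suc j < norm x" using not_less_Least[of j] by (metis k_def lessI)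
      then show ?thesis using Suc by simp
    qed
    with 1 show ?thesis by (auto simp: S_def)
  qed
  have ge_term: "g k \<le> (\<Sum>k. g k)" for g :: "nat \<Rightarrow> ennreal" and k
    using sum_le_suminf[of g "{k}"] by simp
  have pt: "ennreal (f x) \<le> (\<Sum>k. ennreal (c * 2 powr (\<alpha> * real k)) * indicator (S k) x)" for x
  proof (cases "x \<noteq> 0 \<and> norm x \<le> R")
    case True
    then obtain k where k: "x \<in> S k" using cover by blast
    have "ennreal (f x) \<le> ennreal (c * 2 powr (\<alpha> * real k)) * indicator (S k) x"
      using nn[OF k] True k by (simp add: f_def ennreal_leI)
    also have "\<dots> \<le> (\<Sum>k. ennreal (c * 2 powr (\<alpha> * real k)) * indicator (S k) x)"
      by (rule ge_term)
    finally show ?thesis .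
  next
    \<comment> \<open>At the origin the left side is zero because \<open>0 powr a = 0\<close>,
      beyond radius \<open>R\<close> because of the indicator.\<close>
    case False
    then show ?thesis by (auto simp: f_def)
  qed
  have em: "emeasure lborel (S k) \<le> ennreal (V * 2 powr (- real ?n * real k))" for k
  proof -
    have "emeasure lborel (S k) \<le> emeasure lborel (cball (0::'a) (R / 2 ^ k))"
      by (intro emeasure_mono) (auto simp: S_def)
    also have "\<dots> = ennreal (unit_ball_vol (real ?n) * (R / 2 ^ k) ^ ?n)"
      using R by (intro emeasure_cball) simp
    also have "unit_ball_vol (real ?n) * (R / 2 ^ k) ^ ?n = V * 2 powr (- real ?n * real k)"
    proof -
      have "(R / 2 ^ k) ^ ?n = R ^ ?n / 2 ^ (k * ?n)" by (simp add: power_divide power_mult)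
      also have "(2::real) ^ (k * ?n) = 2 powr (real ?n * real k)"
        by (simp add: mult.commute flip: powr_realpow)
      finally show ?thesis by (simp add: V_def powr_minus divide_inverse)
    qed
    finally show ?thesis .
  qed
  define q where "q = 2 powr (\<alpha> - real ?n)"
  have q: "0 \<le> q" "q < 1" using assms powr_less_mono[of "\<alpha> - real ?n" 0 2] by (auto simp: q_def)
  have c: "c \<ge> 0" by (simp add: c_def)
  have "(\<integral>\<^sup>+x. ennreal (f x) \<partial>lborel) \<le> (\<integral>\<^sup>+x. (\<Sum>k. ennreal (c * 2 powr (\<alpha> * real k)) * indicator (S k) x) \<partial>lborel)"
    by (intro nn_integral_mono pt)
  also have "\<dots> = (\<Sum>k. \<integral>\<^sup>+x. ennreal (c * 2 powr (\<alpha> * real k)) * indicator (S k) x \<partial>lborel)"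
    by (intro nn_integral_suminf) measurable
  also have "\<dots> = (\<Sum>k. ennreal (c * 2 powr (\<alpha> * real k)) * emeasure lborel (S k))"
    by (simp add: nn_integral_cmult_indicator)
  also have "\<dots> \<le> (\<Sum>k. ennreal (c * V * q ^ k))"
  proof (intro suminf_le)
    fix k
    have "ennreal (c * 2 powr (\<alpha> * real k)) * emeasure lborel (S k)
       \<le> ennreal (c * 2 powr (\<alpha> * real k)) * ennreal (V * 2 powr (- real ?n * real k))"
      by (intro mult_left_mono em) simp
    also have "\<dots> = ennreal (c * 2 powr (\<alpha> * real k) * (V * 2 powr (- real ?n * real k)))"
      using c V by (intro ennreal_mult[symmetric]) auto
    also have "c * 2 powr (\<alpha> * real k) * (V * 2 powr (- real ?n * real k)) = c * V * q ^ k"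
      by (simp add: q_def powr_realpow[symmetric] powr_powr powr_add[symmetric] algebra_simps)
    finally show "ennreal (c * 2 powr (\<alpha> * real k)) * emeasure lborel (S k) \<le> ennreal (c * V * q ^ k)" .
  qed auto
  also have "\<dots> = ennreal (\<Sum>k. c * V * q ^ k)"
    using c V q by (intro suminf_ennreal2) (auto intro!: summable_mult summable_geometric)
  also have "\<dots> < \<infinity>" by simp
  finally have "(\<integral>\<^sup>+x. ennreal (f x) \<partial>lborel) < \<infinity>" .
  moreover have "f \<in> borel_measurable borel" 
    unfolding f_def by (intro borel_measurable_times borel_measurable_indicator powr_real_measurable) auto
  moreover have "f x \<ge> 0" for x by (simp add: f_def)
  ultimately have "integrable lborel f"
    by (intro integrableI_nonneg) auto
  then show ?thesis unfolding f_def .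
qed

text \<open>The functions \<open>cut \<epsilon> (|x|\<^sup>2)\<close> remove a neighbourhood of the origin. At \<open>s = 0\<close> the quotient is
  \<open>0/0 = 0\<close>, as wanted.\<close>

definition cut :: "real \<Rightarrow> real \<Rightarrow> real" where
  "cut \<epsilon> s = max 0 (s - \<epsilon>) ^ 2 / s ^ 2"

definition cut' :: "real \<Rightarrow> real \<Rightarrow> real" where
  "cut' \<epsilon> s = 2 * max 0 (s - \<epsilon>) / s ^ 2 - 2 * max 0 (s - \<epsilon>) ^ 2 / s ^ 3"

lemma cut_deriv:
  assumes "s > 0"
  shows "(cut \<epsilon> has_real_derivative cut' \<epsilon> s) (at s)"
proof -
  have "((\<lambda>s. max 0 (s - \<epsilon>) ^ 2) has_real_derivative 2 * max 0 (s - \<epsilon>)) (at s)"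
  proof -
    have "((\<lambda>s. s - \<epsilon>) has_real_derivative 1) (at s)" by (auto intro!: derivative_eq_intros)
    from DERIV_chain2[where f = "\<lambda>y. max 0 y ^ Suc (Suc 0)", OF DERIV_max_power this]
    show ?thesis by (simp add: numeral_2_eq_2)
  qed
  from DERIV_divide[OF this DERIV_power[OF DERIV_ident, of 2]] show ?thesis
    unfolding cut_def [abs_def] using assms
    by (rule_tac DERIV_cong) (auto simp: cut'_def field_simps power2_eq_square power3_eq_cube)
qed

text \<open>With \<open>t = max 0 (s - \<epsilon>) / s\<close> in \<open>[0, 1]\<close>,
  \<open>cut\<close> is \<open>t^2\<close> and \<open>cut'\<close> is
  \<open>(2/s) t (1 - t)\<close>. The bound \<open>2 / s\<close> is uniform in \<epsilon>; for
  \<open>s = |x|^2\<close> it makes the gradient of the cutoff O(1/|x|) at every scale.\<close>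

lemma cut_bounds:
  assumes "\<epsilon> > 0"
  shows "0 \<le> cut \<epsilon> s" "s \<ge> 0 \<Longrightarrow> cut \<epsilon> s \<le> 1" "s < \<epsilon> \<Longrightarrow> cut \<epsilon> s = 0" "s > 0 \<Longrightarrow> \<bar>cut' \<epsilon> s\<bar> \<le> 2 / s"
proof -
  show "0 \<le> cut \<epsilon> s" by (simp add: cut_def)
  show "s < \<epsilon> \<Longrightarrow> cut \<epsilon> s = 0" by (simp add: cut_def)
  have M: "0 \<le> max 0 (s - \<epsilon>)" "s \<ge> 0 \<Longrightarrow> max 0 (s - \<epsilon>) \<le> s" using assms by auto
  show "cut \<epsilon> s \<le> 1" if "s \<ge> 0"
  proof -
    have "max 0 (s - \<epsilon>) ^ 2 \<le> s ^ 2" using M that by (intro power_mono) auto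
    then show ?thesis unfolding cut_def by (simp add: divide_le_eq_1)
  qed
  show "\<bar>cut' \<epsilon> s\<bar> \<le> 2 / s" if s: "s > 0"
  proof -
    define t where "t = max 0 (s - \<epsilon>) / s"
    have t: "0 \<le> t" "t \<le> 1" using M s by (auto simp: t_def)
    have "cut' \<epsilon> s = 2 / s * (t * (1 - t))"
      using s by (simp add: cut'_def t_def field_simps power2_eq_square power3_eq_cube)
    moreover have "0 \<le> t * (1 - t)" "t * (1 - t) \<le> 1" using t by (auto intro: mult_le_one)
    ultimately show ?thesis using s by (simp add: abs_mult divide_right_mono)
  qed
qed

lemma cut_tendsto:
  assumes "s > 0" "e \<longlonglongrightarrow> 0"
  shows "(\<lambda>k. cut (e k) s) \<longlonglongrightarrow> 1" "(\<lambda>k. cut' (e k) s) \<longlonglongrightarrow> 0"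
proof -
  have "(\<lambda>k. max 0 (s - e k)) \<longlonglongrightarrow> max 0 (s - 0)"
    by (intro tendsto_intros assms)
  then have M: "(\<lambda>k. max 0 (s - e k)) \<longlonglongrightarrow> s" using assms by simp
  show "(\<lambda>k. cut (e k) s) \<longlonglongrightarrow> 1"
    unfolding cut_def using assms
    by (rule_tac tendsto_eq_rhs[OF tendsto_divide[OF tendsto_power[OF M] tendsto_const]]) auto
  show "(\<lambda>k. cut' (e k) s) \<longlonglongrightarrow> 0"
    unfolding cut'_def using assms
    by (rule_tac tendsto_eq_rhs[OF tendsto_diff[OF tendsto_divide[OF tendsto_mult[OF tendsto_const M] tendsto_const]
      tendsto_divide[OF tendsto_mult[OF tendsto_const tendsto_power[OF M]] tendsto_const]]])
      (auto simp: power2_eq_square power3_eq_cube)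
qed

lemma cut_norm_deriv:
  assumes "(x::'a::euclidean_space) \<noteq> 0"
  shows "((\<lambda>x. cut \<epsilon> (x \<bullet> x)) has_derivative (\<lambda>d. cut' \<epsilon> (x \<bullet> x) * (2 * (x \<bullet> d)))) (at x)"
proof -
  have "((\<lambda>x. x \<bullet> x) has_derivative (\<lambda>d. 2 * (x \<bullet> d))) (at x)"
    by (auto intro!: derivative_eq_intros simp: inner_commute)
  from has_derivative_compose[OF this, of "cut \<epsilon>" "(*) (cut' \<epsilon> (x \<bullet> x))"]
  show ?thesis using cut_deriv[of "x \<bullet> x" \<epsilon>] assms by (simp add: has_field_derivative_def)
qed

text \<open>\<alpha> is the blow-up order of the first derivatives, and the function itself is one
  order better, as for homogeneous functions. The integral identities below hold across the origin
  once \<alpha> is less than the dimension.\<close>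

definition C1_sing :: "real \<Rightarrow> real \<Rightarrow> ('a::euclidean_space \<Rightarrow> real) \<Rightarrow> bool" where
  "C1_sing \<alpha> R f \<longleftrightarrow> (\<forall>x. x \<noteq> 0 \<longrightarrow> f differentiable (at x)) \<and>
     (\<forall>b\<in>Basis. continuous_on (- {0}) (partial_deriv b f)) \<and>
     (\<exists>C\<ge>0. \<forall>x. x \<noteq> 0 \<and> norm x \<le> R \<longrightarrow> \<bar>f x\<bar> \<le> C * norm x powr (1 - \<alpha>) \<and>
        (\<forall>b\<in>Basis. \<bar>partial_deriv b f x\<bar> \<le> C * norm x powr (- \<alpha>)))"

text \<open>The truncations are \<open>cut (1/(k+1)) (|x|^2) * f\<close>. In the product rule the
  derivative of the cutoff costs \<open>1/|x|\<close>, exactly the order by which \<open>f\<close>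
  is better than its derivatives, so one majorant of order \<open>-\<alpha>\<close> serves all
  \<open>k\<close>.\<close>

lemma C1_sing_approx:
  fixes f :: "'a::euclidean_space \<Rightarrow> real"
  assumes f: "C1_sing \<alpha> R f" and z: "\<And>x. norm x > R \<Longrightarrow> f x = 0"
  obtains F D where "\<And>k::nat. C1_cpt R (F k)"
    "\<And>b x. b \<in> Basis \<Longrightarrow> x \<noteq> 0 \<Longrightarrow> (\<lambda>k. partial_deriv b (F k) x) \<longlonglongrightarrow> partial_deriv b f x"
    "\<And>b x k. b \<in> Basis \<Longrightarrow> x \<noteq> 0 \<Longrightarrow>
       \<bar>partial_deriv b (F k) x\<bar> \<le> D * (indicator (cball 0 R) x * norm x powr (- \<alpha>))"
proof -
  define F where "F k x = cut (hseq k) (x \<bullet> x) * f x" for k and x :: 'a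
  have df: "f differentiable (at x)" if "x \<noteq> 0" for x using f that by (simp add: C1_sing_def)
  have cf: "continuous_on (- {0}) (partial_deriv b f)" if "b \<in> Basis" for b using f that by (simp add: C1_sing_def)
  have cf0: "continuous_on (- {0}) f"
    using df by (intro continuous_at_imp_continuous_on) (auto intro: differentiable_imp_continuous_within)
  obtain C where C0: "C \<ge> 0" and C: "\<And>x. x \<noteq> 0 \<Longrightarrow> norm x \<le> R \<Longrightarrow> \<bar>f x\<bar> \<le> C * norm x powr (1 - \<alpha>)"
    "\<And>x b. x \<noteq> 0 \<Longrightarrow> norm x \<le> R \<Longrightarrow> b \<in> Basis \<Longrightarrow> \<bar>partial_deriv b f x\<bar> \<le> C * norm x powr (- \<alpha>)"
    using f unfolding C1_sing_def by blast
  have hpos: "hseq k > 0" for k by simp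
  have cd: "(\<lambda>x. cut e (x \<bullet> x)) differentiable (at x)" if "x \<noteq> 0" for e and x :: 'a
    using cut_norm_deriv[OF that, of e] by (auto simp: differentiable_def)
  have pF: "partial_deriv b (F k) x = cut (hseq k) (x \<bullet> x) * partial_deriv b f x
     + cut' (hseq k) (x \<bullet> x) * (2 * (x \<bullet> b)) * f x" if "x \<noteq> 0" for b k x
    unfolding F_def by (subst partial_deriv_mult[OF cd[OF that] df[OF that]])
      (simp add: partial_deriv_eq[OF cut_norm_deriv[OF that]])
  have Fz: "(F k has_derivative (\<lambda>_. 0)) (at x)" if "x \<bullet> x < hseq k" for k x
  proof (rule has_derivative_transform_within_open[OF has_derivative_const[of 0]])
    show "open {x::'a. x \<bullet> x < hseq k}" by (intro open_Collect_less continuous_intros)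
    show "0 = F k y" if "y \<in> {x. x \<bullet> x < hseq k}" for y
      using that cut_bounds(3)[of "hseq k" "y \<bullet> y"] by (simp add: F_def)
  qed (use that in simp)
  have 1: "C1_cpt R (F k)" for k
    unfolding C1_cpt_def
  proof (intro conjI allI ballI impI)
    fix x :: 'a
    show "F k differentiable (at x)"
    proof (cases "x = 0")
      case True
      then have "x \<bullet> x < hseq k" by simp
      from Fz[OF this] show ?thesis by (auto simp: differentiable_def)
    next
      case False
      then show ?thesis unfolding F_def by (intro differentiable_mult cd df)
    qed
    show "norm x > R \<Longrightarrow> F k x = 0" using z by (simp add: F_def)
  next
    fix b :: 'a assume b: "b \<in> Basis"
    let ?U = "{x::'a. x \<bullet> x < hseq k}"
    have o: "open ?U" by (intro open_Collect_less continuous_intros)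
    have "continuous_on ?U (partial_deriv b (F k))"
      using partial_deriv_eq[OF Fz] by (subst continuous_on_cong[OF refl, of _ _ "\<lambda>_. 0"]) auto
    moreover have "continuous_on (- {0}) (\<lambda>x. cut (hseq k) (x \<bullet> x) * partial_deriv b f x
     + cut' (hseq k) (x \<bullet> x) * (2 * (x \<bullet> b)) * f x)"
      unfolding cut_def cut'_def by (intro continuous_intros cf[OF b] cf0) auto
    then have "continuous_on (- {0}) (partial_deriv b (F k))"
      using pF by (subst continuous_on_cong[OF refl pF]) auto
    ultimately have "continuous_on (?U \<union> - {0}) (partial_deriv b (F k))"
      by (intro continuous_on_open_Un o) auto
    moreover have "?U \<union> - {0} = UNIV" by auto
    ultimately show "continuous_on UNIV (partial_deriv b (F k))" by simp
  qed
  have 2: "(\<lambda>k. partial_deriv b (F k) x) \<longlonglongrightarrow> partial_deriv b f x" if "b \<in> Basis" "x \<noteq> 0" for b x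
  proof -
    have "(\<lambda>k. cut (hseq k) (x \<bullet> x) * partial_deriv b f x
     + cut' (hseq k) (x \<bullet> x) * (2 * (x \<bullet> b)) * f x) \<longlonglongrightarrow> 1 * partial_deriv b f x + 0 * (2 * (x \<bullet> b)) * f x"
      using that by (intro tendsto_intros cut_tendsto hseq) simp_all
    then show ?thesis by (simp add: pF[OF that(2)])
  qed
  \<comment> \<open>The constant is 5 = 1 + 4: one for the truncated derivative of \<open>f\<close>,
    and \<open>2 / |x|^2 * 2 |x|\<close> for the derivative of the cutoff.\<close>
  have 3: "\<bar>partial_deriv b (F k) x\<bar> \<le> (5 * C) * (indicator (cball 0 R) x * norm x powr (- \<alpha>))"
    if b: "b \<in> Basis" and x: "x \<noteq> 0" for b x k
  proof (cases "norm x \<le> R")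
    case True
    have s: "x \<bullet> x > 0" using x by simp
    have "\<bar>cut (hseq k) (x \<bullet> x) * partial_deriv b f x\<bar> \<le> 1 * (C * norm x powr (- \<alpha>))"
      unfolding abs_mult using C(2)[OF x True b] cut_bounds(1,2)[of "hseq k" "x \<bullet> x"] s
      by (intro mult_mono) auto
    moreover have "\<bar>cut' (hseq k) (x \<bullet> x) * (2 * (x \<bullet> b)) * f x\<bar> \<le> 2 / (x \<bullet> x) * (2 * norm x) * (C * norm x powr (1 - \<alpha>))"
      unfolding abs_mult using C(1)[OF x True] cut_bounds(4)[of "hseq k", OF _ s] s Basis_le_norm[OF b, of x]
      by (intro mult_mono) (auto simp: abs_mult)
    moreover have "2 / (x \<bullet> x) * (2 * norm x) * (C * norm x powr (1 - \<alpha>)) = 4 * C * norm x powr (- \<alpha>)"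
      using x by (simp add: dot_square_norm power2_eq_square powr_diff powr_minus field_simps)
    ultimately show ?thesis using True pF[OF x, of b k] by simp
  next
    case False
    then show ?thesis using C1_cpt_partial_zero[OF 1, of x b k] by simp
  qed
  from 1 2 3 show thesis by (rule that)
qed

section \<open>Integral identities carried across a point singularity\<close>

lemma borel_measurable_punctured_continuous:
  fixes g :: "'a::euclidean_space \<Rightarrow> 'b::topological_space"
  assumes "continuous_on (- {0}) g"
  shows "g \<in> borel_measurable borel"
  using assms borel_measurable_continuous_countable_exceptions[of "{0}" g] by simp

lemma AE_lborel_nonzero: "AE x in lborel. x \<noteq> (0::'a::euclidean_space)"
  by (rule AE_lborel_singleton)

lemma integral_C1_sing_tendsto:
  fixes f :: "'a::euclidean_space \<Rightarrow> real"
  assumes F: "\<And>k::nat. C1_cpt R (F k)"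
    "\<And>b x. b \<in> Basis \<Longrightarrow> x \<noteq> 0 \<Longrightarrow> (\<lambda>k. partial_deriv b (F k) x) \<longlonglongrightarrow> partial_deriv b f x"
    "\<And>b x k. b \<in> Basis \<Longrightarrow> x \<noteq> 0 \<Longrightarrow>
       \<bar>partial_deriv b (F k) x\<bar> \<le> D * (indicator (cball 0 R) x * norm x powr (- \<alpha>))"
    and f: "C1_sing \<alpha> R f" and \<alpha>: "\<alpha> < real DIM('a)" and b: "b \<in> Basis"
    and g: "continuous_on UNIV g" "\<And>x. norm x > S \<Longrightarrow> norm x \<le> R \<Longrightarrow> g x = 0" "\<And>x. \<bar>g x\<bar> \<le> E"
  shows "(\<lambda>k. LINT x|lborel. partial_deriv b (F k) x * g x) \<longlonglongrightarrow> (LINT x|lborel. partial_deriv b f x * g x)"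
proof (rule integral_dominated_convergence[where w = "\<lambda>x. D * (indicator (cball 0 R) x * norm x powr (- \<alpha>)) * E"])
  have cf: "continuous_on (- {0}) (partial_deriv b f)" using f b by (simp add: C1_sing_def)
  have "partial_deriv b f \<in> borel_measurable borel" using cf by (rule borel_measurable_punctured_continuous)
  moreover have "g \<in> borel_measurable borel" using g(1) by (rule borel_measurable_continuous_onI)
  ultimately show "(\<lambda>x. partial_deriv b f x * g x) \<in> borel_measurable lborel" by simp
  have "partial_deriv b (F k) \<in> borel_measurable borel" for k
    using F(1)[of k] b by (intro borel_measurable_continuous_onI) (simp add: C1_cpt_def)
  then show "(\<lambda>x. partial_deriv b (F k) x * g x) \<in> borel_measurable lborel" for k
    using \<open>g \<in> borel_measurable borel\<close> by simp
  show "integrable lborel (\<lambda>x::'a. D * (indicator (cball 0 R) x * norm x powr (- \<alpha>)) * E)"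
    by (intro integrable_mult_left integrable_mult_right integrable_norm_powr \<alpha>)
  show "AE x in lborel. (\<lambda>k. partial_deriv b (F k) x * g x) \<longlonglongrightarrow> partial_deriv b f x * g x"
    using AE_lborel_nonzero by eventually_elim (intro tendsto_mult tendsto_const F(2) b)
  show "AE x in lborel. norm (partial_deriv b (F k) x * g x) \<le> D * (indicator (cball 0 R) x * norm x powr (- \<alpha>)) * E" for k
    using AE_lborel_nonzero
  proof eventually_elim
    case (elim x)
    show ?case unfolding real_norm_def abs_mult
      using F(3)[OF b elim, of k] g(3)[of x] by (intro mult_mono) auto
  qed
qed

text \<open>The origin contributes no mass: the truncations satisfy the smooth identity, and
  \<alpha> below the dimension makes their common majorant integrable.\<close>

lemma integral_partial_deriv_sing:
  fixes f :: "'a::euclidean_space \<Rightarrow> real"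
  assumes f: "C1_sing \<alpha> R f" and z: "\<And>x. norm x > R \<Longrightarrow> f x = 0"
    and \<alpha>: "\<alpha> < real DIM('a)" and b: "b \<in> Basis"
  shows "(LINT x|lborel. partial_deriv b f x) = 0"
proof -
  obtain F D where F: "\<And>k::nat. C1_cpt R (F k)"
    "\<And>b x. b \<in> Basis \<Longrightarrow> x \<noteq> 0 \<Longrightarrow> (\<lambda>k. partial_deriv b (F k) x) \<longlonglongrightarrow> partial_deriv b f x"
    "\<And>b x k. b \<in> Basis \<Longrightarrow> x \<noteq> 0 \<Longrightarrow>
       \<bar>partial_deriv b (F k) x\<bar> \<le> D * (indicator (cball 0 R) x * norm x powr (- \<alpha>))"
    using C1_sing_approx[OF f z] by blast
  have "(\<lambda>k. LINT x|lborel. partial_deriv b (F k) x * 1) \<longlonglongrightarrow> (LINT x|lborel. partial_deriv b f x * 1)"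
    by (rule integral_C1_sing_tendsto[OF F f \<alpha> b, where S = R and E = 1]) auto
  then show ?thesis
    by (simp add: integral_partial_deriv[OF F(1) b] LIMSEQ_const_iff)
qed

text \<open>Both sides pass to the limit along the same truncations of \<open>f\<close>. This is
  what makes a plane curl of a singular potential divergence free on the whole space, the origin
  included.\<close>

lemma integral_partial_deriv_swap_sing:
  fixes f :: "'a::euclidean_space \<Rightarrow> real"
  assumes f: "C1_sing \<alpha> R f" and z: "\<And>x. norm x > R \<Longrightarrow> f x = 0"
    and \<alpha>: "\<alpha> < real DIM('a)" and b: "b \<in> Basis" and c: "c \<in> Basis" and p: "C1_cpt S p"
  shows "(LINT x|lborel. partial_deriv b f x * partial_deriv c p x)
       = (LINT x|lborel. partial_deriv c f x * partial_deriv b p x)"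
proof -
  obtain F D where F: "\<And>k::nat. C1_cpt R (F k)"
    "\<And>b x. b \<in> Basis \<Longrightarrow> x \<noteq> 0 \<Longrightarrow> (\<lambda>k. partial_deriv b (F k) x) \<longlonglongrightarrow> partial_deriv b f x"
    "\<And>b x k. b \<in> Basis \<Longrightarrow> x \<noteq> 0 \<Longrightarrow>
       \<bar>partial_deriv b (F k) x\<bar> \<le> D * (indicator (cball 0 R) x * norm x powr (- \<alpha>))"
    using C1_sing_approx[OF f z] by blast
  have cp: "continuous_on UNIV (partial_deriv c p)" if "c \<in> Basis" for c using p that by (simp add: C1_cpt_def)
  have lim: "(\<lambda>k. LINT x|lborel. partial_deriv b (F k) x * partial_deriv c p x)
     \<longlonglongrightarrow> (LINT x|lborel. partial_deriv b f x * partial_deriv c p x)" if b: "b \<in> Basis" and c: "c \<in> Basis" for b c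
  proof -
    obtain E where E: "\<And>x. \<bar>partial_deriv c p x\<bar> \<le> E"
      using continuous_cpt_bounded[OF cp[OF c] C1_cpt_partial_zero[OF p]] by blast
    show ?thesis
      by (rule integral_C1_sing_tendsto[OF F f \<alpha> b cp[OF c], where S = R]) (use E in auto)
  qed
  have "(LINT x|lborel. partial_deriv b (F k) x * partial_deriv c p x)
     = (LINT x|lborel. partial_deriv c (F k) x * partial_deriv b p x)" for k
    using integral_partial_deriv_swap[OF F(1) p b c] by (simp add: mult.commute)
  with lim[OF b c] lim[OF c b] show ?thesis by (simp add: LIMSEQ_unique)
qed

lemma C1_sing_mult:
  fixes f :: "'a::euclidean_space \<Rightarrow> real"
  assumes f: "C1_sing \<alpha> R f" and p: "C1_cpt S p" and R: "R \<ge> 0"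
  shows "C1_sing \<alpha> R (\<lambda>x. f x * p x)"
proof -
  have df: "f differentiable (at x)" if "x \<noteq> 0" for x using f that by (simp add: C1_sing_def)
  have cf: "continuous_on (- {0}) (partial_deriv b f)" if "b \<in> Basis" for b using f that by (simp add: C1_sing_def)
  have cf0: "continuous_on (- {0}) f"
    using df by (intro continuous_at_imp_continuous_on) (auto intro: differentiable_imp_continuous_within)
  have dp: "p differentiable (at x)" for x using p by (simp add: C1_cpt_def)
  have cp: "continuous_on A (partial_deriv b p)" if "b \<in> Basis" for b A
    using p that by (auto simp: C1_cpt_def intro: continuous_on_subset[OF _ subset_UNIV])
  have cp0: "continuous_on A p" for A using C1_cpt_cont[OF p] by (rule continuous_on_subset) simp
  obtain C where C0: "C \<ge> 0" and C: "\<And>x. x \<noteq> 0 \<Longrightarrow> norm x \<le> R \<Longrightarrow> \<bar>f x\<bar> \<le> C * norm x powr (1 - \<alpha>)"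
    "\<And>x b. x \<noteq> 0 \<Longrightarrow> norm x \<le> R \<Longrightarrow> b \<in> Basis \<Longrightarrow> \<bar>partial_deriv b f x\<bar> \<le> C * norm x powr (- \<alpha>)"
    using f unfolding C1_sing_def by blast
  obtain E0 where E0: "0 \<le> E0" "\<And>x. \<bar>p x\<bar> \<le> E0"
    using continuous_cpt_bounded[OF cp0, of S] p by (auto simp: C1_cpt_def)
  have "\<exists>E. \<forall>x. \<bar>partial_deriv b p x\<bar> \<le> E" if "b \<in> Basis" for b
    using continuous_cpt_bounded[OF cp[OF that] C1_cpt_partial_zero[OF p]] by metis
  then obtain E1 where E1: "\<And>b x. b \<in> Basis \<Longrightarrow> \<bar>partial_deriv b p x\<bar> \<le> E1 b" by metis
  define E where "E = (\<Sum>b\<in>Basis. E1 b)"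
  have E1E: "\<bar>partial_deriv b p x\<bar> \<le> E" if "b \<in> Basis" for b x
  proof -
    have "E1 b' \<ge> 0" if "b' \<in> Basis" for b' using E1[OF that, of 0] by linarith
    then have "E1 b \<le> E" unfolding E_def using that by (intro member_le_sum) auto
    with E1[OF that, of x] show ?thesis by linarith
  qed
  obtain b0 :: 'a where "b0 \<in> Basis" using nonempty_Basis by blast
  from E1E[OF this, of 0] have E: "E \<ge> 0" by linarith
  have pd: "partial_deriv b (\<lambda>x. f x * p x) x = f x * partial_deriv b p x + partial_deriv b f x * p x"
    if "x \<noteq> 0" for b x by (rule partial_deriv_mult[OF df[OF that] dp])
  show ?thesis unfolding C1_sing_def
  proof (intro conjI allI impI ballI)
    show "(\<lambda>x. f x * p x) differentiable (at x)" if "x \<noteq> 0" for x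
      by (intro differentiable_mult df[OF that] dp)
    show "continuous_on (- {0}) (partial_deriv b (\<lambda>x. f x * p x))" if b: "b \<in> Basis" for b
    proof -
      have "continuous_on (- {0}) (\<lambda>x. f x * partial_deriv b p x + partial_deriv b f x * p x)"
        by (intro continuous_intros cf0 cf[OF b] cp[OF b] cp0)
      then show ?thesis by (subst continuous_on_cong[OF refl pd]) auto
    qed
    show "\<exists>D\<ge>0. \<forall>x. x \<noteq> 0 \<and> norm x \<le> R \<longrightarrow> \<bar>f x * p x\<bar> \<le> D * norm x powr (1 - \<alpha>) \<and>
        (\<forall>b\<in>Basis. \<bar>partial_deriv b (\<lambda>x. f x * p x) x\<bar> \<le> D * norm x powr (- \<alpha>))"
    \<comment> \<open>The second summand comes from \<open>f\<close> times a derivative of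
      \<open>p\<close>, where order \<open>1 - \<alpha>\<close> is traded for order
      \<open>-\<alpha>\<close> at the price of a factor \<open>R\<close>.\<close>
    proof (intro exI[of _ "C * E0 + C * R * E"] conjI allI impI ballI)
      show "0 \<le> C * E0 + C * R * E" using C0 E0 R E by simp
      fix x :: 'a assume x: "x \<noteq> 0 \<and> norm x \<le> R"
      have "\<bar>f x * p x\<bar> \<le> C * norm x powr (1 - \<alpha>) * E0"
        unfolding abs_mult using C(1)[of x] x E0 C0 by (intro mult_mono) auto
      also have "\<dots> \<le> (C * E0 + C * R * E) * norm x powr (1 - \<alpha>)"
        using C0 R E by (simp add: algebra_simps)
      finally show "\<bar>f x * p x\<bar> \<le> (C * E0 + C * R * E) * norm x powr (1 - \<alpha>)" .
      fix b :: 'a assume b: "b \<in> Basis"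
      have "\<bar>f x * partial_deriv b p x\<bar> \<le> C * norm x powr (1 - \<alpha>) * E"
        unfolding abs_mult using C(1)[of x] x E1E[OF b] C0 by (intro mult_mono) auto
      also have "norm x powr (1 - \<alpha>) = norm x * norm x powr (- \<alpha>)"
        using x by (simp add: powr_diff powr_minus divide_inverse)
      also have "C * (norm x * norm x powr (- \<alpha>)) * E \<le> C * (R * norm x powr (- \<alpha>)) * E"
        using x C0 E by (intro mult_right_mono mult_left_mono) auto
      finally have 1: "\<bar>f x * partial_deriv b p x\<bar> \<le> C * (R * norm x powr (- \<alpha>)) * E" .
      have "\<bar>partial_deriv b f x * p x\<bar> \<le> C * norm x powr (- \<alpha>) * E0"
        unfolding abs_mult using C(2)[of x b] x E0 C0 b by (intro mult_mono) auto
      with 1 show "\<bar>partial_deriv b (\<lambda>x. f x * p x) x\<bar> \<le> (C * E0 + C * R * E) * norm x powr (- \<alpha>)"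
        using x by (simp add: pd algebra_simps)
    qed
  qed
qed

subsection \<open>The radial average of a profile\<close>

text \<open>The profile is \<open>g\<close> times the positive part of \<open>sqrt s - 1\<close> to
  the power \<open>k + 1 \<ge> 2\<close>, which glues in a C1 way to zero at \<open>s = 1\<close>.
  The bounds stop at 9 because only radii \<open>r \<le> 2\<close> matter later, where
  \<open>y \<le> 2\<close> and hence \<open>(1 + y)^2 \<le> 9\<close>.\<close>

lemma profile_exists:
  fixes g g' :: "real \<Rightarrow> real"
  assumes g: "\<And>s. s > 0 \<Longrightarrow> (g has_real_derivative g' s) (at s)"
    and g': "continuous_on {0<..} g'" and k: "k \<ge> 1"
  obtains P P' C where
    "\<And>s. (P has_real_derivative P' s) (at s)" "continuous_on UNIV P'" "C \<ge> 0"
    "\<And>s. s \<le> 9 \<Longrightarrow> \<bar>P s\<bar> \<le> C * max 0 (sqrt s - 1) ^ Suc k"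
    "\<And>s. s \<le> 9 \<Longrightarrow> \<bar>P' s\<bar> \<le> C * max 0 (sqrt s - 1) ^ k"
    "\<And>s. s \<ge> 1 \<Longrightarrow> P s = (sqrt s - 1) ^ Suc k * g s"
proof -
  define M where "M s = max 0 (sqrt s - 1)" for s
  define P where "P s = M s ^ Suc k * g s" for s
  define P' where "P' s = real (Suc k) * M s ^ k * (inverse (sqrt s) / 2) * g s + M s ^ Suc k * g' s" for s
  have M0: "M s = 0" if "s < 1" for s using that by (simp add: M_def)
  have z: "P s = 0" "P' s = 0" if "s < 1" for s
    using k M0[OF that] by (auto simp: P_def P'_def)
  have dM: "((\<lambda>s. M s ^ Suc k) has_real_derivative real (Suc k) * M s ^ k * (inverse (sqrt s) / 2)) (at s)"
    if s: "s > 0" for s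
  proof -
    obtain j where j: "k = Suc j" using k by (cases k) auto
    have "((\<lambda>s. sqrt s - 1) has_real_derivative inverse (sqrt s) / 2) (at s)"
      using DERIV_diff[OF DERIV_real_sqrt[OF s] DERIV_const[of 1]] by simp
    from DERIV_chain2[where f = "\<lambda>y. max 0 y ^ Suc (Suc j)", OF DERIV_max_power this]
    show ?thesis unfolding M_def j by (simp only: add_2_eq_Suc')
  qed
  have dP: "(P has_real_derivative P' s) (at s)" for s
  proof (cases "s > 0")
    case True
    from DERIV_mult[OF dM[OF True] g[OF True]] show ?thesis
      unfolding P_def P'_def by (rule DERIV_cong) (simp add: algebra_simps)
  next
    case False
    have "(P has_real_derivative 0) (at s)"
      by (rule has_field_derivative_transform_within_open[where S = "{..<1}", OF DERIV_const[of 0]])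
        (use False z in auto)
    then show ?thesis using z False by simp
  qed
  have cg: "continuous_on {0<..} g"
    by (rule DERIV_continuous_on[OF has_field_derivative_at_within[OF g]]) auto
  have cM: "continuous_on A M" for A unfolding M_def by (intro continuous_intros)
  have cP': "continuous_on UNIV P'"
  proof -
    have "continuous_on {..<1} P'"
      using z by (subst continuous_on_cong[OF refl, of _ _ "\<lambda>_. 0"]) auto
    moreover have "continuous_on {0<..} P'"
      \<comment> \<open>The formula is used on \<open>s > 0\<close> and the constant 0 on
        \<open>s < 1\<close>; these open sets overlap and cover the line, so no separate argument at
        \<open>s = 1\<close> arises.\<close>
      unfolding P'_def by (intro continuous_intros cM cg g') auto
    ultimately have "continuous_on ({..<1} \<union> {0<..}) P'"
      by (intro continuous_on_open_Un) auto
    moreover have "{..<1::real} \<union> {0<..} = UNIV" by auto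
    ultimately show ?thesis by simp
  qed
  have "compact (g ` {1..9})" "compact (g' ` {1..9})"
    by (intro compact_continuous_image continuous_on_subset[OF cg] continuous_on_subset[OF g']; auto)+
  then have "bounded (g ` {1..9})" "bounded (g' ` {1..9})" by (auto intro: compact_imp_bounded)
  then obtain a b where ab: "\<forall>y\<in>g ` {1..9}. norm y \<le> a" "\<forall>y\<in>g' ` {1..9}. norm y \<le> b"
    unfolding bounded_iff by blast
  have a: "\<bar>g s\<bar> \<le> a" and b: "\<bar>g' s\<bar> \<le> b" if "1 \<le> s" "s \<le> 9" for s
    using ab that by auto
  have ab0: "a \<ge> 0" "b \<ge> 0" using a[of 1] b[of 1] by auto
  have M2: "0 \<le> M s" "s \<le> 9 \<Longrightarrow> M s \<le> 2" for s
  proof -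
    show "s \<le> 9 \<Longrightarrow> M s \<le> 2" using real_sqrt_le_mono[of s 9] by (simp add: M_def real_sqrt_unique[of 3 9])
  qed (simp add: M_def)
  have bP: "\<bar>P s\<bar> \<le> a * M s ^ Suc k" if "s \<le> 9" for s
  proof (cases "s < 1")
    case False
    then show ?thesis using a[of s] that M2(1)[of s]
      by (simp add: P_def abs_mult mult.commute[of _ "\<bar>g s\<bar>"] mult_right_mono zero_le_power del: power_Suc)
  qed (use z ab0 M2 in simp)
  have bP': "\<bar>P' s\<bar> \<le> (real (Suc k) * a + 2 * b) * M s ^ k" if "s \<le> 9" for s
  proof (cases "s < 1")
    case False
    then have s: "1 \<le> s" by simp
    have "1 \<le> sqrt s" using s by simp
    then have "inverse (sqrt s) \<le> inverse 1" "0 \<le> inverse (sqrt s)" by (intro le_imp_inverse_le) (use s in auto)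
    then have "\<bar>inverse (sqrt s) / 2\<bar> \<le> 1" by simp
    then have "\<bar>real (Suc k) * M s ^ k * (inverse (sqrt s) / 2) * g s\<bar> \<le> real (Suc k) * M s ^ k * 1 * a"
      unfolding abs_mult[of _ "g s"] abs_mult[of _ "inverse (sqrt s) / 2"]
      using a[OF s that] M2(1)[of s] by (intro mult_mono) auto
    moreover have "\<bar>M s ^ Suc k * g' s\<bar> \<le> (2 * M s ^ k) * b"
      unfolding abs_mult using b[OF s that] M2(1)[of s] M2(2)[OF that]
      by (intro mult_mono) (auto simp: abs_mult mult_right_mono)
    ultimately show ?thesis unfolding P'_def by (simp add: algebra_simps)
  qed (use z ab0 M2 in simp)
  define C where "C = a + (real (Suc k) * a + 2 * b)"
  show thesis
  proof (rule that[of P P' C])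
    show "C \<ge> 0" using ab0 by (simp add: C_def)
    show "\<bar>P s\<bar> \<le> C * max 0 (sqrt s - 1) ^ Suc k" if "s \<le> 9" for s
    proof -
      have "a * M s ^ Suc k \<le> C * M s ^ Suc k"
        using ab0 M2(1)[of s] by (intro mult_right_mono zero_le_power) (auto simp: C_def)
      with bP[OF that] show ?thesis unfolding M_def by linarith
    qed
    show "\<bar>P' s\<bar> \<le> C * max 0 (sqrt s - 1) ^ k" if "s \<le> 9" for s
    proof -
      have "(real (Suc k) * a + 2 * b) * M s ^ k \<le> C * M s ^ k"
        using ab0 M2(1)[of s] by (intro mult_right_mono zero_le_power) (auto simp: C_def)
      with bP'[OF that] show ?thesis unfolding M_def by linarith
    qed
    show "P s = (sqrt s - 1) ^ Suc k * g s" if "s \<ge> 1" for s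
      using that unfolding P_def M_def by (simp del: power_Suc)
  qed (use dP cP' in auto)
qed

text \<open>Used with \<open>p = n - 2\<close>, where \<open>t ^ p\<close> is the radial volume
  weight of a hyperplane of dimension \<open>n - 1\<close>. Then \<open>a\<close> is the squared
  height of the hyperplane in the blown-up picture and \<open>b\<close> the squared distance of the
  point from the axis.\<close>

locale radial_average =
  fixes P P' :: "real \<Rightarrow> real" and p :: nat
  assumes dP: "\<And>s. (P has_real_derivative P' s) (at s)" and cP': "continuous_on UNIV P'"
begin

definition J :: "real \<Rightarrow> real \<Rightarrow> real" where
  "J a b = integral {0..1} (\<lambda>t. t ^ p * P (a + t\<^sup>2 * b))"

definition Ja :: "real \<Rightarrow> real \<Rightarrow> real" where
  "Ja a b = integral {0..1} (\<lambda>t. t ^ p * P' (a + t\<^sup>2 * b))"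

definition Jb :: "real \<Rightarrow> real \<Rightarrow> real" where
  "Jb a b = integral {0..1} (\<lambda>t. t ^ (p + 2) * P' (a + t\<^sup>2 * b))"

lemma cP: "continuous_on UNIV P"
  using dP by (intro DERIV_continuous_on) auto

lemma cont_P_comp: "continuous_on A f \<Longrightarrow> continuous_on A (\<lambda>x. P (f x))"
  and cont_P'_comp: "continuous_on A f \<Longrightarrow> continuous_on A (\<lambda>x. P' (f x))"
  by (auto intro: continuous_on_compose2[OF cP] continuous_on_compose2[OF cP'])

text \<open>Differentiation under the integral sign in the pair \<open>(a, b)\<close>, with
  derivatives taken as bounded linear functionals. The total derivative is proved, so that
  \<open>J\<close> can later be composed with functions of \<open>x\<close>.\<close>

lemma J_deriv:
  "((\<lambda>x. J (fst x) (snd x)) has_derivative (\<lambda>d. Ja (fst x) (snd x) * fst d + Jb (fst x) (snd x) * snd d)) (at x)"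
proof -
  define fx :: "real \<times> real \<Rightarrow> real \<Rightarrow> (real \<times> real) \<Rightarrow>\<^sub>L real" where
    "fx x t = (t ^ p * P' (fst x + t\<^sup>2 * snd x)) *\<^sub>R (fst_blinfun + t\<^sup>2 *\<^sub>R snd_blinfun)" for x t
  have cfx: "continuous_on A (\<lambda>t. fx x t)" for A x
    unfolding fx_def by (intro continuous_intros cont_P'_comp)
  have "((\<lambda>x. integral (cbox 0 1) (\<lambda>t. t ^ p * P (fst x + t\<^sup>2 * snd x))) has_derivative integral (cbox 0 1) (fx x)) (at x within UNIV)"
  proof (rule leibniz_rule)
    fix x :: "real \<times> real" and t :: real
    have "((\<lambda>x. fst x + t\<^sup>2 * snd x) has_derivative (\<lambda>d. fst d + t\<^sup>2 * snd d)) (at x)"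
      by (auto intro!: derivative_eq_intros)
    from has_derivative_compose[OF this, of P "(*) (P' (fst x + t\<^sup>2 * snd x))"]
    have "((\<lambda>x. P (fst x + t\<^sup>2 * snd x)) has_derivative (\<lambda>d. P' (fst x + t\<^sup>2 * snd x) * (fst d + t\<^sup>2 * snd d))) (at x)"
      using dP by (simp add: has_field_derivative_def)
    from has_derivative_mult_right[OF this, of "t ^ p"]
    show "((\<lambda>x. t ^ p * P (fst x + t\<^sup>2 * snd x)) has_derivative blinfun_apply (fx x t)) (at x within UNIV)"
      by (rule has_derivative_eq_rhs) (simp add: fx_def fun_eq_iff blinfun.bilinear_simps algebra_simps)
  next
    show "(\<lambda>t. t ^ p * P (fst x + t\<^sup>2 * snd x)) integrable_on cbox 0 1" for x
      by (intro integrable_continuous continuous_intros cont_P_comp)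
    show "continuous_on (UNIV \<times> cbox 0 1) (\<lambda>(x, t). fx x t)"
      unfolding fx_def split_beta by (intro continuous_intros cont_P'_comp)
  qed auto
  moreover
  have "blinfun_apply (integral (cbox 0 1) (fx x)) d = Ja (fst x) (snd x) * fst d + Jb (fst x) (snd x) * snd d" for d
  proof -
    have "blinfun_apply (integral (cbox 0 1) (fx x)) d = integral (cbox 0 1) (\<lambda>t. blinfun_apply (fx x t) d)"
      by (rule blinfun_apply_integral) (intro integrable_continuous cfx)
    also have "(\<lambda>t. blinfun_apply (fx x t) d) = (\<lambda>t. t ^ p * P' (fst x + t\<^sup>2 * snd x) * fst d + t ^ (p + 2) * P' (fst x + t\<^sup>2 * snd x) * snd d)"
      by (simp add: fx_def fun_eq_iff blinfun.bilinear_simps algebra_simps power_add power2_eq_square)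
    also have "integral (cbox 0 1) \<dots> = Ja (fst x) (snd x) * fst d + Jb (fst x) (snd x) * snd d"
    proof -
      have "(\<lambda>t. t ^ p * P' (fst x + t\<^sup>2 * snd x)) integrable_on {0..1}"
        "(\<lambda>t. t ^ (p + 2) * P' (fst x + t\<^sup>2 * snd x)) integrable_on {0..1}"
        by (intro integrable_continuous_interval continuous_intros cont_P'_comp)+
      then show ?thesis
        unfolding Ja_def Jb_def box_real(2)
        by (intro integral_unique has_integral_add has_integral_mult_left integrable_integral)
    qed
    finally show ?thesis .
  qed
  then have "blinfun_apply (integral (cbox 0 1) (fx x)) = (\<lambda>d. Ja (fst x) (snd x) * fst d + Jb (fst x) (snd x) * snd d)" by blast
  ultimately show ?thesis unfolding J_def by (simp only: box_real(2))
qed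

lemma J_cont: "continuous_on UNIV (\<lambda>x. J (fst x) (snd x))"
  by (intro continuous_at_imp_continuous_on ballI has_derivative_continuous[OF J_deriv])

lemma Ja_cont: "continuous_on UNIV (\<lambda>x. Ja (fst x) (snd x))"
  unfolding Ja_def box_real(2)[symmetric]
  by (rule integral_continuous_on_param) (auto simp: split_beta intro!: continuous_intros cont_P'_comp)

lemma Jb_cont: "continuous_on UNIV (\<lambda>x. Jb (fst x) (snd x))"
  unfolding Jb_def box_real(2)[symmetric]
  by (rule integral_continuous_on_param) (auto simp: split_beta intro!: continuous_intros cont_P'_comp)

text \<open>The Euler relation of the average, obtained from \<open>t\<^sup>p\<^sup>+\<^sup>1 P(a + t\<^sup>2 b)\<close>; it makes \<open>u \<bullet> \<nabla>v\<close> local in \<open>P\<close>.\<close>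

lemma J_euler: "2 * b * Jb a b + real (p + 1) * J a b = P (a + b)"
proof -
  let ?F = "\<lambda>t. t ^ (p + 1) * P (a + t\<^sup>2 * b)"
  let ?f = "\<lambda>t. real (p + 1) * (t ^ p * P (a + t\<^sup>2 * b)) + 2 * b * (t ^ (p + 2) * P' (a + t\<^sup>2 * b))"
  have "(?f has_integral (?F 1 - ?F 0)) {0..1}"
  proof (rule fundamental_theorem_of_calculus)
    fix t :: real
    have "((\<lambda>t. a + t\<^sup>2 * b) has_real_derivative 2 * t * b) (at t)"
      by (auto intro!: derivative_eq_intros)
    from DERIV_mult[OF DERIV_pow[of "p + 1" t] DERIV_chain2[of P, OF dP this]]
    have "(?F has_real_derivative ?f t) (at t)"
      by (rule DERIV_cong) (simp add: algebra_simps power2_eq_square)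
    then show "(?F has_vector_derivative ?f t) (at t within {0..1})"
      by (simp add: has_real_derivative_iff_has_vector_derivative has_vector_derivative_at_within)
  qed simp
  then have "integral {0..1} ?f = P (a + b)" by (simp add: integral_unique)
  moreover have "integral {0..1} ?f = real (p + 1) * J a b + 2 * b * Jb a b"
  proof -
    have "(\<lambda>t. t ^ p * P (a + t\<^sup>2 * b)) integrable_on {0..1}"
      "(\<lambda>t. t ^ (p + 2) * P' (a + t\<^sup>2 * b)) integrable_on {0..1}"
      by (intro integrable_continuous_interval continuous_intros cont_P_comp cont_P'_comp)+
    then have "(?f has_integral (real (p + 1) * J a b + 2 * b * Jb a b)) {0..1}"
      unfolding J_def Jb_def by (intro has_integral_add has_integral_mult_right integrable_integral)
    then show ?thesis by (rule integral_unique)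
  qed
  ultimately show ?thesis by simp
qed

text \<open>As \<open>b \<ge> 0\<close>, the argument \<open>a + t^2 b\<close> never exceeds
  \<open>a + b = (1 + y)^2\<close>, so its square root passes the edge 1 of the profile by at most
  \<open>y\<close>. The resulting powers of \<open>y\<close> are what compensates the singular
  factor \<open>h^n\<close> of the potential.\<close>

lemma J_bounds:
  assumes C: "C \<ge> 0" "\<And>s. s \<le> 9 \<Longrightarrow> \<bar>P s\<bar> \<le> C * max 0 (sqrt s - 1) ^ Suc k"
    "\<And>s. s \<le> 9 \<Longrightarrow> \<bar>P' s\<bar> \<le> C * max 0 (sqrt s - 1) ^ k"
    and ab: "0 \<le> a" "0 \<le> b" "a + b = (1 + y)\<^sup>2" and y: "0 \<le> y" "y \<le> 2"
  shows "\<bar>J a b\<bar> \<le> C * y ^ Suc k" "\<bar>Ja a b\<bar> \<le> C * y ^ k" "\<bar>Jb a b\<bar> \<le> C * y ^ k"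
proof -
  have s: "a + t\<^sup>2 * b \<le> 9" "max 0 (sqrt (a + t\<^sup>2 * b) - 1) \<le> y" if "t \<in> {0..1}" for t
  proof -
    have "t\<^sup>2 * b \<le> 1 * b" using that ab by (intro mult_right_mono) (auto simp: power_le_one)
    then have 1: "a + t\<^sup>2 * b \<le> (1 + y)\<^sup>2" using ab by simp
    also have "\<dots> \<le> 3\<^sup>2" using y by (intro power_mono) auto
    finally show "a + t\<^sup>2 * b \<le> 9" by simp
    have "sqrt (a + t\<^sup>2 * b) \<le> sqrt ((1 + y)\<^sup>2)" using 1 by (rule real_sqrt_le_mono)
    then show "max 0 (sqrt (a + t\<^sup>2 * b) - 1) \<le> y" using y by simp
  qed
  have P: "\<bar>P (a + t\<^sup>2 * b)\<bar> \<le> C * y ^ Suc k" "\<bar>P' (a + t\<^sup>2 * b)\<bar> \<le> C * y ^ k" if "t \<in> {0..1}" for t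
  proof -
    have "max 0 (sqrt (a + t\<^sup>2 * b) - 1) ^ j \<le> y ^ j" for j
      using s(2)[OF that] by (intro power_mono) auto
    then have "C * max 0 (sqrt (a + t\<^sup>2 * b) - 1) ^ j \<le> C * y ^ j" for j
      using C(1) by (intro mult_left_mono)
    then show "\<bar>P (a + t\<^sup>2 * b)\<bar> \<le> C * y ^ Suc k" "\<bar>P' (a + t\<^sup>2 * b)\<bar> \<le> C * y ^ k"
      using C(2,3)[OF s(1)[OF that]] by (blast intro: order_trans)+
  qed
  have T: "\<bar>t ^ j * c\<bar> \<le> B" if "t \<in> {0..1}" "\<bar>c\<bar> \<le> B" for t c B :: real and j
  proof -
    have "\<bar>t ^ j\<bar> * \<bar>c\<bar> \<le> 1 * B" using that by (intro mult_mono) (auto simp: power_le_one abs_le_iff)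
    then show ?thesis by (simp add: abs_mult)
  qed
  have "norm (integral {0..1} (\<lambda>t. t ^ p * P (a + t\<^sup>2 * b))) \<le> C * y ^ Suc k * (1 - 0)"
    by (rule integral_bound) (simp, intro continuous_intros cont_P_comp, unfold real_norm_def, blast intro: T P)
  then show "\<bar>J a b\<bar> \<le> C * y ^ Suc k" unfolding J_def by (simp del: power_Suc)
  have "norm (integral {0..1} (\<lambda>t. t ^ p * P' (a + t\<^sup>2 * b))) \<le> C * y ^ k * (1 - 0)"
    by (rule integral_bound) (simp, intro continuous_intros cont_P'_comp, unfold real_norm_def, blast intro: T P)
  then show "\<bar>Ja a b\<bar> \<le> C * y ^ k" unfolding Ja_def by simp
  have "norm (integral {0..1} (\<lambda>t. t ^ (p + 2) * P' (a + t\<^sup>2 * b))) \<le> C * y ^ k * (1 - 0)"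
    by (rule integral_bound) (simp, intro continuous_intros cont_P'_comp, unfold real_norm_def, blast intro: T P)
  then show "\<bar>Jb a b\<bar> \<le> C * y ^ k" unfolding Jb_def by (simp del: power_add)
qed

end

subsection \<open>The drift\<close>

text \<open>The inner truncation keeps the value 1 up to \<open>t = 1\<close>, the outer one stops
  at \<open>t = 2\<close>, and the cubes make both joints C1. It is applied to
  \<open>t = r^2\<close>, so it is 1 on the unit ball.\<close>

definition chi :: "real \<Rightarrow> real" where
  "chi t = max 0 (1 - max 0 (t - 1) ^ 3) ^ 3"

definition chi' :: "real \<Rightarrow> real" where
  "chi' t = - 9 * max 0 (1 - max 0 (t - 1) ^ 3) ^ 2 * max 0 (t - 1) ^ 2"

lemma chi_deriv: "(chi has_real_derivative chi' t) (at t)"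
proof -
  have cube: "((\<lambda>y::real. max 0 y ^ 3) has_real_derivative 3 * max 0 y ^ 2) (at y)" for y
    using DERIV_max_power[of 1 y] by (simp add: numeral_3_eq_3 numeral_2_eq_2)
  have "((\<lambda>t. t - 1) has_real_derivative 1) (at t)" by (auto intro!: derivative_eq_intros)
  from DERIV_diff[OF DERIV_const[of 1] DERIV_chain2[where f = "\<lambda>y. max 0 y ^ 3", OF cube this]]
  have "((\<lambda>t. 1 - max 0 (t - 1) ^ 3) has_real_derivative - (3 * max 0 (t - 1) ^ 2)) (at t)" by simp
  from DERIV_chain2[where f = "\<lambda>y. max 0 y ^ 3", OF cube this]
  show ?thesis unfolding chi_def [abs_def] chi'_def by (rule DERIV_cong) simp
qed

lemma chi_bounds: "0 \<le> chi t" "chi t \<le> 1" "t \<le> 1 \<Longrightarrow> chi t = 1" "t \<ge> 2 \<Longrightarrow> chi t = 0" "\<bar>chi' t\<bar> \<le> 9"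
proof -
  have "max 0 (1 - max 0 (t - 1) ^ 3) \<le> 1" by simp
  then show "0 \<le> chi t" "chi t \<le> 1" unfolding chi_def by (auto intro!: power_le_one)
  show "t \<le> 1 \<Longrightarrow> chi t = 1" by (simp add: chi_def)
  have z: "max 0 (1 - max 0 (t - 1) ^ 3) = 0" if "t \<ge> 2"
  proof -
    have "1 \<le> (t - 1) ^ 3" using that by (intro one_le_power) simp
    then show ?thesis using that by simp
  qed
  then show "t \<ge> 2 \<Longrightarrow> chi t = 0" by (simp add: chi_def)
  show "\<bar>chi' t\<bar> \<le> 9"
  proof (cases "t \<ge> 2")
    case True
    then show ?thesis using z by (simp add: chi'_def)
  next
    case False
    then have "max 0 (t - 1) ^ 2 \<le> 1" by (intro power_le_one) auto
    moreover have "max 0 (1 - max 0 (t - 1) ^ 3) ^ 2 \<le> 1" by (intro power_le_one) auto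
    ultimately have "max 0 (1 - max 0 (t - 1) ^ 3) ^ 2 * max 0 (t - 1) ^ 2 \<le> 1"
      by (intro mult_le_one) auto
    then show ?thesis unfolding chi'_def by (simp add: abs_mult)
  qed
qed

lemma chi_cont: "continuous_on A chi" "continuous_on A chi'"
  unfolding chi_def chi'_def by (intro continuous_intros)+

text \<open>The formula \<open>P_eq\<close> is forced by \<open>u \<bullet> \<nabla>v = \<Delta>v\<close>: in the unit ball the left side is
  \<open>z h\<^sup>n (r h)\<^sup>\<prime> P((r h)\<^sup>2)\<close>, and \<open>r h = 1 + y\<close> for \<open>y = r\<^sup>\<beta>\<close>.\<close>

locale drift =
  fixes e :: "'a::euclidean_space" and n m k :: nat and P P' :: "real \<Rightarrow> real" and C :: real
  assumes e: "e \<in> Basis" and n: "n = DIM('a)" and dim: "n \<ge> 3" and m: "m \<ge> 1"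
    and k: "Suc (Suc k) = m * (n - 2)"
    and dP: "\<And>s. (P has_real_derivative P' s) (at s)" and cP': "continuous_on UNIV P'" and C0: "C \<ge> 0"
    and P_le: "\<And>s. s \<le> 9 \<Longrightarrow> \<bar>P s\<bar> \<le> C * max 0 (sqrt s - 1) ^ Suc k"
    and P'_le: "\<And>s. s \<le> 9 \<Longrightarrow> \<bar>P' s\<bar> \<le> C * max 0 (sqrt s - 1) ^ k"
    and P_eq: "\<And>y. y \<ge> 0 \<Longrightarrow> P ((1 + y)\<^sup>2) = y ^ Suc k *
      (- real m * (real n - 1 + (1 - 1 / real m) * (real n - 1 + 1 / real m) * y) / (1 + y) ^ n)"
begin

section \<open>Radial factors of the construction and their bounds for radii up to 2\<close>

definition "beta = 1 / real m"

sublocale radial_average P P' "n - 2"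
  by unfold_locales (rule dP cP')+

lemma beta: "0 < beta" "beta \<le> 1" "beta * real m = 1"
  using m by (auto simp: beta_def)

definition "yy r = r powr beta" for r :: real
definition "hh r = (1 + yy r) / r" for r :: real
definition "qq r = beta * yy r - 1 - yy r" for r :: real
definition "hh' r = qq r / r\<^sup>2" for r :: real

lemma yy_deriv: "r > 0 \<Longrightarrow> (yy has_real_derivative beta * yy r / r) (at r)"
  unfolding yy_def by (rule DERIV_cong[OF has_real_derivative_powr]) (auto simp: powr_diff)

lemma hh_deriv:
  assumes "r > 0"
  shows "(hh has_real_derivative hh' r) (at r)"
  using assms unfolding hh_def [abs_def]
  by (auto intro!: derivative_eq_intros yy_deriv simp: hh'_def qq_def field_simps power2_eq_square)

text \<open>\<open>beta * m = 1\<close> turns \<open>y^m\<close> into \<open>r\<close>, and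
  \<open>k + 2 = m (n - 2)\<close>. This is the reason for taking the exponent as the reciprocal of
  a natural number.\<close>

lemma yy_power: "r > 0 \<Longrightarrow> yy r ^ Suc (Suc k) = r ^ (n - 2)"
proof -
  assume r: "r > 0"
  have "yy r ^ m = r powr (beta * real m)" using r by (simp add: yy_def powr_powr flip: powr_realpow)
  then have "yy r ^ m = r" using r beta by simp
  then show ?thesis by (simp add: k power_mult del: power_Suc)
qed

lemma yy_bounds:
  assumes "0 < r" "r \<le> 2"
  shows "0 < yy r" "yy r \<le> 2"
proof -
  have "r powr beta \<le> 2 powr beta" using assms beta by (intro powr_mono2) auto
  also have "\<dots> \<le> 2 powr 1" using beta by (intro powr_mono) auto
  finally show "yy r \<le> 2" by (simp add: yy_def)
qed (use assms in \<open>simp add: yy_def\<close>)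

lemma hh_bounds:
  assumes "0 < r" "r \<le> 2"
  shows "0 < hh r" "hh r \<le> 3 / r" "\<bar>qq r\<bar> \<le> 3" "\<bar>hh' r\<bar> \<le> 3 / r\<^sup>2"
proof -
  note y = yy_bounds[OF assms]
  show "0 < hh r" "hh r \<le> 3 / r" using assms y by (auto simp: hh_def divide_right_mono add_pos_pos)
  have "beta * yy r \<le> 1 * yy r" "0 \<le> beta * yy r" using y beta by (auto intro: mult_right_mono)
  then show "\<bar>qq r\<bar> \<le> 3" using y unfolding qq_def by linarith
  then show "\<bar>hh' r\<bar> \<le> 3 / r\<^sup>2" by (simp add: hh'_def divide_right_mono)
qed

definition "ww r = chi (r\<^sup>2) * hh r ^ n" for r :: real
definition "ww' r = chi' (r\<^sup>2) * (2 * r) * hh r ^ n + chi (r\<^sup>2) * (real n * hh r ^ (n - 1) * hh' r)" for r :: real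

lemma ww_deriv:
  assumes "r > 0"
  shows "(ww has_real_derivative ww' r) (at r)"
proof -
  have "((\<lambda>r. r\<^sup>2) has_real_derivative 2 * r) (at r)" by (auto intro!: derivative_eq_intros)
  from DERIV_mult[OF DERIV_chain2[of chi, OF chi_deriv this] DERIV_power[OF hh_deriv[OF assms], of n]]
  show ?thesis unfolding ww_def [abs_def] ww'_def by (rule DERIV_cong) (simp add: algebra_simps)
qed

text \<open>The two terms of \<open>ww'\<close>: the first is bounded through
  \<open>9 * 2 r * r \<le> 72\<close>, using \<open>r \<le> 2\<close>, and the second contributes
  \<open>n\<close>, from differentiating the power \<open>h^n\<close>.\<close>

definition "Kw = (72 + real n) * 3 ^ n"

lemma ww_bounds:
  assumes r: "0 < r" "r \<le> 2"
  shows "\<bar>ww r\<bar> \<le> 3 ^ n / r ^ n" "\<bar>ww' r\<bar> \<le> Kw / r ^ Suc n"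
proof -
  note h = hh_bounds[OF r]
  have hp: "hh r ^ j \<le> 3 ^ j / r ^ j" for j
    using power_mono[OF h(2), of j] h by (simp add: power_divide)
  have "\<bar>ww r\<bar> \<le> 1 * (3 ^ n / r ^ n)"
    unfolding ww_def abs_mult using chi_bounds(1,2)[of "r\<^sup>2"] hp[of n] h
    by (intro mult_mono) auto
  then show "\<bar>ww r\<bar> \<le> 3 ^ n / r ^ n" by simp
  have "\<bar>chi' (r\<^sup>2) * (2 * r) * hh r ^ n\<bar> \<le> 9 * (2 * r) * (3 ^ n / r ^ n)"
    unfolding abs_mult using chi_bounds(5)[of "r\<^sup>2"] hp[of n] h r
    by (intro mult_mono) auto
  also have "\<dots> \<le> 72 * 3 ^ n / r ^ Suc n"
  proof -
    have "r * r \<le> 2 * 2" using r by (intro mult_mono) auto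
    then have "18 * (r * r) * 3 ^ n \<le> 72 * 3 ^ n" by simp
    then show ?thesis using r by (simp add: field_simps)
  qed
  finally have 1: "\<bar>chi' (r\<^sup>2) * (2 * r) * hh r ^ n\<bar> \<le> 72 * 3 ^ n / r ^ Suc n" .
  have "\<bar>chi (r\<^sup>2) * (real n * hh r ^ (n - 1) * hh' r)\<bar> \<le> 1 * (real n * (3 ^ (n - 1) / r ^ (n - 1)) * (3 / r\<^sup>2))"
    unfolding abs_mult using chi_bounds(1,2)[of "r\<^sup>2"] hp[of "n - 1"] h r
    by (intro mult_mono) auto
  also have "\<dots> = real n * 3 ^ n / r ^ Suc n"
  proof -
    obtain j where "n = Suc j" using dim by (cases n) auto
    then show ?thesis by (simp add: power2_eq_square field_simps)
  qed
  finally have 2: "\<bar>chi (r\<^sup>2) * (real n * hh r ^ (n - 1) * hh' r)\<bar> \<le> real n * 3 ^ n / r ^ Suc n" .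
  have "\<bar>ww' r\<bar> \<le> 72 * 3 ^ n / r ^ Suc n + real n * 3 ^ n / r ^ Suc n"
    unfolding ww'_def using 1 2 by linarith
  then show "\<bar>ww' r\<bar> \<le> Kw / r ^ Suc n" unfolding Kw_def by (simp add: add_divide_distrib distrib_right del: power_Suc)
qed

text \<open>In the blown-up coordinates \<open>X = h(r) x\<close>, these are the squared height
  \<open>(X \<bullet> e)^2\<close> and the squared distance of \<open>X\<close> from the axis. Their
  sum is \<open>|X|^2 = (1 + y)^2\<close>.\<close>

definition "aa z r = (hh r * z)\<^sup>2" for z r :: real
definition "bb z r = (hh r)\<^sup>2 * (r\<^sup>2 - z\<^sup>2)" for z r :: real
definition "AA z r = z * ww r * J (aa z r) (bb z r)" for z r :: real
text \<open>The partial derivatives of \<open>AA\<close> with \<open>z\<close> and \<open>r\<close>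
  treated as independent variables; the geometric relation between the two enters only through the
  bound \<open>|z| \<le> r\<close>.\<close>

definition "AAz z r = ww r * (J (aa z r) (bb z r) + 2 * aa z r * (Ja (aa z r) (bb z r) - Jb (aa z r) (bb z r)))" for z r :: real
definition "AAr z r = z * (ww' r * J (aa z r) (bb z r) + ww r * (2 * hh r * hh' r * z\<^sup>2 * Ja (aa z r) (bb z r)
   + (2 * hh r * hh' r * (r\<^sup>2 - z\<^sup>2) + 2 * (hh r)\<^sup>2 * r) * Jb (aa z r) (bb z r)))" for z r :: real

lemma aabb:
  assumes r: "0 < r" "r \<le> 2" and z: "\<bar>z\<bar> \<le> r"
  shows "0 \<le> aa z r" "0 \<le> bb z r" "aa z r + bb z r = (1 + yy r)\<^sup>2" "aa z r \<le> 9"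
proof -
  have "z\<^sup>2 \<le> r\<^sup>2" using z r by (simp add: abs_le_square_iff[symmetric])
  then show 1: "0 \<le> aa z r" "0 \<le> bb z r" by (simp_all add: aa_def bb_def)
  have "aa z r + bb z r = (hh r * r)\<^sup>2" by (simp add: aa_def bb_def algebra_simps power_mult_distrib)
  then show 2: "aa z r + bb z r = (1 + yy r)\<^sup>2" using r by (simp add: hh_def)
  have "(1 + yy r)\<^sup>2 \<le> 3\<^sup>2" using yy_bounds[OF r] by (intro power_mono) auto
  then show "aa z r \<le> 9" using 1 2 by simp
qed

text \<open>\<open>J\<close> itself is smaller by a further factor \<open>y \<le> 2\<close>. This is
  given up so that all three averages have the common order \<open>y^k\<close>.\<close>

lemma J_yy_bounds:
  assumes r: "0 < r" "r \<le> 2" and z: "\<bar>z\<bar> \<le> r"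
  shows "\<bar>J (aa z r) (bb z r)\<bar> \<le> 2 * C * yy r ^ k" "\<bar>Ja (aa z r) (bb z r)\<bar> \<le> C * yy r ^ k"
    "\<bar>Jb (aa z r) (bb z r)\<bar> \<le> C * yy r ^ k"
proof -
  note y = yy_bounds[OF r]
  note B = J_bounds[OF C0 P_le P'_le aabb(1-3)[OF assms] less_imp_le[OF y(1)] y(2)]
  show "\<bar>Ja (aa z r) (bb z r)\<bar> \<le> C * yy r ^ k" by (rule B(2))
  show "\<bar>Jb (aa z r) (bb z r)\<bar> \<le> C * yy r ^ k" by (rule B(3))
  have "yy r ^ Suc k \<le> 2 * yy r ^ k" using y by (simp add: mult_right_mono)
  then have "C * yy r ^ Suc k \<le> C * (2 * yy r ^ k)" using C0 by (rule mult_left_mono)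
  with B(1) show "\<bar>J (aa z r) (bb z r)\<bar> \<le> 2 * C * yy r ^ k" by simp
qed

text \<open>From \<open>k = m (n - 2) - 2\<close> and \<open>beta m = 1\<close> one has
  \<open>beta k = n - 2 - 2 beta\<close>. This fixes the blow-up rate: derivatives of
  \<open>A\<close> have order \<open>-2 - 2 beta\<close>, and \<open>u\<close> gains one power of
  \<open>r\<close>.\<close>

lemma yy_k: 
  assumes "r > 0"
  shows "yy r ^ k / r ^ n = r powr (- 2 - 2 * beta)"
proof -
  have "real (m * (n - 2)) = real (Suc (Suc k))" using k by simp
  then have rk: "real k = real m * (real n - 2) - 2" using dim by (simp add: of_nat_diff)
  have "beta * real k = beta * real m * (real n - 2) - 2 * beta" unfolding rk by (simp add: algebra_simps)
  then have bk: "beta * real k = (- 2 - 2 * beta) + real n" using beta by simp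
  have "yy r ^ k = r powr (beta * real k)" using assms by (simp add: yy_def powr_powr flip: powr_realpow)
  also have "\<dots> = r powr (- 2 - 2 * beta) * r powr (real n)" unfolding bk by (rule powr_add)
  also have "r powr real n = r ^ n" using assms by (simp add: powr_realpow)
  finally show ?thesis using assms by simp
qed

text \<open>A sum, so as to dominate the bounds for \<open>AA\<close>, \<open>AAz\<close> and
  \<open>AAr\<close> at once. Here 38 = 2 + 36, with 36 from \<open>2 * aa * (Ja - Jb)\<close> and
  \<open>aa \<le> 9\<close>; the term with \<open>Kw\<close> belongs to \<open>ww'\<close>, and 54 =
  18 + 36 collects the coefficients of \<open>Ja\<close> and \<open>Jb\<close> in
  \<open>AAr\<close>.\<close>

definition "KA = 38 * 3 ^ n * C + (2 * Kw * C + 54 * 3 ^ n * C)"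

lemma KA0: "KA \<ge> 0" using C0 by (simp add: KA_def Kw_def)

lemma AA_bounds:
  assumes r: "0 < r" "r \<le> 2" and z: "\<bar>z\<bar> \<le> r"
  shows "\<bar>AA z r\<bar> \<le> r * (KA * r powr (- 2 - 2 * beta))" "\<bar>AAz z r\<bar> \<le> KA * r powr (- 2 - 2 * beta)"
    "\<bar>AAr z r\<bar> \<le> KA * r powr (- 2 - 2 * beta)"
proof -
  let ?D = "yy r ^ k / r ^ n"
  let ?J = "J (aa z r) (bb z r)" and ?Ja = "Ja (aa z r) (bb z r)" and ?Jb = "Jb (aa z r) (bb z r)"
  note w = ww_bounds[OF r] and j = J_yy_bounds[OF assms] and h = hh_bounds[OF r] and ab = aabb[OF assms]
  have D0: "?D \<ge> 0" using r yy_bounds[OF r] by simp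
  have Y0: "yy r ^ k \<ge> 0" using yy_bounds[OF r] by simp
  have Kw0: "Kw \<ge> 0" by (simp add: Kw_def)
  have mono: "c * ?D \<le> KA * ?D" if "c \<le> KA" for c using that D0 by (rule mult_right_mono)
  have "\<bar>AA z r\<bar> \<le> r * (3 ^ n / r ^ n) * (2 * C * yy r ^ k)"
    unfolding AA_def abs_mult using z w j r by (intro mult_mono) auto
  also have "\<dots> = r * ((2 * 3 ^ n * C) * ?D)" by simp
  also have "\<dots> \<le> r * (KA * ?D)"
    using r C0 Kw0 by (intro mult_left_mono mono) (auto simp: KA_def)
  finally show "\<bar>AA z r\<bar> \<le> r * (KA * r powr (- 2 - 2 * beta))" using yy_k r by simp
  have "\<bar>2 * aa z r * (?Ja - ?Jb)\<bar> \<le> 2 * 9 * (2 * C * yy r ^ k)"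
    unfolding abs_mult using ab j by (intro mult_mono) auto
  then have "\<bar>?J + 2 * aa z r * (?Ja - ?Jb)\<bar> \<le> 38 * C * yy r ^ k" using j(1) by linarith
  then have "\<bar>AAz z r\<bar> \<le> (3 ^ n / r ^ n) * (38 * C * yy r ^ k)"
    unfolding AAz_def abs_mult using w r by (intro mult_mono) auto
  also have "\<dots> = (38 * 3 ^ n * C) * ?D" by simp
  also have "\<dots> \<le> KA * ?D" using C0 Kw0 by (intro mono) (auto simp: KA_def)
  finally show "\<bar>AAz z r\<bar> \<le> KA * r powr (- 2 - 2 * beta)" using yy_k r by simp
  have zr: "z\<^sup>2 \<le> r\<^sup>2" using z r by (simp add: abs_le_square_iff[symmetric])
  have hhr: "\<bar>hh r * hh' r\<bar> * s \<le> 9 / r" if "0 \<le> s" "s \<le> r\<^sup>2" for s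
  proof -
    have "\<bar>hh r * hh' r\<bar> * s \<le> (3 / r) * (3 / r\<^sup>2) * r\<^sup>2"
      unfolding abs_mult using h that r by (intro mult_mono) auto
    also have "\<dots> = 9 / r" using r by simp
    finally show ?thesis .
  qed
  have 1: "\<bar>2 * hh r * hh' r * z\<^sup>2 * ?Ja\<bar> \<le> 18 / r * (C * yy r ^ k)"
  proof -
    have "\<bar>2 * hh r * hh' r * z\<^sup>2\<bar> \<le> 18 / r" using hhr[of "z\<^sup>2"] zr by (simp add: abs_mult)
    then show ?thesis unfolding abs_mult[of _ ?Ja] using j(2) r by (intro mult_mono) auto
  qed
  have 2: "\<bar>(2 * hh r * hh' r * (r\<^sup>2 - z\<^sup>2) + 2 * (hh r)\<^sup>2 * r) * ?Jb\<bar> \<le> 36 / r * (C * yy r ^ k)"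
  proof -
    have a: "\<bar>2 * hh r * hh' r * (r\<^sup>2 - z\<^sup>2)\<bar> \<le> 18 / r" using hhr[of "r\<^sup>2 - z\<^sup>2"] zr by (simp add: abs_mult)
    have "(hh r)\<^sup>2 \<le> (3 / r)\<^sup>2" using h by (intro power_mono) auto
    then have "(hh r)\<^sup>2 * r \<le> (3 / r)\<^sup>2 * r" using r by (intro mult_right_mono) auto
    also have "\<dots> = 9 / r" using r by (simp add: power2_eq_square)
    finally have b: "\<bar>2 * (hh r)\<^sup>2 * r\<bar> \<le> 18 / r" using r by (simp add: abs_mult)
    have "18 / r + 18 / r = 36 / r" by simp
    with a b have "\<bar>2 * hh r * hh' r * (r\<^sup>2 - z\<^sup>2) + 2 * (hh r)\<^sup>2 * r\<bar> \<le> 36 / r" by linarith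
    then show ?thesis unfolding abs_mult[of _ ?Jb] using j(3) r by (intro mult_mono) auto
  qed
  have "18 / r * (C * yy r ^ k) + 36 / r * (C * yy r ^ k) = 54 / r * (C * yy r ^ k)"
    by (simp add: field_simps)
  with 1 2 have 3: "\<bar>2 * hh r * hh' r * z\<^sup>2 * ?Ja + (2 * hh r * hh' r * (r\<^sup>2 - z\<^sup>2) + 2 * (hh r)\<^sup>2 * r) * ?Jb\<bar>
     \<le> 54 / r * (C * yy r ^ k)" by linarith
  have 4: "\<bar>ww r * (2 * hh r * hh' r * z\<^sup>2 * ?Ja + (2 * hh r * hh' r * (r\<^sup>2 - z\<^sup>2) + 2 * (hh r)\<^sup>2 * r) * ?Jb)\<bar>
    \<le> (3 ^ n / r ^ n) * (54 / r * (C * yy r ^ k))"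
    unfolding abs_mult[of "ww r"] using w 3 r by (intro mult_mono) auto
  have 5: "\<bar>ww' r * ?J\<bar> \<le> (Kw / r ^ Suc n) * (2 * C * yy r ^ k)"
    unfolding abs_mult using w j(1) r Kw0 by (intro mult_mono) auto
  have "\<bar>AAr z r\<bar> \<le> r * ((Kw / r ^ Suc n) * (2 * C * yy r ^ k) + (3 ^ n / r ^ n) * (54 / r * (C * yy r ^ k)))"
    unfolding AAr_def abs_mult[of z]
    by (intro mult_mono order_trans[OF abs_triangle_ineq add_mono] 4 5 z) (use r in auto)
  also have "\<dots> = (2 * Kw * C + 54 * 3 ^ n * C) * ?D"
    using r by (simp add: field_simps)
  also have "\<dots> \<le> KA * ?D" using C0 Kw0 by (intro mono) (auto simp: KA_def)
  finally show "\<bar>AAr z r\<bar> \<le> KA * r powr (- 2 - 2 * beta)" using yy_k r by simp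
qed

section \<open>The scalar potential as a function of the point\<close>

definition "A x = AA (x \<bullet> e) (norm x)" for x :: 'a

lemma norm_deriv: "x \<noteq> 0 \<Longrightarrow> (norm has_derivative (\<lambda>d. x \<bullet> d / norm x)) (at (x::'a))"
  by (rule has_derivative_eq_rhs[OF has_derivative_norm]) (auto simp: sgn_div_norm fun_eq_iff inner_commute divide_inverse)

lemma radial_deriv:
  assumes "x \<noteq> 0" "(f has_real_derivative f') (at (norm x))"
  shows "((\<lambda>x::'a. f (norm x)) has_derivative (\<lambda>d. f' * (x \<bullet> d / norm x))) (at x)"
  using has_derivative_compose[OF norm_deriv[OF assms(1)], of f "(*) f'"] assms(2)
  by (simp add: has_field_derivative_def)

lemma inner_e_deriv: "((\<lambda>x. x \<bullet> b) has_derivative (\<lambda>d. d \<bullet> b)) (at (x::'a))"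
  by (auto intro!: derivative_eq_intros)

lemma A_deriv:
  assumes x: "x \<noteq> 0"
  shows "(A has_derivative (\<lambda>d. AAz (x \<bullet> e) (norm x) * (d \<bullet> e) + AAr (x \<bullet> e) (norm x) * (x \<bullet> d) / norm x)) (at x)"
proof -
  define r where "r = norm x"
  define z where "z = x \<bullet> e"
  have r: "r > 0" using x by (simp add: r_def)
  have dz: "((\<lambda>x. x \<bullet> e) has_derivative (\<lambda>d. d \<bullet> e)) (at x)" by (rule inner_e_deriv)
  have dh: "((\<lambda>x. hh (norm x)) has_derivative (\<lambda>d. hh' r * (x \<bullet> d / r))) (at x)"
    unfolding r_def using x by (intro radial_deriv hh_deriv) auto
  have dw: "((\<lambda>x. ww (norm x)) has_derivative (\<lambda>d. ww' r * (x \<bullet> d / r))) (at x)"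
    unfolding r_def using x by (intro radial_deriv ww_deriv) auto
  have dn: "(norm has_derivative (\<lambda>d. x \<bullet> d / r)) (at x)" unfolding r_def using x by (rule norm_deriv)
  have da: "((\<lambda>x. aa (x \<bullet> e) (norm x)) has_derivative
     (\<lambda>d. 2 * (hh r * z) * (hh' r * (x \<bullet> d / r) * z + hh r * (d \<bullet> e)))) (at x)"
    unfolding aa_def power2_eq_square
    by (rule has_derivative_eq_rhs[OF has_derivative_mult[OF has_derivative_mult[OF dh dz] has_derivative_mult[OF dh dz]]])
      (simp add: fun_eq_iff r_def z_def algebra_simps)
  have db: "((\<lambda>x. bb (x \<bullet> e) (norm x)) has_derivative
     (\<lambda>d. 2 * hh r * hh' r * (x \<bullet> d / r) * (r\<^sup>2 - z\<^sup>2) + (hh r)\<^sup>2 * (2 * r * (x \<bullet> d / r) - 2 * z * (d \<bullet> e)))) (at x)"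
    unfolding bb_def power2_eq_square
    by (rule has_derivative_eq_rhs[OF has_derivative_mult[OF has_derivative_mult[OF dh dh]
       has_derivative_diff[OF has_derivative_mult[OF dn dn] has_derivative_mult[OF dz dz]]]])
      (simp add: fun_eq_iff r_def z_def algebra_simps)
  let ?a = "aa z r" and ?b = "bb z r"
  have "((\<lambda>x. J (aa (x \<bullet> e) (norm x)) (bb (x \<bullet> e) (norm x))) has_derivative
     (\<lambda>d. Ja ?a ?b * (2 * (hh r * z) * (hh' r * (x \<bullet> d / r) * z + hh r * (d \<bullet> e)))
        + Jb ?a ?b * (2 * hh r * hh' r * (x \<bullet> d / r) * (r\<^sup>2 - z\<^sup>2) + (hh r)\<^sup>2 * (2 * r * (x \<bullet> d / r) - 2 * z * (d \<bullet> e))))) (at x)"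
    using has_derivative_compose[OF has_derivative_Pair[OF da db] J_deriv] by (simp add: r_def z_def)
  from has_derivative_mult[OF has_derivative_mult[OF dz dw] this]
  show ?thesis unfolding A_def [abs_def] AA_def AAz_def AAr_def r_def[symmetric] z_def[symmetric]
  proof (rule has_derivative_eq_rhs)
    show "(\<lambda>d. z * ww r * (Ja ?a ?b * (2 * (hh r * z) * (hh' r * (x \<bullet> d / r) * z + hh r * (d \<bullet> e)))
        + Jb ?a ?b * (2 * hh r * hh' r * (x \<bullet> d / r) * (r\<^sup>2 - z\<^sup>2) + (hh r)\<^sup>2 * (2 * r * (x \<bullet> d / r) - 2 * z * (d \<bullet> e))))
        + (z * (ww' r * (x \<bullet> d / r)) + d \<bullet> e * ww r) * J ?a ?b)
      = (\<lambda>d. ww r * (J ?a ?b + 2 * ?a * (Ja ?a ?b - Jb ?a ?b)) * (d \<bullet> e)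
        + z * (ww' r * J ?a ?b + ww r * (2 * hh r * hh' r * z\<^sup>2 * Ja ?a ?b
          + (2 * hh r * hh' r * (r\<^sup>2 - z\<^sup>2) + 2 * (hh r)\<^sup>2 * r) * Jb ?a ?b)) * (x \<bullet> d) / r)"
    proof
      fix d
      \<comment> \<open>With this quotient abbreviated no division is left, and the claim is a
        polynomial identity in the remaining quantities.\<close>
      define s where "s = x \<bullet> d / r"
      have s: "c * (x \<bullet> d) / r = c * s" for c by (simp add: s_def)
      show "z * ww r * (Ja ?a ?b * (2 * (hh r * z) * (hh' r * (x \<bullet> d / r) * z + hh r * (d \<bullet> e)))
        + Jb ?a ?b * (2 * hh r * hh' r * (x \<bullet> d / r) * (r\<^sup>2 - z\<^sup>2) + (hh r)\<^sup>2 * (2 * r * (x \<bullet> d / r) - 2 * z * (d \<bullet> e))))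
        + (z * (ww' r * (x \<bullet> d / r)) + d \<bullet> e * ww r) * J ?a ?b
      = ww r * (J ?a ?b + 2 * ?a * (Ja ?a ?b - Jb ?a ?b)) * (d \<bullet> e)
        + z * (ww' r * J ?a ?b + ww r * (2 * hh r * hh' r * z\<^sup>2 * Ja ?a ?b
          + (2 * hh r * hh' r * (r\<^sup>2 - z\<^sup>2) + 2 * (hh r)\<^sup>2 * r) * Jb ?a ?b)) * (x \<bullet> d) / r"
        unfolding s s_def[symmetric]
        by (simp only: aa_def[of z r, unfolded power2_eq_square] power2_eq_square) algebra
    qed
  qed
qed

lemma A_partial: "x \<noteq> 0 \<Longrightarrow> partial_deriv b A x = AAz (x \<bullet> e) (norm x) * (b \<bullet> e) + AAr (x \<bullet> e) (norm x) * (x \<bullet> b) / norm x"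
  by (rule partial_deriv_eq[OF A_deriv])

lemma radial_cont:
  "continuous_on (- {0}) (\<lambda>x::'a. hh (norm x))" "continuous_on (- {0}) (\<lambda>x::'a. hh' (norm x))"
  "continuous_on (- {0}) (\<lambda>x::'a. ww (norm x))" "continuous_on (- {0}) (\<lambda>x::'a. ww' (norm x))"
  "continuous_on (- {0}) (\<lambda>x::'a. yy (norm x))"
proof -
  show y: "continuous_on (- {0}) (\<lambda>x::'a. yy (norm x))"
    unfolding yy_def by (intro continuous_intros) auto
  show h: "continuous_on (- {0}) (\<lambda>x::'a. hh (norm x))"
    unfolding hh_def by (intro continuous_intros y) auto
  show h': "continuous_on (- {0}) (\<lambda>x::'a. hh' (norm x))"
    unfolding hh'_def qq_def by (intro continuous_intros y) auto
  have c: "continuous_on (- {0}) (\<lambda>x::'a. chi ((norm x)\<^sup>2))" "continuous_on (- {0}) (\<lambda>x::'a. chi' ((norm x)\<^sup>2))"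
    by (intro continuous_on_compose2[OF chi_cont(1)] continuous_on_compose2[OF chi_cont(2)] continuous_intros; auto)+
  show "continuous_on (- {0}) (\<lambda>x::'a. ww (norm x))" "continuous_on (- {0}) (\<lambda>x::'a. ww' (norm x))"
    unfolding ww_def ww'_def by (intro continuous_intros h h' c)+
qed

lemma A_cont:
  "continuous_on (- {0}) A" "continuous_on (- {0}) (\<lambda>x. AAz (x \<bullet> e) (norm x))"
  "continuous_on (- {0}) (\<lambda>x. AAr (x \<bullet> e) (norm x))"
proof -
  note rc = radial_cont
  have a: "continuous_on (- {0}) (\<lambda>x. aa (x \<bullet> e) (norm x))"
    unfolding aa_def by (intro continuous_intros rc)
  have b: "continuous_on (- {0}) (\<lambda>x. bb (x \<bullet> e) (norm x))"
    unfolding bb_def by (intro continuous_intros rc)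
  have ab: "continuous_on (- {0}) (\<lambda>x. (aa (x \<bullet> e) (norm x), bb (x \<bullet> e) (norm x)))"
    by (intro continuous_intros a b)
  note jc = continuous_on_compose2[OF J_cont ab subset_UNIV, simplified]
    continuous_on_compose2[OF Ja_cont ab subset_UNIV, simplified]
    continuous_on_compose2[OF Jb_cont ab subset_UNIV, simplified]
  show "continuous_on (- {0}) A" unfolding A_def [abs_def] AA_def by (intro continuous_intros rc jc)
  show "continuous_on (- {0}) (\<lambda>x. AAz (x \<bullet> e) (norm x))" unfolding AAz_def by (intro continuous_intros rc jc a)
  show "continuous_on (- {0}) (\<lambda>x. AAr (x \<bullet> e) (norm x))" unfolding AAr_def by (intro continuous_intros rc jc)
qed

lemma A_zero: "norm x > 2 \<Longrightarrow> A x = 0"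
proof -
  assume "norm x > 2"
  then have "2 * 2 \<le> norm x * norm x" by (intro mult_mono) auto
  then have "chi ((norm x)\<^sup>2) = 0" by (intro chi_bounds(4)) (simp add: power2_eq_square)
  then show ?thesis by (simp add: A_def AA_def ww_def)
qed

text \<open>Up to sign, the nonzero entries of the antisymmetric matrix field \<open>A\<close> times
  the wedge of \<open>e\<close> and \<open>x\<close>, whose row-wise divergence is the
  drift.\<close>

definition "B b x = (x \<bullet> b) * A x" for b x :: 'a

lemma B_deriv: "x \<noteq> 0 \<Longrightarrow> (B b has_derivative (\<lambda>d. (x \<bullet> b) * (AAz (x \<bullet> e) (norm x) * (d \<bullet> e) + AAr (x \<bullet> e) (norm x) * (x \<bullet> d) / norm x)
   + (d \<bullet> b) * A x)) (at x)"
  unfolding B_def [abs_def] by (rule has_derivative_mult[OF inner_e_deriv A_deriv])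

lemma B_partial: "x \<noteq> 0 \<Longrightarrow> partial_deriv c (B b) x = (x \<bullet> b) * partial_deriv c A x + (c \<bullet> b) * A x"
  by (simp add: partial_deriv_eq[OF B_deriv] A_partial)

text \<open>The factor \<open>x \<bullet> b\<close> improves the order \<open>2 + 2 beta\<close> of
  the derivatives of \<open>A\<close> by one. The constant is 3 = 2 + 1: two terms from the
  derivative of \<open>A\<close>, one from that of \<open>x \<bullet> b\<close>.\<close>

lemma B_sing:
  assumes b: "b \<in> Basis"
  shows "C1_sing (1 + 2 * beta) 2 (B b)"
  unfolding C1_sing_def
proof (intro conjI allI impI ballI)
  show "B b differentiable (at x)" if "x \<noteq> 0" for x
    using B_deriv[OF that] by (auto simp: differentiable_def)
  show "continuous_on (- {0}) (partial_deriv c (B b))" for c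
  proof -
    have "continuous_on (- {0}) (\<lambda>x. (x \<bullet> b) * (AAz (x \<bullet> e) (norm x) * (c \<bullet> e) + AAr (x \<bullet> e) (norm x) * (x \<bullet> c) / norm x)
       + (c \<bullet> b) * A x)"
      by (intro continuous_intros A_cont) auto
    then show ?thesis
      by (subst continuous_on_cong[OF refl]) (auto simp: B_partial A_partial)
  qed
  show "\<exists>K\<ge>0. \<forall>x. x \<noteq> 0 \<and> norm x \<le> 2 \<longrightarrow> \<bar>B b x\<bar> \<le> K * norm x powr (1 - (1 + 2 * beta)) \<and>
     (\<forall>c\<in>Basis. \<bar>partial_deriv c (B b) x\<bar> \<le> K * norm x powr (- (1 + 2 * beta)))"
  proof (intro exI[of _ "3 * KA"] conjI allI impI ballI)
    show "0 \<le> 3 * KA" using KA0 by simp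
    fix x :: 'a assume x: "x \<noteq> 0 \<and> norm x \<le> 2"
    define r where "r = norm x"
    have r: "0 < r" "r \<le> 2" "\<bar>x \<bullet> e\<bar> \<le> r" using x Basis_le_norm[OF e, of x] by (auto simp: r_def)
    note bd = AA_bounds[OF r]
    have xb: "\<bar>x \<bullet> b\<bar> \<le> r" using Basis_le_norm[OF b] by (simp add: r_def)
    have pw: "r powr (- (1 + 2 * beta)) = r * r powr (- 2 - 2 * beta)" "r powr (1 - (1 + 2 * beta)) = r * (r * r powr (- 2 - 2 * beta))"
    proof -
      have "r * r powr (- 2 - 2 * beta) = r powr (1 + (- 2 - 2 * beta))" using r by (simp only: powr_add) simp
      then show 1: "r powr (- (1 + 2 * beta)) = r * r powr (- 2 - 2 * beta)" by simp
      have "r * r powr (- (1 + 2 * beta)) = r powr (1 + (- (1 + 2 * beta)))" using r by (simp only: powr_add) simp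
      then show "r powr (1 - (1 + 2 * beta)) = r * (r * r powr (- 2 - 2 * beta))" using 1 by simp
    qed
    have Ab: "\<bar>A x\<bar> \<le> r * (KA * r powr (- 2 - 2 * beta))" using bd by (simp add: A_def r_def)
    have D0: "KA * r powr (- 2 - 2 * beta) \<ge> 0" using KA0 by simp
    have "\<bar>B b x\<bar> \<le> r * (r * (KA * r powr (- 2 - 2 * beta)))"
      unfolding B_def abs_mult using xb Ab r by (intro mult_mono) auto
    also have "\<dots> \<le> 3 * (r * (r * (KA * r powr (- 2 - 2 * beta))))" using D0 r by simp
    finally show "\<bar>B b x\<bar> \<le> 3 * KA * norm x powr (1 - (1 + 2 * beta))"
      unfolding r_def[symmetric] pw by (simp add: algebra_simps)
    fix c :: 'a assume c: "c \<in> Basis"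
    have ce: "\<bar>c \<bullet> e\<bar> \<le> 1" "\<bar>c \<bullet> b\<bar> \<le> 1"
      using c e b by (auto simp: inner_Basis)
    have xc: "\<bar>x \<bullet> c / r\<bar> \<le> 1" using Basis_le_norm[OF c, of x] r by (simp add: r_def)
    have "\<bar>AAz (x \<bullet> e) r * (c \<bullet> e)\<bar> \<le> KA * r powr (- 2 - 2 * beta) * 1"
      unfolding abs_mult using bd ce D0 by (intro mult_mono) auto
    moreover have "\<bar>AAr (x \<bullet> e) r * (x \<bullet> c / r)\<bar> \<le> KA * r powr (- 2 - 2 * beta) * 1"
      unfolding abs_mult[of _ "x \<bullet> c / r"] using bd xc D0 by (intro mult_mono) auto
    moreover have "partial_deriv c A x = AAz (x \<bullet> e) r * (c \<bullet> e) + AAr (x \<bullet> e) r * (x \<bullet> c / r)"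
      using x by (simp add: A_partial r_def)
    ultimately have "\<bar>partial_deriv c A x\<bar> \<le> 2 * (KA * r powr (- 2 - 2 * beta))" by linarith
    then have "\<bar>(x \<bullet> b) * partial_deriv c A x\<bar> \<le> r * (2 * (KA * r powr (- 2 - 2 * beta)))"
      unfolding abs_mult using xb r by (intro mult_mono) auto
    moreover have "\<bar>(c \<bullet> b) * A x\<bar> \<le> 1 * (r * (KA * r powr (- 2 - 2 * beta)))"
      unfolding abs_mult using ce Ab by (intro mult_mono) auto
    ultimately have "\<bar>partial_deriv c (B b) x\<bar> \<le> 3 * (r * (KA * r powr (- 2 - 2 * beta)))"
      using x by (simp add: B_partial)
    then show "\<bar>partial_deriv c (B b) x\<bar> \<le> 3 * KA * norm x powr (- (1 + 2 * beta))"
      unfolding r_def[symmetric] pw by (simp add: algebra_simps)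
  qed
qed

text \<open>This is \<open>(n - 1) A e + (x \<bullet> \<nabla>A) e - (e \<bullet> \<nabla>A) x\<close>, written as a sum of plane curls so that it is
  divergence free by the symmetry of \<open>\<integral> \<partial>\<^sub>b f \<partial>\<^sub>c \<phi>\<close> in \<open>b\<close> and \<open>c\<close>.\<close>

definition u :: "'a \<Rightarrow> 'a" where
  "u x = (\<Sum>b\<in>Basis. partial_deriv b (B b) x *\<^sub>R e - partial_deriv e (B b) x *\<^sub>R b)"

text \<open>The product rule gives \<open>n A + x \<bullet> grad A\<close> along \<open>e\<close>
  from the first sum, and \<open>A e + (e \<bullet> grad A) x\<close> from the second; one
  \<open>A\<close> cancels. In the variables \<open>z\<close> and \<open>r\<close> the Euler
  operator \<open>x \<bullet> grad A\<close> reads \<open>z AAz + r AAr\<close>.\<close>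

lemma u_inner:
  assumes x: "x \<noteq> 0"
  shows "u x \<bullet> w = ((real n - 1) * A x + AAz (x \<bullet> e) (norm x) * (x \<bullet> e) + AAr (x \<bullet> e) (norm x) * norm x) * (e \<bullet> w)
     - partial_deriv e A x * (x \<bullet> w)"
proof -
  have r: "norm x \<noteq> 0" using x by simp
  have 1: "(\<Sum>b\<in>Basis. partial_deriv b (B b) x) = AAz (x \<bullet> e) (norm x) * (x \<bullet> e) + AAr (x \<bullet> e) (norm x) * norm x + real n * A x"
  proof -
    have "(\<Sum>b\<in>Basis. partial_deriv b (B b) x) = (\<Sum>b\<in>Basis. AAz (x \<bullet> e) (norm x) * ((x \<bullet> b) * (e \<bullet> b))
       + AAr (x \<bullet> e) (norm x) / norm x * ((x \<bullet> b) * (x \<bullet> b)) + A x)"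
      using x by (intro sum.cong) (auto simp: B_partial A_partial algebra_simps inner_commute)
    also have "\<dots> = AAz (x \<bullet> e) (norm x) * (x \<bullet> e) + AAr (x \<bullet> e) (norm x) / norm x * (x \<bullet> x) + real n * A x"
    proof -
      have "(\<Sum>b\<in>Basis. c * ((x \<bullet> b) * (e \<bullet> b)) + d * ((x \<bullet> b) * (x \<bullet> b)) + A x)
        = c * (x \<bullet> e) + d * (x \<bullet> x) + real n * A x" for c d :: real
        unfolding euclidean_inner[of x e] euclidean_inner[of x x] by (simp add: sum.distrib sum_distrib_left n)
      then show ?thesis .
    qed
    also have "AAr (x \<bullet> e) (norm x) / norm x * (x \<bullet> x) = AAr (x \<bullet> e) (norm x) * norm x"
      using r by (simp add: dot_square_norm power2_eq_square)
    finally show ?thesis .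
  qed
  have 2: "(\<Sum>b\<in>Basis. partial_deriv e (B b) x * (b \<bullet> w)) = partial_deriv e A x * (x \<bullet> w) + A x * (e \<bullet> w)"
  proof -
    have "(\<Sum>b\<in>Basis. partial_deriv e (B b) x * (b \<bullet> w)) = (\<Sum>b\<in>Basis. partial_deriv e A x * ((x \<bullet> b) * (w \<bullet> b))
       + A x * ((e \<bullet> b) * (w \<bullet> b)))"
      using x by (intro sum.cong) (auto simp: B_partial algebra_simps inner_commute)
    also have "\<dots> = partial_deriv e A x * (x \<bullet> w) + A x * (e \<bullet> w)"
      by (simp add: sum.distrib euclidean_inner[of x w] euclidean_inner[of e w] flip: sum_distrib_left)
    finally show ?thesis .
  qed
  have "u x \<bullet> w = (\<Sum>b\<in>Basis. partial_deriv b (B b) x) * (e \<bullet> w) - (\<Sum>b\<in>Basis. partial_deriv e (B b) x * (b \<bullet> w))"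
    by (simp add: u_def inner_sum_left inner_diff_left sum_subtractf sum_distrib_right)
  then show ?thesis unfolding 1 2 by (simp add: algebra_simps)
qed

end

subsection \<open>Weak formulations\<close>

lemma integrable_sing:
  fixes g :: "'a::euclidean_space \<Rightarrow> 'b::euclidean_space"
  assumes g: "g \<in> borel_measurable borel"
    and b: "\<And>x. x \<noteq> 0 \<Longrightarrow> norm x \<le> R \<Longrightarrow> norm (g x) \<le> K * norm x powr (- \<alpha>)"
    and z: "\<And>x. norm x > R \<Longrightarrow> g x = 0" and \<alpha>: "\<alpha> < real DIM('a)"
  shows "integrable lborel g"
proof (rule Bochner_Integration.integrable_bound)
  show "integrable lborel (\<lambda>x::'a. K * (indicator (cball 0 R) x * norm x powr (- \<alpha>)))"
    by (intro integrable_mult_right integrable_norm_powr \<alpha>)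
  show "AE x in lborel. norm (g x) \<le> norm (K * (indicator (cball 0 R) x * norm x powr (- \<alpha>)))"
    using AE_lborel_nonzero
  proof eventually_elim
    case (elim x)
    show ?case
    proof (cases "norm x \<le> R")
      case True
      then show ?thesis using b[OF elim True] by simp
    next
      case False
      then show ?thesis using z[of x] by simp
    qed
  qed
qed (use g in simp)

text \<open>The notions to be verified integrate over \<open>lebesgue_on\<close>, while the analysis
  is carried out in \<open>lborel\<close>. For Borel functions the two agree, Lebesgue measure being
  the completion.\<close>

lemma lebesgue_on_lborel:
  fixes f :: "'a::euclidean_space \<Rightarrow> 'b::euclidean_space"
  assumes f: "f \<in> borel_measurable borel" and S: "S \<in> sets borel"
  shows "integrable (lebesgue_on S) f \<longleftrightarrow> integrable lborel (\<lambda>x. indicator S x *\<^sub>R f x)"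
    and "(LINT x|lebesgue_on S. f x) = (LINT x|lborel. indicator S x *\<^sub>R f x)"
    and "f \<in> borel_measurable (lebesgue_on S)"
proof -
  have m: "(\<lambda>x. indicator S x *\<^sub>R f x) \<in> borel_measurable lborel" using f S by simp
  have S': "S \<inter> space lebesgue \<in> sets lebesgue" using S by simp
  show "integrable (lebesgue_on S) f \<longleftrightarrow> integrable lborel (\<lambda>x. indicator S x *\<^sub>R f x)"
    by (simp add: integrable_restrict_space[OF S'] integrable_completion[OF m])
  show "(LINT x|lebesgue_on S. f x) = (LINT x|lborel. indicator S x *\<^sub>R f x)"
    by (simp add: integral_restrict_space[OF S'] integral_completion[OF m])
  have "f \<in> borel_measurable lebesgue" using f by (intro measurable_completion) simp
  then show "f \<in> borel_measurable (lebesgue_on S)" by (rule measurable_restrict_space1)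
qed

lemma integrable_lebesgue_on:
  fixes f :: "'a::euclidean_space \<Rightarrow> 'b::euclidean_space"
  assumes "f \<in> borel_measurable borel" "S \<in> sets borel" "T \<in> sets borel" "S \<subseteq> T" "integrable lborel (\<lambda>x. indicator T x *\<^sub>R f x)"
  shows "integrable (lebesgue_on S) f"
proof -
  have 1: "integrable lborel (\<lambda>x. indicator S x *\<^sub>R (indicator T x *\<^sub>R f x))"
    using assms(2,5) by (rule_tac integrable_mult_indicator) auto
  have "(\<lambda>x. indicator S x *\<^sub>R (indicator T x *\<^sub>R f x)) = (\<lambda>x. indicator S x *\<^sub>R f x)"
    using assms(4) by (auto simp: indicator_def fun_eq_iff)
  with 1 show ?thesis by (simp only: lebesgue_on_lborel(1)[OF assms(1,2)])
qed

text \<open>Smoothness is used up to order two. Off the closed support a test function vanishes on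
  an open set, which kills all its derivatives there.\<close>

lemma test_functionD:
  assumes "test_function_on \<Omega> \<phi>"
  shows "\<exists>S. C1_cpt S \<phi> \<and> (\<forall>b\<in>Basis. C1_cpt S (partial_deriv b \<phi>)) \<and>
    (\<forall>x. x \<notin> \<Omega> \<longrightarrow> \<phi> x = 0 \<and> laplacian \<phi> x = 0 \<and> (\<forall>b. partial_deriv b \<phi> x = 0))"
proof -
  let ?T = "closure {x. \<phi> x \<noteq> 0}"
  have Ck: "Ck j \<phi>" for j using assms by (simp add: test_function_on_def)
  have T: "compact ?T" "?T \<subseteq> \<Omega>" using assms by (auto simp: test_function_on_def)
  have z0: "\<phi> x = 0" if "x \<notin> ?T" for x using that closure_subset[of "{x. \<phi> x \<noteq> 0}"] by blast
  have z: "partial_deriv b f x = 0" if "x \<notin> ?T" "\<And>x. x \<notin> ?T \<Longrightarrow> f x = 0" for f :: "'a \<Rightarrow> real" and b x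
  proof -
    have "(f has_derivative (\<lambda>_. 0)) (at x)"
    proof (rule has_derivative_transform_within_open[OF has_derivative_const[of 0]])
      show "open (- ?T)" by (intro open_Compl closed_closure)
    qed (use that in auto)
    from partial_deriv_eq[OF this] show ?thesis .
  qed
  have z1: "partial_deriv b \<phi> x = 0" if "x \<notin> ?T" for b x by (rule z[OF that z0])
  have z2: "partial_deriv c (partial_deriv b \<phi>) x = 0" if "x \<notin> ?T" for b c x by (rule z[OF that z1])
  obtain S where S: "\<And>x. x \<in> ?T \<Longrightarrow> norm x \<le> S"
    using compact_imp_bounded[OF T(1)] unfolding bounded_iff by blast
  then have out: "x \<notin> ?T" if "norm x > S" for x using that by force
  have d1: "\<phi> differentiable (at x)" for x
    using Ck[of 1] by (simp add: differentiable_on_def)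
  have c1: "continuous_on UNIV (partial_deriv b \<phi>)" if "b \<in> Basis" for b
    using Ck[of 1] that by simp
  have d2: "partial_deriv b \<phi> differentiable (at x)" if "b \<in> Basis" for b x
    using Ck[of 2] that by (simp add: numeral_2_eq_2 differentiable_on_def)
  have c2: "continuous_on UNIV (partial_deriv c (partial_deriv b \<phi>))" if "b \<in> Basis" "c \<in> Basis" for b c
    using Ck[of 2] that by (simp add: numeral_2_eq_2)
  have "C1_cpt S \<phi>" using d1 c1 z0[OF out] by (simp add: C1_cpt_def)
  moreover have "C1_cpt S (partial_deriv b \<phi>)" if "b \<in> Basis" for b
    using d2[OF that] c2[OF that] z1[OF out] by (simp add: C1_cpt_def)
  moreover have "\<phi> x = 0 \<and> laplacian \<phi> x = 0 \<and> (\<forall>b. partial_deriv b \<phi> x = 0)" if "x \<notin> \<Omega>" for x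
  proof -
    have x: "x \<notin> ?T" using that T(2) by blast
    have "laplacian \<phi> x = 0" unfolding laplacian_def by (intro sum.neutral ballI z2[OF x])
    then show ?thesis using z0[OF x] z1[OF x] by blast
  qed
  ultimately show ?thesis by blast
qed

lemma grad_inner: "b \<in> Basis \<Longrightarrow> grad f x \<bullet> b = partial_deriv b f x"
  by (simp add: grad_def inner_sum_left inner_Basis if_distrib sum.delta cong: if_cong)

lemma C1_sing_partial_borel:
  assumes "C1_sing \<alpha> R f" "b \<in> Basis"
  shows "partial_deriv b f \<in> borel_measurable borel" "f \<in> borel_measurable borel"
proof -
  show "partial_deriv b f \<in> borel_measurable borel" using assms by (intro borel_measurable_punctured_continuous) (simp add: C1_sing_def)
  show "f \<in> borel_measurable borel" using assms(1)
    by (intro borel_measurable_punctured_continuous continuous_at_imp_continuous_on) (auto simp: C1_sing_def intro: differentiable_imp_continuous_within)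
qed

text \<open>The disjunctions let either factor supply the bounded support: the potentials do so in
  the divergence identity, the test function in the weak identities for \<open>v\<close>.\<close>

lemma C1_sing_integrable:
  fixes f :: "'a::euclidean_space \<Rightarrow> real"
  assumes f: "C1_sing \<alpha> R f" and R: "R \<ge> 0" and \<alpha>: "\<alpha> < real DIM('a)" and b: "b \<in> Basis"
    and g: "continuous_on UNIV g" "\<And>x. \<bar>g x\<bar> \<le> E" and z: "\<And>x. norm x > R \<Longrightarrow> f x = 0 \<or> g x = 0"
  shows "integrable lborel (\<lambda>x. f x * g x)"
    and "(\<And>x. norm x > R \<Longrightarrow> partial_deriv b f x = 0 \<or> g x = 0) \<Longrightarrow> integrable lborel (\<lambda>x. partial_deriv b f x * g x)"
proof -
  obtain K where K: "K \<ge> 0" "\<And>x. x \<noteq> 0 \<Longrightarrow> norm x \<le> R \<Longrightarrow> \<bar>f x\<bar> \<le> K * norm x powr (1 - \<alpha>)"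
    "\<And>x b. x \<noteq> 0 \<Longrightarrow> norm x \<le> R \<Longrightarrow> b \<in> Basis \<Longrightarrow> \<bar>partial_deriv b f x\<bar> \<le> K * norm x powr (- \<alpha>)"
    using f unfolding C1_sing_def by blast
  have E: "E \<ge> 0" using g(2)[of 0] by linarith
  note m = C1_sing_partial_borel[OF f b] borel_measurable_continuous_onI[OF g(1)]
  show "integrable lborel (\<lambda>x. f x * g x)"
  proof (rule integrable_sing[where R = R and K = "K * R * E" and \<alpha> = \<alpha>, OF _ _ _ \<alpha>])
    fix x :: 'a assume x: "x \<noteq> 0" "norm x \<le> R"
    have "\<bar>f x\<bar> * \<bar>g x\<bar> \<le> K * norm x powr (1 - \<alpha>) * E"
      using K(2)[OF x] g(2)[of x] K(1) by (intro mult_mono) auto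
    also have "norm x powr (1 - \<alpha>) = norm x * norm x powr (- \<alpha>)"
      using x by (simp add: powr_diff powr_minus divide_inverse)
    also have "K * (norm x * norm x powr (- \<alpha>)) * E \<le> K * (R * norm x powr (- \<alpha>)) * E"
      using x K E by (intro mult_right_mono mult_left_mono) auto
    finally show "norm (f x * g x) \<le> K * R * E * norm x powr (- \<alpha>)" by (simp add: abs_mult algebra_simps)
  qed (use m z in auto)
  show "integrable lborel (\<lambda>x. partial_deriv b f x * g x)" if z': "\<And>x. norm x > R \<Longrightarrow> partial_deriv b f x = 0 \<or> g x = 0"
  proof (rule integrable_sing[where R = R and K = "K * E" and \<alpha> = \<alpha>, OF _ _ _ \<alpha>])
    fix x :: 'a assume x: "x \<noteq> 0" "norm x \<le> R"
    have "\<bar>partial_deriv b f x\<bar> * \<bar>g x\<bar> \<le> K * norm x powr (- \<alpha>) * E"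
      using K(3)[OF x b] g(2)[of x] K(1) by (intro mult_mono) auto
    then show "norm (partial_deriv b f x * g x) \<le> K * E * norm x powr (- \<alpha>)" by (simp add: abs_mult algebra_simps)
  qed (use m z' in auto)
qed

lemma C1_cpt_bounded:
  assumes "C1_cpt S p"
  shows "\<exists>E. (\<forall>x. \<bar>p x\<bar> \<le> E) \<and> (\<forall>b\<in>Basis. \<forall>x. \<bar>partial_deriv b p x\<bar> \<le> E)"
proof -
  have p: "continuous_on UNIV (partial_deriv b p)" if "b \<in> Basis" for b using assms that by (simp add: C1_cpt_def)
  have pz: "p x = 0" if "norm x > S" for x using assms that by (simp add: C1_cpt_def)
  obtain E0 where E0: "\<And>x. \<bar>p x\<bar> \<le> E0"
    using continuous_cpt_bounded[OF C1_cpt_cont[OF assms] pz] by blast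
  have "\<exists>E. \<forall>x. \<bar>partial_deriv b p x\<bar> \<le> E" if "b \<in> Basis" for b
    using continuous_cpt_bounded[OF p[OF that] C1_cpt_partial_zero[OF assms]] by metis
  then obtain E1 where E1: "\<And>b x. b \<in> Basis \<Longrightarrow> \<bar>partial_deriv b p x\<bar> \<le> E1 b" by metis
  let ?E = "Max (insert E0 (E1 ` Basis))"
  have "\<bar>p x\<bar> \<le> ?E" for x
    using E0[of x] Max_ge[of "insert E0 (E1 ` Basis)" E0] by (simp add: order_trans)
  moreover have "\<bar>partial_deriv b p x\<bar> \<le> ?E" if "b \<in> Basis" for b x
    using E1[OF that, of x] Max_ge[of "insert E0 (E1 ` Basis)" "E1 b"] that by (auto intro: order_trans)
  ultimately show ?thesis by blast
qed

text \<open>The product \<open>f * p\<close> is again a singular C1 function of order \<alpha>, and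
  it is supported in the ball of radius \<open>R\<close>, so its derivative integrates to zero; the
  product rule fails at most at the origin, a null set.\<close>

lemma integral_by_parts_sing:
  fixes f :: "'a::euclidean_space \<Rightarrow> real"
  assumes f: "C1_sing \<alpha> R f" and R: "R \<ge> 0" and \<alpha>: "\<alpha> < real DIM('a)" and b: "b \<in> Basis"
    and p: "C1_cpt S p" and z: "\<And>x. norm x > R \<Longrightarrow> p x = 0"
  shows "(LINT x|lborel. f x * partial_deriv b p x) = - (LINT x|lborel. partial_deriv b f x * p x)"
    and "integrable lborel (\<lambda>x. f x * partial_deriv b p x)" "integrable lborel (\<lambda>x. partial_deriv b f x * p x)"
proof -
  obtain E where E: "\<And>x. \<bar>p x\<bar> \<le> E" "\<And>b x. b \<in> Basis \<Longrightarrow> \<bar>partial_deriv b p x\<bar> \<le> E"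
    using C1_cpt_bounded[OF p] by blast
  have cp: "continuous_on UNIV (partial_deriv b p)" using p b by (simp add: C1_cpt_def)
  have z': "partial_deriv b p x = 0" if "norm x > R" for x using z that by (rule partial_deriv_zero_outside)
  show i1: "integrable lborel (\<lambda>x. f x * partial_deriv b p x)"
    using z' E(2)[OF b] by (intro C1_sing_integrable(1)[OF f R \<alpha> b cp]) auto
  show i2: "integrable lborel (\<lambda>x. partial_deriv b f x * p x)"
    using z E(1) by (intro C1_sing_integrable(2)[OF f R \<alpha> b C1_cpt_cont[OF p]]) auto
  have "0 = (LINT x|lborel. partial_deriv b (\<lambda>x. f x * p x) x)"
    using z by (intro integral_partial_deriv_sing[OF C1_sing_mult[OF f p R] _ \<alpha> b, symmetric]) auto
  also have "\<dots> = (LINT x|lborel. f x * partial_deriv b p x + partial_deriv b f x * p x)"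
  proof (rule integral_cong_AE)
    have m: "(\<lambda>x. f x * partial_deriv b p x + partial_deriv b f x * p x) \<in> borel_measurable lborel"
      using i1 i2 by auto
    then show "(\<lambda>x. f x * partial_deriv b p x + partial_deriv b f x * p x) \<in> borel_measurable lborel" .
    show "partial_deriv b (\<lambda>x. f x * p x) \<in> borel_measurable lborel"
      using C1_sing_partial_borel(1)[OF C1_sing_mult[OF f p R] b] by simp
    show "AE x in lborel. partial_deriv b (\<lambda>x. f x * p x) x = f x * partial_deriv b p x + partial_deriv b f x * p x"
      using AE_lborel_nonzero
      by eventually_elim (use f p in \<open>auto intro!: partial_deriv_mult simp: C1_sing_def C1_cpt_def\<close>)
  qed
  also have "\<dots> = (LINT x|lborel. f x * partial_deriv b p x) + (LINT x|lborel. partial_deriv b f x * p x)"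
    using i1 i2 by simp
  finally show "(LINT x|lborel. f x * partial_deriv b p x) = - (LINT x|lborel. partial_deriv b f x * p x)" by simp
qed

subsection \<open>The solution\<close>

context drift
begin

definition v :: "'a \<Rightarrow> real" where
  "v x = (x \<bullet> e) * hh (norm x)"

text \<open>This is \<open>h'(r) / r\<close>, so that the gradient of \<open>v\<close> is
  \<open>h e + z kp x\<close>.\<close>

definition "kp r = qq r / r ^ 3" for r :: real
definition "kp' r = ((beta - 1) * beta * yy r - 3 * qq r) / r ^ 4" for r :: real

lemma kp_deriv:
  assumes "r > 0"
  shows "(kp has_real_derivative kp' r) (at r)"
  unfolding kp_def [abs_def] qq_def [abs_def] using assms
  by (auto intro!: derivative_eq_intros yy_deriv simp: kp'_def qq_def field_simps eval_nat_numeral)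

lemma kp_bounds:
  assumes r: "0 < r" "r \<le> 2"
  shows "\<bar>kp r\<bar> \<le> 3 / r ^ 3" "\<bar>kp' r\<bar> \<le> 11 / r ^ 4"
proof -
  note q = hh_bounds(3)[OF r] and y = yy_bounds[OF r]
  show "\<bar>kp r\<bar> \<le> 3 / r ^ 3" using q r by (simp add: kp_def divide_right_mono)
  \<comment> \<open>11 = 2 + 3 * 3, the second part from \<open>|qq r| \<le> 3\<close>.\<close>
  have "\<bar>(beta - 1) * beta * yy r\<bar> \<le> 1 * 1 * 2"
    unfolding abs_mult using y beta by (intro mult_mono) auto
  then have "\<bar>(beta - 1) * beta * yy r - 3 * qq r\<bar> \<le> 11" using q by linarith
  then show "\<bar>kp' r\<bar> \<le> 11 / r ^ 4" using r by (simp add: kp'_def divide_right_mono)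
qed

lemma v_deriv:
  assumes x: "x \<noteq> 0"
  shows "(v has_derivative (\<lambda>d. (d \<bullet> e) * hh (norm x) + (x \<bullet> e) * (x \<bullet> d) * kp (norm x))) (at x)"
  unfolding v_def [abs_def]
  by (rule has_derivative_eq_rhs[OF has_derivative_mult[OF inner_e_deriv radial_deriv[OF x hh_deriv]]])
    (use x in \<open>auto simp: fun_eq_iff hh'_def kp_def power2_eq_square power3_eq_cube\<close>)

lemma v_partial: "x \<noteq> 0 \<Longrightarrow> partial_deriv b v x = (b \<bullet> e) * hh (norm x) + (x \<bullet> e) * (x \<bullet> b) * kp (norm x)"
  by (rule partial_deriv_eq[OF v_deriv])

lemma vv_deriv:
  assumes x: "x \<noteq> 0"
  shows "(partial_deriv b v has_derivative (\<lambda>d. (b \<bullet> e) * (hh' (norm x) * (x \<bullet> d / norm x))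
    + ((d \<bullet> e) * (x \<bullet> b) + (x \<bullet> e) * (d \<bullet> b)) * kp (norm x)
    + (x \<bullet> e) * (x \<bullet> b) * (kp' (norm x) * (x \<bullet> d / norm x)))) (at x)"
proof (rule has_derivative_transform_within_open[where f = "\<lambda>x. (b \<bullet> e) * hh (norm x) + (x \<bullet> e) * (x \<bullet> b) * kp (norm x)"])
  have r: "norm x > 0" using x by simp
  show "((\<lambda>x. (b \<bullet> e) * hh (norm x) + (x \<bullet> e) * (x \<bullet> b) * kp (norm x)) has_derivative
    (\<lambda>d. (b \<bullet> e) * (hh' (norm x) * (x \<bullet> d / norm x))
    + ((d \<bullet> e) * (x \<bullet> b) + (x \<bullet> e) * (d \<bullet> b)) * kp (norm x)
    + (x \<bullet> e) * (x \<bullet> b) * (kp' (norm x) * (x \<bullet> d / norm x)))) (at x)"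
    by (rule has_derivative_eq_rhs[OF has_derivative_add[OF has_derivative_mult_right[OF radial_deriv[OF x hh_deriv[OF r]]]
       has_derivative_mult[OF has_derivative_mult[OF inner_e_deriv inner_e_deriv] radial_deriv[OF x kp_deriv[OF r]]]]])
      (simp add: fun_eq_iff algebra_simps)
  show "open (- {0::'a})" by (intro open_Compl closed_singleton)
qed (use x v_partial in auto)

lemma vv_partial:
  "x \<noteq> 0 \<Longrightarrow> partial_deriv c (partial_deriv b v) x = (b \<bullet> e) * (hh' (norm x) * (x \<bullet> c / norm x))
    + ((c \<bullet> e) * (x \<bullet> b) + (x \<bullet> e) * (c \<bullet> b)) * kp (norm x)
    + (x \<bullet> e) * (x \<bullet> b) * (kp' (norm x) * (x \<bullet> c / norm x))"
  by (rule partial_deriv_eq[OF vv_deriv])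

lemma kp_cont: "continuous_on (- {0}) (\<lambda>x::'a. kp (norm x))" "continuous_on (- {0}) (\<lambda>x::'a. kp' (norm x))"
  unfolding kp_def kp'_def qq_def by (intro continuous_intros radial_cont; auto)+

lemma v_bounds:
  assumes x: "x \<noteq> 0" "norm x \<le> 2" and b: "b \<in> Basis" and c: "c \<in> Basis"
  shows "\<bar>v x\<bar> \<le> 3" "\<bar>partial_deriv b v x\<bar> \<le> 6 / norm x" "\<bar>partial_deriv c (partial_deriv b v) x\<bar> \<le> 20 / (norm x)\<^sup>2"
proof -
  define r where "r = norm x"
  have r: "0 < r" "r \<le> 2" using x by (auto simp: r_def)
  have xe: "\<bar>x \<bullet> e\<bar> \<le> r" and xb: "\<bar>x \<bullet> b\<bar> \<le> r" and xc: "\<bar>x \<bullet> c\<bar> \<le> r"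
    using Basis_le_norm[OF e, of x] Basis_le_norm[OF b, of x] Basis_le_norm[OF c, of x] by (auto simp: r_def)
  have ip: "\<bar>b \<bullet> e\<bar> \<le> 1" "\<bar>c \<bullet> e\<bar> \<le> 1" "\<bar>c \<bullet> b\<bar> \<le> 1" using b c e by (auto simp: inner_Basis)
  note h = hh_bounds[OF r] and kb = kp_bounds[OF r]
  have xcr: "\<bar>x \<bullet> c / r\<bar> \<le> 1" using xc r by simp
  have "\<bar>v x\<bar> \<le> r * (3 / r)" unfolding v_def abs_mult r_def[symmetric] using xe h r by (intro mult_mono) auto
  then show "\<bar>v x\<bar> \<le> 3" using r by simp
  have "\<bar>(b \<bullet> e) * hh r\<bar> \<le> 1 * (3 / r)" unfolding abs_mult using ip h by (intro mult_mono) auto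
  moreover have "\<bar>(x \<bullet> e) * (x \<bullet> b) * kp r\<bar> \<le> r * r * (3 / r ^ 3)"
    unfolding abs_mult using xe xb kb r by (intro mult_mono) auto
  moreover have "r * r * (3 / r ^ 3) = 3 / r" using r by (simp add: power3_eq_cube)
  moreover have "3 / r + 3 / r = 6 / r" by simp
  ultimately show "\<bar>partial_deriv b v x\<bar> \<le> 6 / norm x" 
    unfolding v_partial[OF x(1)] r_def[symmetric] by linarith
  have 1: "\<bar>(b \<bullet> e) * (hh' r * (x \<bullet> c / r))\<bar> \<le> 1 * (3 / r\<^sup>2 * 1)"
    unfolding abs_mult[of "b \<bullet> e"] abs_mult[of "hh' r"] using ip h xcr by (intro mult_mono) auto
  have "\<bar>(c \<bullet> e) * (x \<bullet> b)\<bar> \<le> 1 * r" "\<bar>(x \<bullet> e) * (c \<bullet> b)\<bar> \<le> r * 1"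
    unfolding abs_mult by (intro mult_mono ip xe xb; use r in simp)+
  then have "\<bar>(c \<bullet> e) * (x \<bullet> b) + (x \<bullet> e) * (c \<bullet> b)\<bar> \<le> 2 * r" by linarith
  then have 2: "\<bar>((c \<bullet> e) * (x \<bullet> b) + (x \<bullet> e) * (c \<bullet> b)) * kp r\<bar> \<le> 2 * r * (3 / r ^ 3)"
    unfolding abs_mult[of _ "kp r"] using kb r by (intro mult_mono) auto
  have 3: "\<bar>(x \<bullet> e) * (x \<bullet> b) * (kp' r * (x \<bullet> c / r))\<bar> \<le> r * r * (11 / r ^ 4 * 1)"
    unfolding abs_mult[of _ "kp' r * (x \<bullet> c / r)"] abs_mult[of "x \<bullet> e"] abs_mult[of "kp' r"]
    using xe xb xcr kb r by (intro mult_mono) auto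
  \<comment> \<open>The three terms of the second derivative contribute 3, 6 and 11.\<close>
  have "1 * (3 / r\<^sup>2 * 1) + 2 * r * (3 / r ^ 3) + r * r * (11 / r ^ 4 * 1) = 20 / r\<^sup>2"
    using r by (simp add: field_simps eval_nat_numeral)
  moreover have "\<bar>f + g + h\<bar> \<le> D" if "\<bar>f\<bar> \<le> F" "\<bar>g\<bar> \<le> G" "\<bar>h\<bar> \<le> H" "F + G + H = D" for f g h F G H D :: real
    using that by linarith
  ultimately show "\<bar>partial_deriv c (partial_deriv b v) x\<bar> \<le> 20 / (norm x)\<^sup>2"
    unfolding vv_partial[OF x(1)] r_def[symmetric] using 1 2 3 by blast
qed

lemma v_sing: "C1_sing 1 2 v"
  unfolding C1_sing_def
proof (intro conjI allI impI ballI)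
  show "v differentiable (at x)" if "x \<noteq> 0" for x using v_deriv[OF that] by (auto simp: differentiable_def)
  show "continuous_on (- {0}) (partial_deriv b v)" for b
    by (subst continuous_on_cong[OF refl v_partial]) (auto intro!: continuous_intros radial_cont kp_cont)
  show "\<exists>K\<ge>0. \<forall>x. x \<noteq> 0 \<and> norm x \<le> 2 \<longrightarrow> \<bar>v x\<bar> \<le> K * norm x powr (1 - 1) \<and>
        (\<forall>b\<in>Basis. \<bar>partial_deriv b v x\<bar> \<le> K * norm x powr (- 1))"
  proof (intro exI[of _ 6] conjI allI impI ballI)
    fix x :: 'a assume x: "x \<noteq> 0 \<and> norm x \<le> 2"
    show "\<bar>v x\<bar> \<le> 6 * norm x powr (1 - 1)" using v_bounds(1)[OF _ _ e e, of x] x by simp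
    show "\<bar>partial_deriv b v x\<bar> \<le> 6 * norm x powr (- 1)" if "b \<in> Basis" for b
      using v_bounds(2)[OF _ _ that e, of x] x by (simp add: powr_minus divide_inverse)
  qed simp
qed

text \<open>Order 2 is still below the dimension because \<open>n \<ge> 3\<close>; this admits the
  second integration by parts in the weak equation.\<close>

lemma vv_sing:
  assumes b: "b \<in> Basis"
  shows "C1_sing 2 2 (partial_deriv b v)"
  unfolding C1_sing_def
proof (intro conjI allI impI ballI)
  show "partial_deriv b v differentiable (at x)" if "x \<noteq> 0" for x using vv_deriv[OF that] by (auto simp: differentiable_def)
  show "continuous_on (- {0}) (partial_deriv c (partial_deriv b v))" for c
    by (subst continuous_on_cong[OF refl vv_partial]) (auto intro!: continuous_intros radial_cont kp_cont)
  show "\<exists>K\<ge>0. \<forall>x. x \<noteq> 0 \<and> norm x \<le> 2 \<longrightarrow> \<bar>partial_deriv b v x\<bar> \<le> K * norm x powr (1 - 2) \<and>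
        (\<forall>c\<in>Basis. \<bar>partial_deriv c (partial_deriv b v) x\<bar> \<le> K * norm x powr (- 2))"
  proof (intro exI[of _ 20] conjI allI impI ballI)
    fix x :: 'a assume x: "x \<noteq> 0 \<and> norm x \<le> 2"
    have "6 / norm x \<le> 20 / norm x" by (intro divide_right_mono) auto
    then show "\<bar>partial_deriv b v x\<bar> \<le> 20 * norm x powr (1 - 2)"
      using v_bounds(2)[OF _ _ b e, of x] x by (simp add: powr_minus divide_inverse)
    show "\<bar>partial_deriv c (partial_deriv b v) x\<bar> \<le> 20 * norm x powr (- 2)" if "c \<in> Basis" for c
      using v_bounds(3)[OF _ _ b that, of x] x by (simp add: powr_minus powr_numeral divide_inverse)
  qed simp
qed

lemma grad_v:
  assumes "x \<noteq> 0"
  shows "w \<bullet> grad v x = (w \<bullet> e) * hh (norm x) + (x \<bullet> e) * (w \<bullet> x) * kp (norm x)"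
proof -
  have "w \<bullet> grad v x = (\<Sum>b\<in>Basis. hh (norm x) * ((w \<bullet> b) * (e \<bullet> b)) + (x \<bullet> e) * kp (norm x) * ((w \<bullet> b) * (x \<bullet> b)))"
    by (simp add: grad_def inner_sum_right v_partial[OF assms] algebra_simps inner_commute)
  also have "\<dots> = hh (norm x) * (w \<bullet> e) + (x \<bullet> e) * kp (norm x) * (w \<bullet> x)"
    unfolding euclidean_inner[of w e] euclidean_inner[of w x] by (simp add: sum.distrib sum_distrib_left)
  finally show ?thesis by (simp add: algebra_simps)
qed

text \<open>The value is \<open>z (h'' + (n + 1) h' / r)\<close>, the second derivative of
  \<open>h\<close> being hidden in \<open>kp' r * r = h'' - h' / r\<close>.\<close>

lemma laplacian_v:
  assumes x: "x \<noteq> 0"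
  shows "laplacian v x = (x \<bullet> e) * ((real n - 1) * qq (norm x) + (beta - 1) * beta * yy (norm x)) / norm x ^ 3"
proof -
  define r where "r = norm x"
  have r: "r \<noteq> 0" using x by (simp add: r_def)
  have "laplacian v x = (\<Sum>b\<in>Basis. (hh' r / r + kp r) * ((x \<bullet> b) * (e \<bullet> b))
    + (x \<bullet> e) * kp' r / r * ((x \<bullet> b) * (x \<bullet> b)) + (x \<bullet> e) * kp r)"
    unfolding laplacian_def
    by (intro sum.cong refl) (simp add: vv_partial[OF x] r_def[symmetric] algebra_simps inner_commute)
  also have "\<dots> = (hh' r / r + kp r) * (x \<bullet> e) + (x \<bullet> e) * kp' r / r * (x \<bullet> x) + real n * ((x \<bullet> e) * kp r)"
  proof -
    have "(\<Sum>b\<in>Basis. c * ((x \<bullet> b) * (e \<bullet> b)) + d * ((x \<bullet> b) * (x \<bullet> b)) + f)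
      = c * (x \<bullet> e) + d * (x \<bullet> x) + real n * f" for c d f :: real
      unfolding euclidean_inner[of x e] euclidean_inner[of x x] by (simp add: sum.distrib sum_distrib_left n)
    then show ?thesis .
  qed
  also have "x \<bullet> x = r * r" by (simp add: r_def dot_square_norm power2_eq_square)
  finally have L: "laplacian v x = (hh' r / r + kp r) * (x \<bullet> e) + (x \<bullet> e) * kp' r / r * (r * r) + real n * ((x \<bullet> e) * kp r)" .
  have "hh' r / r = qq r / r ^ 3" by (simp add: hh'_def power2_eq_square power3_eq_cube)
  moreover have "kp' r * r = ((beta - 1) * beta * yy r - 3 * qq r) / r ^ 3"
    using r by (simp add: kp'_def eval_nat_numeral)
  moreover have "laplacian v x = (x \<bullet> e) * (hh' r / r + kp r + kp' r * r + real n * kp r)"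
    unfolding L using r by (simp add: algebra_simps)
  ultimately have "laplacian v x = (x \<bullet> e) * (2 * (qq r / r ^ 3) + ((beta - 1) * beta * yy r - 3 * qq r) / r ^ 3 + real n * (qq r / r ^ 3))"
    by (simp only: kp_def) (simp only: mult_2)
  also have "\<dots> = (x \<bullet> e) * ((real n - 1) * qq r + (beta - 1) * beta * yy r) / r ^ 3"
    by (simp add: add_divide_distrib diff_divide_distrib algebra_simps)
  finally show ?thesis unfolding r_def .
qed

text \<open>In the unit ball the cutoff is 1 with derivative 0, so \<open>ww\<close> is
  \<open>h^n\<close>. The Euler relation of the average then removes every integral and leaves the
  single value of \<open>P\<close> at \<open>(1 + y)^2\<close>, which \<open>P_eq\<close>
  prescribes.\<close>

lemma u_grad_v:
  assumes x: "x \<noteq> 0" "norm x < 1"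
  shows "u x \<bullet> grad v x = laplacian v x"
proof -
  define r where "r = norm x"
  define z where "z = x \<bullet> e"
  define N where "N = real n"
  define W where "W = hh r ^ (n - 1)"
  define \<kappa> where "\<kappa> = kp r"
  define h where "h = hh r"
  let ?J = "J (aa z r) (bb z r)" and ?Ja = "Ja (aa z r) (bb z r)" and ?Jb = "Jb (aa z r) (bb z r)"
  have r: "0 < r" "r < 1" using x by (auto simp: r_def)
  have z: "\<bar>z\<bar> \<le> r" using Basis_le_norm[OF e] by (simp add: z_def r_def)
  have r2: "r\<^sup>2 < 1" using r by (simp add: power_less_one_iff)
  have y: "yy r > 0" using r yy_bounds by simp
  have hn: "hh r ^ n = W * h" using dim by (cases n) (auto simp: W_def h_def)
  have h': "hh' r = \<kappa> * r" using r by (simp add: \<kappa>_def kp_def hh'_def power2_eq_square power3_eq_cube)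
  have "chi (r\<^sup>2) = 1" using r2 by (intro chi_bounds(3)) simp
  moreover have "chi' (r\<^sup>2) = 0" using r2 by (simp add: chi'_def)
  ultimately have w: "ww r = W * h" "ww' r = N * W * (\<kappa> * r)"
    by (simp_all add: ww_def ww'_def hn h' N_def W_def)
  have ee: "e \<bullet> e = 1" using e by simp
  have xx: "x \<bullet> x = r * r" by (simp add: r_def dot_square_norm power2_eq_square)
  have rel: "2 * (h * h * (r * r - z * z)) * ?Jb + (N - 1) * ?J = P ((1 + yy r)\<^sup>2)"
  proof -
    have "aa z r + bb z r = (1 + yy r)\<^sup>2" using aabb(3)[OF r(1) _ z] r by simp
    with J_euler[of "bb z r" "aa z r"] show ?thesis
      using dim by (simp add: bb_def h_def N_def power2_eq_square of_nat_diff)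
  qed
  define R where "R = z * (N * W * \<kappa> * ?J + W * h * (2 * h * \<kappa> * (z * z) * ?Ja + (2 * h * \<kappa> * (r * r - z * z) + 2 * h * h) * ?Jb))"
  have AAr: "AAr z r = R * r" unfolding AAr_def w h' R_def power2_eq_square h_def[symmetric] by algebra
  have AAz: "AAz z r = W * h * (?J + 2 * (h * z * (h * z)) * (?Ja - ?Jb))"
    unfolding AAz_def w by (simp add: aa_def h_def power2_eq_square)
  have A: "A x = z * (W * h) * ?J" unfolding A_def AA_def z_def[symmetric] r_def[symmetric] w by simp
  have pA: "partial_deriv e A x = AAz z r + R * z"
    using r by (simp add: A_partial[OF x(1)] AAr ee flip: z_def r_def)
  have gv: "e \<bullet> grad v x = h + z * z * \<kappa>" "x \<bullet> grad v x = z * h + z * (r * r) * \<kappa>"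
    by (simp_all add: grad_v[OF x(1)] ee xx h_def \<kappa>_def inner_commute[of e x] flip: r_def z_def)
  have "u x \<bullet> grad v x = ((N - 1) * (z * (W * h) * ?J) + AAz z r * z + R * r * r) * (h + z * z * \<kappa>)
     - (AAz z r + R * z) * (z * h + z * (r * r) * \<kappa>)"
    unfolding u_inner[OF x(1)] z_def[symmetric] r_def[symmetric] gv A pA AAr N_def ..
  \<comment> \<open>All terms with \<open>Ja\<close> cancel, and \<open>J\<close> and
    \<open>Jb\<close> remain only in the combination of the Euler relation. The exponent in
    \<open>h^n\<close> is what removes the stray term of \<open>J\<close> cubic in
    \<open>z\<close>.\<close>
  also have "\<dots> = z * W * h * (\<kappa> * (r * r) + h) * (2 * (h * h * (r * r - z * z)) * ?Jb + (N - 1) * ?J)"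
    unfolding AAz R_def by algebra
  also have "\<dots> = z * (hh r ^ n * (\<kappa> * (r * r) + h)) * P ((1 + yy r)\<^sup>2)"
    unfolding rel hn by (simp add: algebra_simps)
  \<comment> \<open>The left side is the derivative of \<open>r h = 1 + y\<close>.\<close>
  also have "\<kappa> * (r * r) + h = beta * yy r / r"
    using r by (simp add: \<kappa>_def kp_def h_def hh_def qq_def power3_eq_cube field_simps)
  also have "hh r ^ n = (1 + yy r) ^ n / r ^ n" by (simp add: hh_def power_divide)
  also have "P ((1 + yy r)\<^sup>2) = yy r ^ Suc k * (- real m * (N - 1 + (1 - beta) * (N - 1 + beta) * yy r) / (1 + yy r) ^ n)"
    using P_eq[of "yy r"] y by (simp add: N_def beta_def)
  also have "z * ((1 + yy r) ^ n / r ^ n * (beta * yy r / r)) *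
      (yy r ^ Suc k * (- real m * (N - 1 + (1 - beta) * (N - 1 + beta) * yy r) / (1 + yy r) ^ n))
    = - (z * (N - 1 + (1 - beta) * (N - 1 + beta) * yy r)) * (yy r ^ Suc (Suc k) / (r ^ n * r)) * (beta * real m)"
  proof -
    have "z * (E / Q * (beta * yy r / r)) * (Y * (- real m * M / E)) = - (z * M) * (yy r * Y / (Q * r)) * (beta * real m)"
      if "E \<noteq> 0" for E Q Y M :: real using that by simp
    moreover have "(1 + yy r) ^ n \<noteq> 0" using y by simp
    ultimately show ?thesis by (simp only: power_Suc[of "yy r" "Suc k"])
  qed
  \<comment> \<open>The factor \<open>y\<close> from the derivative of \<open>r h\<close> has raised
    the power in \<open>P\<close> from \<open>k + 1\<close> to
    \<open>k + 2 = m (n - 2)\<close>.\<close>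
  also have "yy r ^ Suc (Suc k) / (r ^ n * r) = 1 / r ^ 3"
  proof -
    have "n = Suc (Suc (n - 2))" using dim by simp
    then have "r ^ n = r ^ (n - 2) * r * r" by (metis power_Suc2)
    then show ?thesis unfolding yy_power[OF r(1)] using r by (simp add: power3_eq_cube)
  qed
  also have "- (z * (N - 1 + (1 - beta) * (N - 1 + beta) * yy r)) * (1 / r ^ 3) * (beta * real m)
    = z * ((N - 1) * qq r + (beta - 1) * beta * yy r) / r ^ 3"
  proof -
    have num: "- (z * (N - 1 + (1 - beta) * (N - 1 + beta) * yy r)) = z * ((N - 1) * qq r + (beta - 1) * beta * yy r)"
      unfolding qq_def by algebra
    show ?thesis unfolding num beta(3) by simp
  qed
  finally show ?thesis unfolding laplacian_v[OF x(1)] z_def r_def N_def .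
qed

end

subsection \<open>The equation and the discontinuity\<close>

lemma Lp_on_sing:
  fixes f :: "'a::euclidean_space \<Rightarrow> 'b::euclidean_space"
  assumes f: "f \<in> borel_measurable borel" and S: "S \<in> sets borel" and K: "K \<ge> 0"
    and b: "\<And>x. x \<in> S \<Longrightarrow> x \<noteq> 0 \<Longrightarrow> norm x \<le> R \<Longrightarrow> norm (f x) \<le> K * norm x powr (- a)"
    and z: "\<And>x. x \<in> S \<Longrightarrow> norm x > R \<Longrightarrow> f x = 0" and p: "p > 0" "a * p < real DIM('a)"
  shows "Lp_on p S f"
  unfolding Lp_on_def
proof
  show "f \<in> borel_measurable (lebesgue_on S)" using f S by (rule lebesgue_on_lborel)
  have m: "(\<lambda>x. norm (f x) powr p) \<in> borel_measurable borel" using f by measurable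
  have "integrable lborel (\<lambda>x. indicator S x *\<^sub>R (norm (f x) powr p))"
  proof (rule integrable_sing[where R = R and K = "K powr p" and \<alpha> = "a * p"])
    fix x :: 'a assume x: "x \<noteq> 0" "norm x \<le> R"
    show "norm (indicator S x *\<^sub>R (norm (f x) powr p)) \<le> K powr p * norm x powr (- (a * p))"
    proof (cases "x \<in> S")
      case True
      have "norm (f x) powr p \<le> (K * norm x powr (- a)) powr p"
        using b[OF True x] p by (intro powr_mono2) auto
      also have "\<dots> = K powr p * norm x powr (- (a * p))"
        using K by (simp add: powr_mult powr_powr)
      finally show ?thesis using True by simp
    qed simp
  next
    show "norm x > R \<Longrightarrow> indicator S x *\<^sub>R (norm (f x) powr p) = 0" for x
      using z[of x] by (cases "x \<in> S") auto
  qed (use m S p in auto)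
  then show "integrable (lebesgue_on S) (\<lambda>x. norm (f x) powr p)"
    using lebesgue_on_lborel(1)[OF m S] by simp
qed

lemma integral_lebesgue_on_support:
  fixes f :: "'a::euclidean_space \<Rightarrow> real"
  assumes f: "f \<in> borel_measurable borel" "S \<in> sets borel" and z: "\<And>x. x \<notin> S \<Longrightarrow> f x = 0"
  shows "(LINT x|lebesgue_on S. f x) = (LINT x|lborel. f x)"
proof -
  have "(\<lambda>x. indicator S x *\<^sub>R f x) = f" using z by (auto simp: indicator_def fun_eq_iff)
  then show ?thesis using lebesgue_on_lborel(2)[OF f] by simp
qed

context drift
begin

section \<open>Integrability and divergence of the drift\<close>

lemma B_zero: "norm x > 2 \<Longrightarrow> B b x = 0"
  by (simp add: B_def A_zero)

lemma u_cont: "continuous_on (- {0}) u"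
  unfolding u_def using B_sing e by (intro continuous_intros) (auto simp: C1_sing_def)

lemma u_borel: "u \<in> borel_measurable borel"
  using u_cont by (rule borel_measurable_punctured_continuous)

lemma u_zero: "norm x > 2 \<Longrightarrow> u x = 0"
  unfolding u_def by (simp add: partial_deriv_zero_outside[where R = 2, OF B_zero])

lemma u_bound:
  obtains K where "K \<ge> 0" "\<And>x. x \<noteq> 0 \<Longrightarrow> norm x \<le> 2 \<Longrightarrow> norm (u x) \<le> K * norm x powr (- (1 + 2 * beta))"
proof -
  have "\<exists>K\<ge>0. \<forall>x. x \<noteq> 0 \<and> norm x \<le> 2 \<longrightarrow> (\<forall>c\<in>Basis. \<bar>partial_deriv c (B b) x\<bar> \<le> K * norm x powr (- (1 + 2 * beta)))"
    if "b \<in> Basis" for b using B_sing[OF that] unfolding C1_sing_def by blast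
  then obtain K where K: "\<And>b. b \<in> Basis \<Longrightarrow> K b \<ge> 0" "\<And>b x c. b \<in> Basis \<Longrightarrow> x \<noteq> 0 \<Longrightarrow> norm x \<le> 2 \<Longrightarrow>
      c \<in> Basis \<Longrightarrow> \<bar>partial_deriv c (B b) x\<bar> \<le> K b * norm x powr (- (1 + 2 * beta))"
    by metis
  show thesis
  proof (rule that)
    show "0 \<le> (\<Sum>b\<in>Basis. 2 * K b)" using K(1) by (intro sum_nonneg) auto
    fix x :: 'a assume x: "x \<noteq> 0" "norm x \<le> 2"
    have "norm (u x) \<le> (\<Sum>b\<in>Basis. norm (partial_deriv b (B b) x *\<^sub>R e - partial_deriv e (B b) x *\<^sub>R b))"
      unfolding u_def by (rule norm_sum)
    also have "\<dots> \<le> (\<Sum>b\<in>Basis. 2 * K b * norm x powr (- (1 + 2 * beta)))"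
    proof (rule sum_mono)
      fix b :: 'a assume b: "b \<in> Basis"
      have "norm (partial_deriv b (B b) x *\<^sub>R e - partial_deriv e (B b) x *\<^sub>R b)
        \<le> \<bar>partial_deriv b (B b) x\<bar> + \<bar>partial_deriv e (B b) x\<bar>"
        using norm_triangle_ineq4[of "partial_deriv b (B b) x *\<^sub>R e" "partial_deriv e (B b) x *\<^sub>R b"] b e by simp
      with K(2)[OF b x b] K(2)[OF b x e]
      show "norm (partial_deriv b (B b) x *\<^sub>R e - partial_deriv e (B b) x *\<^sub>R b) \<le> 2 * K b * norm x powr (- (1 + 2 * beta))"
        by linarith
    qed
    also have "\<dots> = (\<Sum>b\<in>Basis. 2 * K b) * norm x powr (- (1 + 2 * beta))" by (simp add: sum_distrib_right)
    finally show "norm (u x) \<le> (\<Sum>b\<in>Basis. 2 * K b) * norm x powr (- (1 + 2 * beta))" .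
  qed
qed

lemma u_Lp:
  assumes "p > 0" "(1 + 2 * beta) * p < real n"
  shows "Lp_on p UNIV u"
proof -
  obtain K where "K \<ge> 0" "\<And>x. x \<noteq> 0 \<Longrightarrow> norm x \<le> 2 \<Longrightarrow> norm (u x) \<le> K * norm x powr (- (1 + 2 * beta))"
    using u_bound by blast
  with assms u_borel u_zero n show ?thesis
    by (intro Lp_on_sing[where R = 2 and K = K and a = "1 + 2 * beta"]) auto
qed

lemma grad_test_cont:
  assumes "C1_cpt S p"
  shows "continuous_on UNIV (grad p)"
  unfolding grad_def using assms by (intro continuous_intros) (simp add: C1_cpt_def)

lemma u_div_free:
  assumes \<beta>: "1 + 2 * beta < real n"
  shows "div_free_on UNIV u"
  unfolding div_free_on_def
proof (intro conjI allI impI)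
  have \<alpha>: "1 + 2 * beta < real DIM('a)" using \<beta> n by simp
  obtain K where "K \<ge> 0" "\<And>x. x \<noteq> 0 \<Longrightarrow> norm x \<le> 2 \<Longrightarrow> norm (u x) \<le> K * norm x powr (- (1 + 2 * beta))"
    using u_bound by blast
  then have "integrable lborel u" using u_zero u_borel by (intro integrable_sing[OF _ _ _ \<alpha>]) auto
  then show "locally_integrable_on UNIV u"
    unfolding locally_integrable_on_def using u_borel
    by (auto intro!: integrable_lebesgue_on[where T = UNIV] intro: borel_compact)
  fix \<phi> :: "'a \<Rightarrow> real" assume "test_function_on UNIV \<phi>"
  then obtain S where \<phi>: "C1_cpt S \<phi>" using test_functionD[of _ \<phi>] by blast
  obtain E where "\<And>x. \<bar>\<phi> x\<bar> \<le> E" and E: "\<And>b x. b \<in> Basis \<Longrightarrow> \<bar>partial_deriv b \<phi> x\<bar> \<le> E"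
    using C1_cpt_bounded[OF \<phi>] by blast
  have cp: "continuous_on UNIV (partial_deriv b \<phi>)" if "b \<in> Basis" for b using \<phi> that by (simp add: C1_cpt_def)
  have int: "integrable lborel (\<lambda>x. partial_deriv c (B b) x * partial_deriv d \<phi> x)"
    if "b \<in> Basis" "c \<in> Basis" "d \<in> Basis" for b c d
    using B_zero partial_deriv_zero_outside[OF B_zero] E[OF that(3)]
    by (intro C1_sing_integrable(2)[OF B_sing[OF that(1)] _ \<alpha> that(2) cp[OF that(3)]]) auto
  have "(\<lambda>x. u x \<bullet> grad \<phi> x) \<in> borel_measurable borel"
    using u_borel borel_measurable_continuous_onI[OF grad_test_cont[OF \<phi>]] by simp
  then have "(LINT x|lebesgue_on UNIV. u x \<bullet> grad \<phi> x) = (LINT x|lborel. u x \<bullet> grad \<phi> x)"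
    by (rule integral_lebesgue_on_support) auto
  also have "\<dots> = (LINT x|lborel. (\<Sum>b\<in>Basis. partial_deriv b (B b) x * partial_deriv e \<phi> x - partial_deriv e (B b) x * partial_deriv b \<phi> x))"
  proof (intro Bochner_Integration.integral_cong refl)
    fix x
    have "b \<bullet> grad \<phi> x = partial_deriv b \<phi> x" if "b \<in> Basis" for b
      using grad_inner[OF that, of \<phi> x] by (simp only: inner_commute)
    then show "u x \<bullet> grad \<phi> x = (\<Sum>b\<in>Basis. partial_deriv b (B b) x * partial_deriv e \<phi> x - partial_deriv e (B b) x * partial_deriv b \<phi> x)"
      using e by (simp add: u_def inner_sum_left inner_diff_left)
  qed
  also have "\<dots> = (\<Sum>b\<in>Basis. (LINT x|lborel. partial_deriv b (B b) x * partial_deriv e \<phi> x) - (LINT x|lborel. partial_deriv e (B b) x * partial_deriv b \<phi> x))"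
    using int e by (subst Bochner_Integration.integral_sum) auto
  \<comment> \<open>Each plane curl vanishes separately, by exchanging the directions
    \<open>b\<close> and \<open>e\<close>.\<close>
  also have "\<dots> = 0"
    using integral_partial_deriv_swap_sing[OF B_sing B_zero \<alpha> _ e \<phi>] by (intro sum.neutral) auto
  finally show "(LINT x|lebesgue_on UNIV. u x \<bullet> grad \<phi> x) = 0" .
qed

section \<open>The solution in the unit ball\<close>

lemma v_borel: "v \<in> borel_measurable borel"
  using C1_sing_partial_borel(2)[OF v_sing e] .

lemma v_bound: "norm x \<le> 2 \<Longrightarrow> \<bar>v x\<bar> \<le> 3"
  using v_bounds(1)[OF _ _ e e, of x] by (cases "x = 0") (auto simp: v_def)

lemma grad_v_borel: "grad v \<in> borel_measurable borel"
proof -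
  have "continuous_on (- {0}) (grad v)"
    unfolding grad_def using v_sing by (intro continuous_intros) (auto simp: C1_sing_def)
  then show ?thesis by (rule borel_measurable_punctured_continuous)
qed

lemma grad_v_bound:
  assumes "x \<noteq> 0" "norm x \<le> 2"
  shows "norm (grad v x) \<le> real n * 6 * norm x powr (- 1)"
proof -
  have "norm (grad v x) \<le> (\<Sum>b\<in>Basis. norm (partial_deriv b v x *\<^sub>R b))"
    unfolding grad_def by (rule norm_sum)
  also have "\<dots> \<le> (\<Sum>b\<in>(Basis::'a set). 6 / norm x)"
    using v_bounds(2)[OF assms _ e] by (intro sum_mono) simp
  finally show ?thesis using n assms by (simp add: powr_minus divide_inverse)
qed

lemma laplacian_v_bound:
  assumes "x \<noteq> 0" "norm x \<le> 2"
  shows "\<bar>laplacian v x\<bar> \<le> real n * 20 * norm x powr (- 2)"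
proof -
  have "\<bar>laplacian v x\<bar> \<le> (\<Sum>b\<in>Basis. \<bar>partial_deriv b (partial_deriv b v) x\<bar>)"
    unfolding laplacian_def by (rule sum_abs)
  also have "\<dots> \<le> (\<Sum>b\<in>(Basis::'a set). 20 / (norm x)\<^sup>2)"
    using v_bounds(3)[OF assms] by (intro sum_mono) simp
  finally show ?thesis using n assms by (simp add: powr_minus powr_numeral divide_inverse)
qed

lemma local_integrable_ball:
  fixes f :: "'a \<Rightarrow> 'b::euclidean_space"
  assumes f: "f \<in> borel_measurable borel" and b: "\<And>x. x \<noteq> 0 \<Longrightarrow> norm x < 1 \<Longrightarrow> norm (f x) \<le> K * norm x powr (- \<alpha>)"
    and K: "K \<ge> 0" and \<alpha>: "\<alpha> < real n"
  shows "locally_integrable_on (ball 0 1) f"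
proof -
  have m: "(\<lambda>x. indicator (ball 0 1) x *\<^sub>R f x) \<in> borel_measurable borel"
    using f by (intro borel_measurable_scaleR borel_measurable_indicator) auto
  have "integrable lborel (\<lambda>x. indicator (ball 0 1) x *\<^sub>R f x)"
  proof (rule integrable_sing[where R = 1 and K = K and \<alpha> = \<alpha>])
    show "norm (indicator (ball 0 1) x *\<^sub>R f x) \<le> K * norm x powr - \<alpha>" if "x \<noteq> 0" for x
      using b[OF that] K by (cases "norm x < 1") auto
  qed (use m \<alpha> n in auto)
  then show ?thesis
    unfolding locally_integrable_on_def using f
    by (auto intro!: integrable_lebesgue_on[where T = "ball 0 1"] intro: borel_compact)
qed

text \<open>The classical gradient off the origin is the weak one, since its blow-up order 1 is
  below the dimension and the singularity therefore carries no mass.\<close>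

lemma v_weak_gradient: "weak_gradient_on (ball 0 1) v (grad v)"
  unfolding weak_gradient_on_def
proof (intro conjI allI impI ballI)
  show "locally_integrable_on (ball 0 1) v"
    using v_borel v_bound dim by (intro local_integrable_ball[where K = 3 and \<alpha> = 0]) auto
  show "locally_integrable_on (ball 0 1) (grad v)"
    using grad_v_borel grad_v_bound dim by (intro local_integrable_ball[where K = "real n * 6" and \<alpha> = 1]) auto
  fix \<phi> :: "'a \<Rightarrow> real" and b :: 'a
  assume "test_function_on (ball 0 1) \<phi>" and b: "b \<in> Basis"
  then obtain S where \<phi>: "C1_cpt S \<phi>" and z: "\<And>x. x \<notin> ball 0 1 \<Longrightarrow> \<phi> x = 0" "\<And>x b. x \<notin> ball 0 1 \<Longrightarrow> partial_deriv b \<phi> x = 0"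
    using test_functionD[of _ \<phi>] by blast
  have z2: "\<phi> x = 0" if "norm x > 2" for x using that by (intro z) simp
  have \<alpha>: "1 < real DIM('a)" using dim n by simp
  note ibp = integral_by_parts_sing[OF v_sing _ \<alpha> b \<phi> z2, simplified]
  have "(LINT x|lebesgue_on (ball 0 1). v x * partial_deriv b \<phi> x) = (LINT x|lborel. v x * partial_deriv b \<phi> x)"
    using ibp(2) z(2) by (intro integral_lebesgue_on_support) auto
  also have "\<dots> = - (LINT x|lborel. partial_deriv b v x * \<phi> x)" by (rule ibp)
  also have "(LINT x|lborel. partial_deriv b v x * \<phi> x) = (LINT x|lebesgue_on (ball 0 1). partial_deriv b v x * \<phi> x)"
    using ibp(3) z(1) by (intro integral_lebesgue_on_support[symmetric]) auto
  finally show "(LINT x|lebesgue_on (ball 0 1). v x * partial_deriv b \<phi> x) = - (LINT x|lebesgue_on (ball 0 1). (grad v x \<bullet> b) * \<phi> x)"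
    using b by (simp add: grad_inner)
qed

text \<open>The squared gradient is O(1/r^2), which is integrable for
  \<open>n \<ge> 3\<close>.\<close>

lemma v_H1: "H1_on (ball 0 1) v"
proof -
  have n3: "2 < real DIM('a)" using dim n by simp
  have "Lp_on 2 (ball 0 1) v"
    using v_borel v_bound by (intro Lp_on_sing[where R = 1 and K = 3 and a = 0]) auto
  moreover have "Lp_on 2 (ball 0 1) (grad v)"
    using grad_v_borel grad_v_bound n3 by (intro Lp_on_sing[where R = 1 and K = "real n * 6" and a = 1]) auto
  ultimately show ?thesis unfolding H1_on_def using v_weak_gradient by blast
qed

text \<open>Two integrations by parts move the Laplacian from the test function to \<open>v\<close>,
  with orders 1 and 2 below the dimension; then the pointwise equation applies off the origin. The
  same equation yields local integrability of \<open>u \<bullet> grad v\<close>, which is bounded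
  through the Laplacian as O(1/r^2).\<close>

lemma v_solution: "weak_solution_on (ball 0 1) u v"
  unfolding weak_solution_on_def
proof (intro conjI exI[of _ "grad v"] allI impI)
  show "H1_on (ball 0 1) v" by (rule v_H1)
  show "weak_gradient_on (ball 0 1) v (grad v)" by (rule v_weak_gradient)
  have ug: "(\<lambda>x. u x \<bullet> grad v x) \<in> borel_measurable borel" using u_borel grad_v_borel by simp
  show "locally_integrable_on (ball 0 1) (\<lambda>x. u x \<bullet> grad v x)"
    using ug laplacian_v_bound u_grad_v dim by (intro local_integrable_ball[where K = "real n * 20" and \<alpha> = 2]) auto
  fix \<phi> :: "'a \<Rightarrow> real" assume "test_function_on (ball 0 1) \<phi>"
  then obtain S where \<phi>: "C1_cpt S \<phi>" "\<And>b. b \<in> Basis \<Longrightarrow> C1_cpt S (partial_deriv b \<phi>)"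
    and z: "\<And>x. x \<notin> ball 0 1 \<Longrightarrow> \<phi> x = 0" "\<And>x b. x \<notin> ball 0 1 \<Longrightarrow> partial_deriv b \<phi> x = 0"
    "\<And>x. x \<notin> ball 0 1 \<Longrightarrow> laplacian \<phi> x = 0"
    using test_functionD[of _ \<phi>] by blast
  have z2: "\<phi> x = 0" "partial_deriv b \<phi> x = 0" if "norm x > 2" for x b using that by (auto intro!: z)
  have \<alpha>: "1 < real DIM('a)" "2 < real DIM('a)" using dim n by simp_all
  note ibp1 = integral_by_parts_sing[OF v_sing _ \<alpha>(1) _ \<phi>(2) z2(2), simplified]
  note ibp2 = integral_by_parts_sing[OF vv_sing _ \<alpha>(2) _ \<phi>(1) z2(1), simplified]
  have i1: "integrable lborel (\<lambda>x. v x * laplacian \<phi> x)"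
    unfolding laplacian_def sum_distrib_left by (intro Bochner_Integration.integrable_sum ibp1)
  have i2: "integrable lborel (\<lambda>x. laplacian v x * \<phi> x)"
    unfolding laplacian_def sum_distrib_right by (intro Bochner_Integration.integrable_sum ibp2)
  have "(LINT x|lebesgue_on (ball 0 1). v x * laplacian \<phi> x) = (LINT x|lborel. v x * laplacian \<phi> x)"
    using i1 z(3) by (intro integral_lebesgue_on_support) auto
  also have "\<dots> = (\<Sum>b\<in>Basis. LINT x|lborel. v x * partial_deriv b (partial_deriv b \<phi>) x)"
    unfolding laplacian_def sum_distrib_left by (intro Bochner_Integration.integral_sum ibp1)
  also have "\<dots> = (\<Sum>b\<in>Basis. LINT x|lborel. partial_deriv b (partial_deriv b v) x * \<phi> x)"
    by (intro sum.cong refl) (simp add: ibp1 ibp2)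
  also have "\<dots> = (LINT x|lborel. laplacian v x * \<phi> x)"
    unfolding laplacian_def sum_distrib_right by (intro Bochner_Integration.integral_sum[symmetric] ibp2)
  also have "\<dots> = (LINT x|lborel. (u x \<bullet> grad v x) * \<phi> x)"
  proof (rule integral_cong_AE)
    show "(\<lambda>x. laplacian v x * \<phi> x) \<in> borel_measurable lborel" using i2 by auto
    show "(\<lambda>x. (u x \<bullet> grad v x) * \<phi> x) \<in> borel_measurable lborel"
      using ug borel_measurable_continuous_onI[OF C1_cpt_cont[OF \<phi>(1)]] by simp
    show "AE x in lborel. laplacian v x * \<phi> x = (u x \<bullet> grad v x) * \<phi> x"
      using AE_lborel_nonzero
    proof eventually_elim
      case (elim x)
      then show ?case using u_grad_v[of x] z(1)[of x] by (cases "norm x < 1") auto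
    qed
  qed
  also have "\<dots> = (LINT x|lebesgue_on (ball 0 1). (u x \<bullet> grad v x) * \<phi> x)"
    using ug borel_measurable_continuous_onI[OF C1_cpt_cont[OF \<phi>(1)]] z(1)
    by (intro integral_lebesgue_on_support[symmetric]) auto
  finally show "- (LINT x|lebesgue_on (ball 0 1). v x * laplacian \<phi> x) + (LINT x|lebesgue_on (ball 0 1). (u x \<bullet> grad v x) * \<phi> x) = 0"
    by simp
qed

lemma v_ess_bounded: "ess_bounded_on (ball 0 1) v"
  unfolding ess_bounded_on_def by (intro exI[of _ 3] AE_I2) (auto simp: v_bound)

text \<open>Every neighbourhood of the origin meets two open cones around the opposite half axes, on
  which \<open>v\<close> exceeds 4/5 and stays below -4/5 respectively. Nonempty open sets are not
  negligible, so a function equal to \<open>v\<close> almost everywhere takes such values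
  arbitrarily near the origin.\<close>

lemma v_discontinuous:
  assumes ae: "AE x in lebesgue_on (ball 0 1). w x = v x" and c: "isCont w 0"
  shows False
proof -
  have "AE x in lebesgue. x \<in> ball 0 1 \<longrightarrow> w x = v x"
    using ae by (subst (asm) AE_restrict_space_iff) auto
  then obtain N where N: "negligible N" "{x. \<not> (x \<in> ball 0 1 \<longrightarrow> w x = v x)} \<subseteq> N"
    unfolding eventually_ae_filter_negligible by blast
  obtain d where d: "d > 0" "\<And>x. norm x < d \<Longrightarrow> \<bar>w x - w 0\<bar> < 1/2"
    using c unfolding continuous_at_eps_delta by (force simp: dist_norm dest: spec[of _ "1/2"])
  have ex: "\<exists>x. x \<noteq> 0 \<and> norm x < d \<and> w x = v x \<and> s * (x \<bullet> e) > 4/5 * norm x" if s: "\<bar>s\<bar> = 1" for s :: real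
  proof -
    define U where "U = {x::'a. norm x < min d 1} \<inter> {x. 4/5 * norm x < s * (x \<bullet> e)}"
    define t where "t = min d 1 / 2"
    have t: "0 < t" "t < min d 1" using d by (auto simp: t_def)
    have "open U" unfolding U_def by (intro open_Int open_Collect_less continuous_intros)
    moreover have "(s * t) *\<^sub>R e \<in> U"
    proof -
      have "s * s = 1" using s by (auto simp: abs_if split: if_splits)
      then have "s * (((s * t) *\<^sub>R e) \<bullet> e) = t" using e by (simp add: mult.assoc[symmetric])
      moreover have "norm ((s * t) *\<^sub>R e) = t" using t s e by (simp add: abs_mult)
      ultimately show ?thesis unfolding U_def using t by simp
    qed
    ultimately have "\<not> negligible U" using open_not_negligible by blast
    then have "\<not> U \<subseteq> N" using N(1) negligible_subset by blast
    then obtain x where x: "x \<in> U" "x \<notin> N" by blast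
    then have "w x = v x" using N(2) by (auto simp: U_def)
    moreover have "x \<noteq> 0" using x by (auto simp: U_def)
    ultimately show ?thesis using x by (auto simp: U_def)
  qed
  \<comment> \<open>Since \<open>r h(r) = 1 + y\<close> is at least 1, \<open>v\<close> inherits the
    lower bound 4/5 of \<open>s (x \<bullet> e) / r\<close> in the cone.\<close>
  have hr: "hh r * r \<ge> 1" "hh r > 0" if "r > 0" for r
    using that by (auto simp: hh_def yy_def add_pos_pos)
  have vl: "s * v x > 4/5" if x: "x \<noteq> 0" "s * (x \<bullet> e) > 4/5 * norm x" for x s
  proof -
    have "4/5 \<le> 4/5 * (hh (norm x) * norm x)" using hr(1)[of "norm x"] x by simp
    also have "\<dots> = (4/5 * norm x) * hh (norm x)" by simp
    also have "\<dots> < s * (x \<bullet> e) * hh (norm x)" using x hr(2)[of "norm x"] by (intro mult_strict_right_mono) auto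
    finally show ?thesis by (simp add: v_def)
  qed
  obtain x where x: "x \<noteq> 0" "norm x < d" "w x = v x" "1 * (x \<bullet> e) > 4/5 * norm x" using ex[of 1] by auto
  obtain y where y: "y \<noteq> 0" "norm y < d" "w y = v y" "- 1 * (y \<bullet> e) > 4/5 * norm y" using ex[of "- 1"] by auto
  \<comment> \<open>\<open>w x - w y\<close> exceeds 8/5, while both values lie within 1/2 of
    \<open>w 0\<close>.\<close>
  show False
    using vl[OF x(1,4)] vl[OF y(1,4)] d(2)[OF x(2)] d(2)[OF y(2)] x(3) y(3) by linarith
qed

end

section \<open>Choice of the parameters and conclusion\<close>

theorem theorem1p7:
  fixes lam :: real
  assumes "CARD('n::finite) \<ge> 3"
    and "0 < lam" and "lam < real CARD('n) - 1"
  shows "\<exists>u :: real ^ 'n \<Rightarrow> real ^ 'n.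
           Lp_on (real CARD('n) - lam) UNIV u \<and> div_free_on UNIV u \<and>
           (\<exists>v :: real ^ 'n \<Rightarrow> real.
              weak_solution_on (ball 0 1) u v \<and> ess_bounded_on (ball 0 1) v \<and>
              \<not> (\<exists>w. (AE x in lebesgue_on (ball 0 1). w x = v x) \<and> isCont w 0))"
proof -
  define n where "n = CARD('n)"
  define p where "p = real n - lam"
  have n3: "n \<ge> 3" and p: "p > 1" "p < real n" using assms by (auto simp: n_def p_def)
  obtain m0 :: nat where m0: "real m0 > 2 * p / lam" using reals_Archimedean2 by blast
  \<comment> \<open>\<open>m \<ge> m0\<close> gives \<open>2 p / m < lam\<close>, hence
    \<open>(1 + 2 beta) p < p + lam = n\<close>. \<open>m \<ge> 3\<close> gives
    \<open>k \<ge> 1\<close> even when \<open>n = 3\<close>.\<close>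
  define m where "m = max 3 m0"
  have mb: "m \<ge> 3" "2 * p < lam * real m"
  proof -
    show "m \<ge> 3" by (simp add: m_def)
    have "2 * p / lam < real m" using m0 by (simp add: m_def)
    then show "2 * p < lam * real m" using assms(2) by (simp add: divide_less_eq mult.commute)
  qed
  have mn: "3 * 1 \<le> m * (n - 2)" using mb n3 by (intro mult_le_mono) auto
  define k where "k = m * (n - 2) - 2"
  have k: "Suc (Suc k) = m * (n - 2)" "k \<ge> 1" using mn by (auto simp: k_def)
  define \<mu> where "\<mu> = (1 - 1 / real m) * (real n - 1 + 1 / real m)"
  \<comment> \<open>The second factor prescribed by \<open>P_eq\<close>, with
    \<open>y = sqrt s - 1\<close>. It matters only for \<open>s \<ge> 1\<close>, where
    \<open>P\<close> is supported.\<close>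
  define g where "g s = - real m * (real n - 1 + \<mu> * (sqrt s - 1)) / sqrt s ^ n" for s :: real
  define g' where "g' s = (- real m * (\<mu> * (inverse (sqrt s) / 2)) * sqrt s ^ n
     - - real m * (real n - 1 + \<mu> * (sqrt s - 1)) * (real n * (inverse (sqrt s) / 2 * sqrt s ^ (n - 1)))) / (sqrt s ^ n * sqrt s ^ n)" for s :: real
  have dg: "(g has_real_derivative g' s) (at s)" if s: "s > 0" for s
  proof -
    note r = DERIV_real_sqrt[OF s]
    have "((\<lambda>s. - real m * (real n - 1 + \<mu> * (sqrt s - 1))) has_real_derivative - real m * (\<mu> * (inverse (sqrt s) / 2))) (at s)"
      by (rule DERIV_cong[OF DERIV_cmult[OF DERIV_add[OF DERIV_const DERIV_cmult[OF DERIV_diff[OF r DERIV_const]]]]]) simp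
    from DERIV_divide[OF this DERIV_power[OF r, of n]] show ?thesis
      unfolding g_def [abs_def] g'_def using s by (rule_tac DERIV_cong) auto
  qed
  have cg: "continuous_on {0<..} g'" unfolding g'_def by (intro continuous_intros) auto
  obtain P P' C where P: "\<And>s. (P has_real_derivative P' s) (at s)" "continuous_on UNIV P'" "C \<ge> 0"
    "\<And>s. s \<le> 9 \<Longrightarrow> \<bar>P s\<bar> \<le> C * max 0 (sqrt s - 1) ^ Suc k"
    "\<And>s. s \<le> 9 \<Longrightarrow> \<bar>P' s\<bar> \<le> C * max 0 (sqrt s - 1) ^ k"
    "\<And>s. s \<ge> 1 \<Longrightarrow> P s = (sqrt s - 1) ^ Suc k * g s"
    using profile_exists[OF dg cg k(2)] by blast
  obtain e :: "real ^ 'n" where e: "e \<in> Basis" using nonempty_Basis by blast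
  interpret drift e n m k P P' C
  proof
    show "n = DIM(real ^ 'n)" by (simp add: n_def)
    show "P ((1 + y)\<^sup>2) = y ^ Suc k * (- real m * (real n - 1 + (1 - 1 / real m) * (real n - 1 + 1 / real m) * y) / (1 + y) ^ n)"
      if y: "y \<ge> 0" for y
    proof -
      have "(1 + y)\<^sup>2 \<ge> 1" using y by (intro one_le_power) simp
      moreover have "sqrt ((1 + y)\<^sup>2) = 1 + y" using y by simp
      ultimately show ?thesis using P(6)[of "(1 + y)\<^sup>2"] by (simp only: g_def \<mu>_def) simp
    qed
  qed (use e n3 mb k P in auto)
  have b: "(1 + 2 * beta) * p < real n"
  proof -
    have "(1 + 2 * beta) * p = p + 2 * p / real m" by (simp add: beta_def distrib_right)
    also have "2 * p / real m < lam" using mb by (simp add: divide_less_eq)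
    finally show ?thesis by (simp add: p_def)
  qed
  moreover have "1 + 2 * beta < real n"
  proof -
    \<comment> \<open>Here \<open>p > 1\<close>, that is \<open>lam < n - 1\<close>, enters: the
      order of \<open>u\<close> itself is then below \<open>n\<close>, which makes \<open>u\<close>
      integrable.\<close>
    have "1 + 2 * beta \<le> (1 + 2 * beta) * p" using mult_left_mono[of 1 p "1 + 2 * beta"] p beta(1) by simp
    then show ?thesis using b by (rule le_less_trans)
  qed
  ultimately have "Lp_on p UNIV u" "div_free_on UNIV u" using u_Lp[of p] u_div_free p by auto
  then show ?thesis
    unfolding n_def[symmetric] p_def[symmetric]
    using v_solution v_ess_bounded v_discontinuous by blast
qed

end
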